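(* Let $\Omega=[0,1]\setminus\mathbf{Q}$ and $\mathbf{N}=\{1,2,3,\ldots\}$, let $\{s_i:i\in\mathbf{N}\}$ be the canonical generators of the Cuntz algebra $\mathcal{O}_\infty$, and let $(l_2(\Omega),\pi_\alpha)$ be the representation of $\mathcal{O}_\infty$ given by $$\pi_\alpha(s_i)e_x=e_{\alpha_i(x)},\qquad \alpha_i(x)=\frac{1}{x+i}\qquad(x\in\Omega,\ i\in\mathbf{N}).$$ For $x\in\Omega$ let $[x]=\{y\in\Omega: y\sim x\}$ be the equivalence class of $x$ in $\Omega$ with respect to modular transformations (in the broad sense), and let $\Omega/\!\sim$ be the set of these classes. (i) The following irreducible decomposition holds: $$l_2(\Omega)=\bigoplus_{[x]\in\Omega/\sim}\mathcal{H}_{[x]},$$ where $\mathcal{H}_{[x]}$ denotes the closed subspace of $l_2(\Omega)$ generated by $\{e_y:y\in[x]\}$; that is, this is an orthogonal direct sum, each $\mathcal{H}_{[x]}$ is invariant under $\pi_\alpha(\mathcal{O}_\infty)$, and each restriction $\pi_\alpha|_{\mathcal{H}_{[x]}}$ is irreducible. (ii) For $x\in\Omega$, let $\eta_{[x]}=\pi_\alpha|_{\mathcal{H}_{[x]}}$ be the subrepresentation of $\pi_\alpha$ on $\mathcal{H}_{[x]}$. Then, for $x,y\in\Omega$, $\eta_{[x]}$ and $\eta_{[y]}$ are unitarily equivalent if and only if $x\sim y$. Especially, the decomposition in (i) is multiplicity free. (iii) Let $\mathsf{CFE}:\Omega\to\mathbf{N}^\infty$ be the continued fraction expansion map, and let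 $\Omega^{(2)}$ be the set of all quadratic irrationals in $\Omega$. (a) If $x\in\Omega\setminus\Omega^{(2)}$, then $\eta_{[x]}$ is $P(\mathsf{CFE}(x))$. (b) If $x\in\Omega^{(2)}$, then $\eta_{[x]}$ is $P(\mathsf{CFE}_0(x))$, where $\mathsf{CFE}_0(x)$ denotes the repeating block of $\mathsf{CFE}(x)$. (iv) Any irreducible permutative representation of $\mathcal{O}_\infty$ is unitarily equivalent to $\eta_{[x]}$ for some $[x]\in\Omega/\!\sim$.
   Context: Cuntz algebra and representations. $\mathcal{O}_\infty$ is the C$^*$-algebra universally generated by $\{s_i:i\in\mathbf{N}\}$ satisfying $s_i^*s_j=\delta_{ij}I$ ($i,j\in\mathbf{N}$) and $\sum_{i=1}^k s_is_i^*\le I$ ($k\in\mathbf{N}$), where $I$ is the unit. Any family of bounded operators on a Hilbert space satisfying the same relations determines a unique unital $*$-representation of $\mathcal{O}_\infty$. A representation is a pair $(\mathcal{H},\pi)$ with $\mathcal{H}$ a complex Hilbert space and $\pi$ a $*$-homomorphism from $\mathcal{O}_\infty$ to the bounded linear operators on $\mathcal{H}$. Representations $(\mathcal{H}_1,\pi_1)$ and $(\mathcal{H}_2,\pi_2)$ are unitarily equivalent if there is a unitary $u:\mathcal{H}_1\to\mathcal{H}_2$ (onto) with $u\pi_1(A)u^*=\pi_2(A)$ for all $A\in\mathcal{O}_\infty$. $(\mathcal{H},\pi)$ is irreducible if it has no invariant closed subspace except $\{0\}$ and $\mathcal{H}$; it is multiplicity free if no two (distinct) subrepresentations are unitarily equivalent.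 For a nonempty set $A$, $l_2(A)$ is the complex Hilbert space with orthonormal (standard) basis $\{e_a:a\in A\}$. Permutative representations. A representation $(\mathcal{H},\pi)$ of $\mathcal{O}_\infty$ is permutative if there is an orthonormal basis $\mathcal{E}$ of $\mathcal{H}$ with $\pi(s_i)\mathcal{E}\subset\mathcal{E}$ for each $i\in\mathbf{N}$; here it is part of the convention that $\mathcal{H}=\bigoplus_{i\in\mathbf{N}}\pi(s_i)\mathcal{H}$ (orthogonal Hilbert space direct sum), equivalently $\mathcal{E}=\bigcup_{i\in\mathbf{N}}\pi(s_i)\mathcal{E}$. The classes $P(J)$. For $J=(j_l)_{l=1}^k\in\mathbf{N}^k$ with $1\le k<\infty$, $P(J)$ is the class of representations $(\mathcal{H},\pi)$ of $\mathcal{O}_\infty$ having a cyclic unit vector $v\in\mathcal{H}$ such that $\pi(s_J)v=v$ and $\{\pi(s_{j_l}\cdots s_{j_k})v\}_{l=1}^k$ is an orthonormal family, where $s_J=s_{j_1}\cdots s_{j_k}$. For $J=(j_l)_{l\ge1}\in\mathbf{N}^\infty$ (the set of infinite sequences in $\mathbf{N}$), $P(J)$ is the class of representations $(\mathcal{H},\pi)$ of $\mathcal{O}_\infty$ having a cyclic unit vector $v\in\mathcal{H}$ such that $\{\pi(s_{J_{(n)}})^*v:n\in\mathbf{N}\}$ is an orthonormal family, where $J_{(n)}=(j_1,\ldots,j_n)$ and $s_{J_{(n)}}=s_{j_1}\cdots s_{j_n}$. Each $P(J)$ is nonempty and consists of a single unitary equivalence class, so $P(J)$ is identified with any representative; "$\pi$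 is $P(J)$" means that $\pi$ belongs to the class $P(J)$. Equivalence of real numbers. For real $x,y$, $x\sim y$ means that $x=\frac{ay+b}{cy+d}$ for some $a,b,c,d\in\mathbf{Z}$ with $ad-bc=\pm1$ (a modular transformation in the broad sense). Continued fractions. Each $x\in\Omega$ has a unique infinite simple continued fraction expansion $$x=\cfrac{1}{a_1(x)+\cfrac{1}{a_2(x)+\cfrac{1}{a_3(x)+\ddots}}}$$ with $a_i(x)\in\mathbf{N}$; set $\mathsf{CFE}(x)=(a_i(x))_{i\ge1}\in\mathbf{N}^\infty$. An $x\in\Omega$ is a quadratic irrational if it is a solution of a quadratic equation with integral coefficients. For a quadratic irrational $x$ one has $\mathsf{CFE}(x)=(m_1,\ldots,m_l,n_1,\ldots,n_k,n_1,\ldots,n_k,\ldots)$ for some finite (possibly empty) initial block $(m_1,\ldots,m_l)$ and a nonperiodic finite sequence $(n_1,\ldots,n_k)\in\mathbf{N}^k$, where nonperiodic means that it is not fixed by any nontrivial cyclic permutation of its entries. The sequence $(n_1,\ldots,n_k)$ is called the repeating block of $\mathsf{CFE}(x)$, where it is supposed that there is no shorter such repeating block and that the initial block does not end with a copy of the repeating block. *)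

theory Defs
  imports "HOL-Analysis.Analysis"
begin

section \<open>Complex Hilbert spaces and unital C*-algebras\<close>

class scaleC =
  fixes scaleC :: "complex \<Rightarrow> 'a \<Rightarrow> 'a"  (infixr "*\<^sub>C" 75)

class complex_vector = real_vector + scaleC +
  assumes scaleC_add_right: "a *\<^sub>C (x + y) = a *\<^sub>C x + a *\<^sub>C y"
    and scaleC_add_left: "(a + b) *\<^sub>C x = a *\<^sub>C x + b *\<^sub>C x"
    and scaleC_scaleC: "a *\<^sub>C b *\<^sub>C x = (a * b) *\<^sub>C x"
    and scaleC_one: "1 *\<^sub>C x = x"
    and scaleR_scaleC: "r *\<^sub>R x = complex_of_real r *\<^sub>C x"

global_interpretation complex_vector: vector_space "scaleC :: complex \<Rightarrow> 'a \<Rightarrow> 'a::complex_vector"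
  defines csubspace = complex_vector.subspace
    and cspan = complex_vector.span
  by unfold_locales (auto simp: scaleC_add_right scaleC_add_left scaleC_scaleC scaleC_one)

text \<open>The complex inner product is linear in its first argument. Its real part is the real inner
  product of the library, so the norm is the one induced by \<open>cinner\<close>.\<close>

class complex_inner = complex_vector + real_inner +
  fixes cinner :: "'a \<Rightarrow> 'a \<Rightarrow> complex"
  assumes cinner_commute: "cinner x y = cnj (cinner y x)"
    and cinner_add_left: "cinner (x + y) z = cinner x z + cinner y z"
    and cinner_scaleC_left: "cinner (c *\<^sub>C x) y = c * cinner x y"
    and inner_eq_Re_cinner: "inner x y = Re (cinner x y)"

class chilbert_space = complex_inner + complete_space

class cstar_algebra_1 = complex_vector + real_normed_algebra_1 + complete_space +
  fixes star :: "'a \<Rightarrow> 'a"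
  assumes norm_scaleC: "norm (c *\<^sub>C x) = cmod c * norm x"
    and mult_scaleC_left: "(c *\<^sub>C x) * y = c *\<^sub>C (x * y)"
    and mult_scaleC_right: "x * (c *\<^sub>C y) = c *\<^sub>C (x * y)"
    and star_add: "star (x + y) = star x + star y"
    and star_scaleC: "star (c *\<^sub>C x) = cnj c *\<^sub>C star x"
    and star_mult: "star (x * y) = star y * star x"
    and star_star: "star (star x) = x"
    and cstar_identity: "norm (star x * x) = (norm x)\<^sup>2"


section \<open>The Hilbert space \<open>l\<^sub>2\<close>\<close>

typedef 'a ell2 = "{f :: 'a \<Rightarrow> complex. (\<lambda>a. (cmod (f a))\<^sup>2) summable_on UNIV}"
  morphisms ell2_coeff Abs_ell2
  by (intro exI[of _ "\<lambda>_. 0"]) auto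

setup_lifting type_definition_ell2

lemma ell2_coeff_summable: "(\<lambda>a. (cmod (ell2_coeff f a))\<^sup>2) summable_on UNIV"
  using ell2_coeff[of f] by simp

lemma ell2_coeff_Abs: "(\<lambda>a. (cmod (f a))\<^sup>2) summable_on UNIV \<Longrightarrow> ell2_coeff (Abs_ell2 f) = f"
  by (simp add: Abs_ell2_inverse)

lemma sq_summable_add:
  fixes f g :: "'a \<Rightarrow> complex"
  assumes "(\<lambda>a. (cmod (f a))\<^sup>2) summable_on UNIV" "(\<lambda>a. (cmod (g a))\<^sup>2) summable_on UNIV"
  shows "(\<lambda>a. (cmod (f a + g a))\<^sup>2) summable_on UNIV"
proof (rule summable_on_comparison_test)
  show "(\<lambda>a. 2 * (cmod (f a))\<^sup>2 + 2 * (cmod (g a))\<^sup>2) summable_on UNIV"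
    by (intro summable_on_add summable_on_cmult_right assms)
next
  fix a
  have "(cmod (f a + g a))\<^sup>2 \<le> (cmod (f a) + cmod (g a))\<^sup>2"
    by (intro power_mono norm_triangle_ineq) auto
  also have "\<dots> \<le> 2 * (cmod (f a))\<^sup>2 + 2 * (cmod (g a))\<^sup>2"
    using sum_squares_bound[of "cmod (f a)" "cmod (g a)"] by (simp add: power2_sum)
  finally show "(cmod (f a + g a))\<^sup>2 \<le> 2 * (cmod (f a))\<^sup>2 + 2 * (cmod (g a))\<^sup>2" .
qed auto

lemma sq_summable_scale:
  fixes f :: "'a \<Rightarrow> complex"
  assumes "(\<lambda>a. (cmod (f a))\<^sup>2) summable_on UNIV"
  shows "(\<lambda>a. (cmod (c * f a))\<^sup>2) summable_on UNIV"
  using summable_on_cmult_right[OF assms, of "(cmod c)\<^sup>2"] by (simp add: norm_mult power_mult_distrib)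

lemma prod_summable: "(\<lambda>a. ell2_coeff f a * cnj (ell2_coeff g a)) summable_on UNIV"
proof (rule abs_summable_summable, rule Infinite_Sum.abs_summable_on_comparison_test')
  show "(\<lambda>a. (cmod (ell2_coeff f a))\<^sup>2 + (cmod (ell2_coeff g a))\<^sup>2) summable_on UNIV"
    by (intro summable_on_add ell2_coeff_summable)
next
  fix a
  have "2 * (cmod (ell2_coeff f a) * cmod (ell2_coeff g a)) \<le> (cmod (ell2_coeff f a))\<^sup>2 + (cmod (ell2_coeff g a))\<^sup>2"
    using sum_squares_bound[of "cmod (ell2_coeff f a)" "cmod (ell2_coeff g a)"] by simp
  moreover have "0 \<le> cmod (ell2_coeff f a) * cmod (ell2_coeff g a)"
    by (intro mult_nonneg_nonneg) auto
  ultimately have "cmod (ell2_coeff f a) * cmod (ell2_coeff g a)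
      \<le> (cmod (ell2_coeff f a))\<^sup>2 + (cmod (ell2_coeff g a))\<^sup>2"
    by linarith
  then show "norm (ell2_coeff f a * cnj (ell2_coeff g a))
      \<le> (cmod (ell2_coeff f a))\<^sup>2 + (cmod (ell2_coeff g a))\<^sup>2"
    by (simp add: norm_mult)
qed

instantiation ell2 :: (type) complex_inner
begin

lift_definition zero_ell2 :: "'a ell2" is "\<lambda>_. 0" by simp
lift_definition plus_ell2 :: "'a ell2 \<Rightarrow> 'a ell2 \<Rightarrow> 'a ell2" is "\<lambda>f g a. f a + g a"
  by (rule sq_summable_add)
lift_definition scaleC_ell2 :: "complex \<Rightarrow> 'a ell2 \<Rightarrow> 'a ell2" is "\<lambda>c f a. c * f a"
  by (rule sq_summable_scale)
lift_definition uminus_ell2 :: "'a ell2 \<Rightarrow> 'a ell2" is "\<lambda>f a. - f a" by simp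
definition minus_ell2 :: "'a ell2 \<Rightarrow> 'a ell2 \<Rightarrow> 'a ell2" where "(f :: 'a ell2) - g = f + - g"
definition scaleR_ell2 :: "real \<Rightarrow> 'a ell2 \<Rightarrow> 'a ell2" where "r *\<^sub>R (f :: 'a ell2) = complex_of_real r *\<^sub>C f"
definition cinner_ell2 :: "'a ell2 \<Rightarrow> 'a ell2 \<Rightarrow> complex" where
  "cinner (f :: 'a ell2) g = (\<Sum>\<^sub>\<infinity>a. ell2_coeff f a * cnj (ell2_coeff g a))"
definition inner_ell2 :: "'a ell2 \<Rightarrow> 'a ell2 \<Rightarrow> real" where "inner (f :: 'a ell2) g = Re (cinner f g)"
definition norm_ell2 :: "'a ell2 \<Rightarrow> real" where "norm (f :: 'a ell2) = sqrt (inner f f)"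
definition dist_ell2 :: "'a ell2 \<Rightarrow> 'a ell2 \<Rightarrow> real" where "dist (f :: 'a ell2) g = norm (f - g)"
definition sgn_ell2 :: "'a ell2 \<Rightarrow> 'a ell2" where "sgn (f :: 'a ell2) = inverse (norm f) *\<^sub>R f"
definition uniformity_ell2 :: "('a ell2 \<times> 'a ell2) filter" where
  "uniformity_ell2 = (INF e\<in>{0<..}. principal {(f, g). dist f g < e})"
definition open_ell2 :: "'a ell2 set \<Rightarrow> bool" where
  "open_ell2 (U :: 'a ell2 set) = (\<forall>x\<in>U. \<forall>\<^sub>F (x', y) in uniformity. x' = x \<longrightarrow> y \<in> U)"

lemma cinner_self_ell2: "cinner f f = complex_of_real (\<Sum>\<^sub>\<infinity>a. (cmod (ell2_coeff f a))\<^sup>2)"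
  for f :: "'a ell2"
proof -
  have "cinner f f = (\<Sum>\<^sub>\<infinity>a. complex_of_real ((cmod (ell2_coeff f a))\<^sup>2))"
    unfolding cinner_ell2_def by (intro infsum_cong) (metis complex_norm_square)
  then show ?thesis
    using infsumI[OF has_sum_of_real[OF has_sum_infsum[OF ell2_coeff_summable[of f]]]] by (rule trans)
qed

instance
proof
  fix f g h :: "'a ell2" and a b :: real and c d :: complex and U :: "'a ell2 set"
  show "f + g + h = f + (g + h)" by transfer (simp add: add.assoc)
  show "f + g = g + f" by transfer (simp add: add.commute)
  show "0 + f = f" by transfer simp
  show "- f + f = 0" by transfer simp
  show "f - g = f + - g" by (simp add: minus_ell2_def)
  show c1: "c *\<^sub>C (f + g) = c *\<^sub>C f + c *\<^sub>C g" by transfer (simp add: distrib_left)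
  show c2: "(c + d) *\<^sub>C f = c *\<^sub>C f + d *\<^sub>C f" by transfer (simp add: distrib_right)
  show c3: "c *\<^sub>C d *\<^sub>C f = (c * d) *\<^sub>C f" by transfer (simp add: mult.assoc)
  show c4: "1 *\<^sub>C f = f" by transfer simp
  show "a *\<^sub>R f = complex_of_real a *\<^sub>C f" by (simp add: scaleR_ell2_def)
  show "a *\<^sub>R (f + g) = a *\<^sub>R f + a *\<^sub>R g"
    unfolding scaleR_ell2_def by transfer (simp add: distrib_left)
  show "(a + b) *\<^sub>R f = a *\<^sub>R f + b *\<^sub>R f"
    unfolding scaleR_ell2_def by transfer (simp add: distrib_right)
  show "a *\<^sub>R b *\<^sub>R f = (a * b) *\<^sub>R f"
    unfolding scaleR_ell2_def by transfer (simp add: mult.assoc)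
  show "1 *\<^sub>R f = f" unfolding scaleR_ell2_def by transfer simp
  show cc: "cinner f g = cnj (cinner g f)"
  proof -
    have "cnj (cinner g f) = (\<Sum>\<^sub>\<infinity>a. cnj (ell2_coeff g a * cnj (ell2_coeff f a)))"
      unfolding cinner_ell2_def by (rule infsum_cnj[symmetric])
    also have "\<dots> = cinner f g"
      unfolding cinner_ell2_def by (intro infsum_cong) simp
    finally show ?thesis by simp
  qed
  show ca: "cinner (f + g) h = cinner f h + cinner g h"
    unfolding cinner_ell2_def
    by (simp add: plus_ell2.rep_eq distrib_right infsum_add prod_summable)
  show cs: "cinner (c *\<^sub>C f) g = c * cinner f g" for c :: complex
    unfolding cinner_ell2_def
    by (simp add: scaleC_ell2.rep_eq mult.assoc infsum_cmult_right prod_summable)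
  show "inner f g = Re (cinner f g)" by (rule inner_ell2_def)
  show "inner f g = inner g f" unfolding inner_ell2_def cc by simp
  show "inner (f + g) h = inner f h + inner g h" by (simp add: inner_ell2_def ca)
  show "inner (a *\<^sub>R f) g = a * inner f g" by (simp add: inner_ell2_def scaleR_ell2_def cs)
  show "0 \<le> inner f f" by (simp add: inner_ell2_def cinner_self_ell2 infsum_nonneg)
  show "(inner f f = 0) = (f = 0)"
  proof
    assume "inner f f = 0"
    then have "(\<Sum>\<^sub>\<infinity>a. (cmod (ell2_coeff f a))\<^sup>2) = 0" by (simp add: inner_ell2_def cinner_self_ell2)
    then have "(cmod (ell2_coeff f a))\<^sup>2 = 0" for a
      using nonneg_infsum_le_0D[of "\<lambda>a. (cmod (ell2_coeff f a))\<^sup>2" UNIV a] ell2_coeff_summable[of f] by simp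
    then have "ell2_coeff f = ell2_coeff 0" by (auto simp: zero_ell2.rep_eq)
    then show "f = 0" by (simp add: ell2_coeff_inject)
  qed (simp add: inner_ell2_def cinner_self_ell2 zero_ell2.rep_eq)
  show "norm f = sqrt (inner f f)" by (rule norm_ell2_def)
  show "dist f g = norm (f - g)" by (rule dist_ell2_def)
  show "sgn f = inverse (norm f) *\<^sub>R f" by (rule sgn_ell2_def)
  show "uniformity = (INF e\<in>{0<..}. principal {(f :: 'a ell2, g). dist f g < e})"
    by (rule uniformity_ell2_def)
  show "open U = (\<forall>x\<in>U. \<forall>\<^sub>F (x', y) in uniformity. x' = x \<longrightarrow> y \<in> U)"
    by (rule open_ell2_def)
qed

end

lemma norm_ell2_sq: "(norm f)\<^sup>2 = (\<Sum>\<^sub>\<infinity>a. (cmod (ell2_coeff f a))\<^sup>2)" for f :: "'a ell2"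
  unfolding power2_norm_eq_inner inner_ell2_def cinner_self_ell2 by (rule Re_complex_of_real)

lemma ell2_coeff_diff: "ell2_coeff (f - g) a = ell2_coeff f a - ell2_coeff g a"
  unfolding minus_ell2_def plus_ell2.rep_eq uminus_ell2.rep_eq by simp

lemma finite_sum_le_norm: "finite F \<Longrightarrow> (\<Sum>a\<in>F. (cmod (ell2_coeff f a))\<^sup>2) \<le> (norm f)\<^sup>2"
  unfolding norm_ell2_sq by (rule finite_sum_le_infsum[OF ell2_coeff_summable]) simp_all

lemma cmod_coeff_le: "cmod (ell2_coeff f a) \<le> norm f"
proof (rule power2_le_imp_le)
  show "(cmod (ell2_coeff f a))\<^sup>2 \<le> (norm f)\<^sup>2"
    using finite_sum_le_norm[of "{a}" f] by simp
qed simp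

instance ell2 :: (type) chilbert_space
proof
  fix X :: "nat \<Rightarrow> 'a ell2"
  assume X: "Cauchy X"
  have "Cauchy (\<lambda>n. ell2_coeff (X n) a)" for a
    unfolding Cauchy_iff
  proof (intro allI impI)
    fix e :: real assume "e > 0"
    then obtain M where "\<forall>m\<ge>M. \<forall>n\<ge>M. norm (X m - X n) < e"
      using X unfolding Cauchy_iff by blast
    moreover have "cmod (ell2_coeff (X m) a - ell2_coeff (X n) a) \<le> norm (X m - X n)" for m n
      using cmod_coeff_le[of "X m - X n" a] by (simp add: ell2_coeff_diff)
    ultimately show "\<exists>M. \<forall>m\<ge>M. \<forall>n\<ge>M. norm (ell2_coeff (X m) a - ell2_coeff (X n) a) < e"
      by (meson le_less_trans)
  qed
  then obtain L where L: "\<And>a. (\<lambda>n. ell2_coeff (X n) a) \<longlonglongrightarrow> L a"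
    unfolding Cauchy_convergent_iff convergent_def by metis
  have bound: "(\<Sum>a\<in>F. (cmod (L a - ell2_coeff (X n) a))\<^sup>2) \<le> e\<^sup>2"
    if "finite F" and N: "\<forall>m\<ge>N. norm (X m - X n) \<le> e" for F n N e
  proof (rule tendsto_upperbound)
    show "(\<lambda>m. \<Sum>a\<in>F. (cmod (ell2_coeff (X m) a - ell2_coeff (X n) a))\<^sup>2)
      \<longlonglongrightarrow> (\<Sum>a\<in>F. (cmod (L a - ell2_coeff (X n) a))\<^sup>2)"
      by (intro tendsto_intros L)
    show "\<forall>\<^sub>F m in sequentially. (\<Sum>a\<in>F. (cmod (ell2_coeff (X m) a - ell2_coeff (X n) a))\<^sup>2) \<le> e\<^sup>2"
      using eventually_ge_at_top[of N]
    proof eventually_elim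
      case (elim m)
      have "(\<Sum>a\<in>F. (cmod (ell2_coeff (X m) a - ell2_coeff (X n) a))\<^sup>2) \<le> (norm (X m - X n))\<^sup>2"
        using finite_sum_le_norm[OF that(1), of "X m - X n"] by (simp add: ell2_coeff_diff)
      also have "\<dots> \<le> e\<^sup>2" using N elim by (intro power_mono) auto
      finally show ?case .
    qed
  qed simp
  have summ: "(\<lambda>a. (cmod (L a - ell2_coeff (X n) a))\<^sup>2) summable_on UNIV"
    if N: "\<forall>m\<ge>N. norm (X m - X n) \<le> e" for n N e
  proof (rule nonneg_bdd_above_summable_on)
    show "bdd_above (sum (\<lambda>a. (cmod (L a - ell2_coeff (X n) a))\<^sup>2) ` {F. F \<subseteq> UNIV \<and> finite F})"
      unfolding bdd_above_def using bound[OF _ N] by blast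
  qed simp
  obtain N where N: "\<forall>m\<ge>N. \<forall>n\<ge>N. norm (X m - X n) < 1"
    using CauchyD[OF X zero_less_one] by blast
  then have "\<forall>m\<ge>N. norm (X m - X N) \<le> 1" by (meson less_imp_le order_refl)
  from sq_summable_add[OF summ[OF this] ell2_coeff_summable[of "X N"]]
  have cL: "ell2_coeff (Abs_ell2 L) = L" by (intro ell2_coeff_Abs) simp
  have "X \<longlonglongrightarrow> Abs_ell2 L"
    unfolding LIMSEQ_iff
  proof (intro allI impI)
    fix r :: real assume r: "r > 0"
    then have "r / 2 > 0" by simp
    then obtain N where N: "\<forall>m\<ge>N. \<forall>n\<ge>N. norm (X m - X n) < r / 2"
      using CauchyD[OF X] by blast
    have "norm (X n - Abs_ell2 L) < r" if n: "n \<ge> N" for n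
    proof -
      have e: "\<forall>m\<ge>N. norm (X m - X n) \<le> r / 2" using N n by (meson less_imp_le)
      have "(norm (Abs_ell2 L - X n))\<^sup>2 \<le> (r / 2)\<^sup>2"
        unfolding norm_ell2_sq ell2_coeff_diff cL
        by (rule infsum_le_finite_sums[OF summ[OF e]], rule bound[OF _ e])
      then have "norm (Abs_ell2 L - X n) \<le> r / 2"
        by (rule power2_le_imp_le) (use r in simp)
      then show ?thesis using r by (simp add: norm_minus_commute)
    qed
    then show "\<exists>no. \<forall>n\<ge>no. norm (X n - Abs_ell2 L) < r" by blast
  qed
  then show "convergent X" by (auto simp: convergent_def)
qed

lift_definition ket :: "'a \<Rightarrow> 'a ell2" is "\<lambda>x a. if a = x then 1 else 0"
proof -
  fix x :: 'a
  show "(\<lambda>a. (cmod (if a = x then 1 else 0))\<^sup>2) summable_on UNIV"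
    by (rule finite_nonzero_values_imp_summable_on, rule finite_subset[of _ "{x}"]) auto
qed

text \<open>\<open>l\<^sub>2(A)\<close> for a subset \<open>A\<close> of the index type, as the sequences supported in \<open>A\<close>; its standard
  basis is \<open>ket a\<close> for \<open>a \<in> A\<close>.\<close>

definition l2 :: "'a set \<Rightarrow> 'a ell2 set" where
  "l2 A = {f. \<forall>a. a \<notin> A \<longrightarrow> ell2_coeff f a = 0}"


section \<open>Subspaces, orthonormality, direct sums\<close>

definition closed_csubspace :: "'h::chilbert_space set \<Rightarrow> bool" where
  "closed_csubspace K \<longleftrightarrow> csubspace K \<and> closed K"

definition orthonormal_family :: "'i set \<Rightarrow> ('i \<Rightarrow> 'h::chilbert_space) \<Rightarrow> bool" where
  "orthonormal_family I f \<longleftrightarrow> (\<forall>i\<in>I. \<forall>j\<in>I. cinner (f i) (f j) = (if i = j then 1 else 0))"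

definition orthonormal_basis :: "'h::chilbert_space set \<Rightarrow> 'h set \<Rightarrow> bool" where
  "orthonormal_basis K E \<longleftrightarrow> orthonormal_family E (\<lambda>e. e) \<and> closure (cspan E) = K"

definition orthogonal_direct_sum :: "'h::chilbert_space set \<Rightarrow> 'i set \<Rightarrow> ('i \<Rightarrow> 'h set) \<Rightarrow> bool" where
  "orthogonal_direct_sum K I M \<longleftrightarrow>
     (\<forall>i\<in>I. closed_csubspace (M i)) \<and>
     (\<forall>i\<in>I. \<forall>j\<in>I. i \<noteq> j \<longrightarrow> (\<forall>v\<in>M i. \<forall>w\<in>M j. cinner v w = 0)) \<and>
     closure (cspan (\<Union>i\<in>I. M i)) = K"


section \<open>Representations on Hilbert spaces\<close>

text \<open>A Hilbert space is given by a closed subspace \<open>K\<close> of a type of class \<open>chilbert_space\<close>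
  (\<open>K = UNIV\<close> being allowed), an operator on it by a function of which only the values on \<open>K\<close>
  matter. Hence the subrepresentation of \<open>(K, \<pi>)\<close> on an invariant closed subspace \<open>M\<close> is
  \<open>(M, \<pi>)\<close>.\<close>

definition bounded_operator_on :: "'h::chilbert_space set \<Rightarrow> ('h \<Rightarrow> 'h) \<Rightarrow> bool" where
  "bounded_operator_on K A \<longleftrightarrow>
     (\<forall>v\<in>K. A v \<in> K) \<and>
     (\<forall>v\<in>K. \<forall>w\<in>K. A (v + w) = A v + A w) \<and>
     (\<forall>c. \<forall>v\<in>K. A (c *\<^sub>C v) = c *\<^sub>C A v) \<and>
     (\<exists>B. \<forall>v\<in>K. norm (A v) \<le> B * norm v)"

definition star_rep :: "'h::chilbert_space set \<Rightarrow> ('o::cstar_algebra_1 \<Rightarrow> 'h \<Rightarrow> 'h) \<Rightarrow> bool" where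
  "star_rep K \<pi> \<longleftrightarrow>
     closed_csubspace K \<and>
     (\<forall>a. bounded_operator_on K (\<pi> a)) \<and>
     (\<forall>a b. \<forall>v\<in>K. \<pi> (a + b) v = \<pi> a v + \<pi> b v) \<and>
     (\<forall>c a. \<forall>v\<in>K. \<pi> (c *\<^sub>C a) v = c *\<^sub>C \<pi> a v) \<and>
     (\<forall>a b. \<forall>v\<in>K. \<pi> (a * b) v = \<pi> a (\<pi> b v)) \<and>
     (\<forall>a. \<forall>v\<in>K. \<forall>w\<in>K. cinner (\<pi> a v) w = cinner v (\<pi> (star a) w))"

definition subrepresentation ::
  "'h::chilbert_space set \<Rightarrow> ('o::cstar_algebra_1 \<Rightarrow> 'h \<Rightarrow> 'h) \<Rightarrow> 'h set \<Rightarrow> bool" where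
  "subrepresentation K \<pi> M \<longleftrightarrow> closed_csubspace M \<and> M \<subseteq> K \<and> (\<forall>a. \<forall>v\<in>M. \<pi> a v \<in> M)"

text \<open>The zero space is not counted as irreducible.\<close>

definition irreducible_rep ::
  "'h::chilbert_space set \<Rightarrow> ('o::cstar_algebra_1 \<Rightarrow> 'h \<Rightarrow> 'h) \<Rightarrow> bool" where
  "irreducible_rep K \<pi> \<longleftrightarrow> K \<noteq> {0} \<and> (\<forall>M. subrepresentation K \<pi> M \<longrightarrow> M = {0} \<or> M = K)"

text \<open>A linear isometry \<open>u\<close> of \<open>K\<^sub>1\<close> onto \<open>K\<^sub>2\<close> is a unitary; \<open>u\<^sup>*\<close> is its inverse
  \<open>inv_into K\<^sub>1 u\<close>.\<close>

definition unitarily_equivalent ::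
  "'h::chilbert_space set \<Rightarrow> ('o::cstar_algebra_1 \<Rightarrow> 'h \<Rightarrow> 'h) \<Rightarrow>
   'g::chilbert_space set \<Rightarrow> ('o \<Rightarrow> 'g \<Rightarrow> 'g) \<Rightarrow> bool" where
  "unitarily_equivalent K\<^sub>1 \<pi>\<^sub>1 K\<^sub>2 \<pi>\<^sub>2 \<longleftrightarrow>
     (\<exists>u. u ` K\<^sub>1 = K\<^sub>2 \<and>
        (\<forall>v\<in>K\<^sub>1. \<forall>w\<in>K\<^sub>1. u (v + w) = u v + u w) \<and>
        (\<forall>c. \<forall>v\<in>K\<^sub>1. u (c *\<^sub>C v) = c *\<^sub>C u v) \<and>
        (\<forall>v\<in>K\<^sub>1. \<forall>w\<in>K\<^sub>1. cinner (u v) (u w) = cinner v w) \<and>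
        (\<forall>a. \<forall>w\<in>K\<^sub>2. u (\<pi>\<^sub>1 a (inv_into K\<^sub>1 u w)) = \<pi>\<^sub>2 a w))"

definition multiplicity_free ::
  "'h::chilbert_space set \<Rightarrow> ('o::cstar_algebra_1 \<Rightarrow> 'h \<Rightarrow> 'h) \<Rightarrow> bool" where
  "multiplicity_free K \<pi> \<longleftrightarrow>
     (\<forall>M N. subrepresentation K \<pi> M \<and> subrepresentation K \<pi> N \<and> M \<noteq> N
        \<longrightarrow> \<not> unitarily_equivalent M \<pi> N \<pi>)"


section \<open>The Cuntz algebra with infinitely many generators\<close>

text \<open>Generators are indexed by \<open>i \<ge> 1\<close>; the value at \<open>0\<close> is irrelevant throughout.
  In a C*-algebra, \<open>a \<le> b\<close> means that \<open>b - a\<close> has the form \<open>c\<^sup>* c\<close>.\<close>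

definition cuntz_relations :: "(nat \<Rightarrow> 'o::cstar_algebra_1) \<Rightarrow> bool" where
  "cuntz_relations s \<longleftrightarrow>
     (\<forall>i\<ge>1. \<forall>j\<ge>1. star (s i) * s j = (if i = j then 1 else 0)) \<and>
     (\<forall>k\<ge>1. \<exists>c. 1 - (\<Sum>i=1..k. s i * star (s i)) = star c * c)"

definition cadjoint :: "('h::chilbert_space \<Rightarrow> 'h) \<Rightarrow> 'h \<Rightarrow> 'h" where
  "cadjoint A = (THE B. \<forall>v w. cinner (A v) w = cinner v (B w))"

definition cuntz_operators :: "(nat \<Rightarrow> 'h::chilbert_space \<Rightarrow> 'h) \<Rightarrow> bool" where
  "cuntz_operators T \<longleftrightarrow>
     (\<forall>i\<ge>1. bounded_operator_on UNIV (T i)) \<and>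
     (\<forall>i\<ge>1. \<forall>j\<ge>1. \<forall>v. cadjoint (T i) (T j v) = (if i = j then v else 0)) \<and>
     (\<forall>k\<ge>1. \<forall>v. Re (cinner (\<Sum>i=1..k. T i (cadjoint (T i) v)) v) \<le> Re (cinner v v))"

inductive_set star_algebra_generated :: "(nat \<Rightarrow> 'o::cstar_algebra_1) \<Rightarrow> 'o set"
  for s :: "nat \<Rightarrow> 'o" where
  one: "1 \<in> star_algebra_generated s"
| gen: "i \<ge> 1 \<Longrightarrow> s i \<in> star_algebra_generated s"
| add: "a \<in> star_algebra_generated s \<Longrightarrow> b \<in> star_algebra_generated s
          \<Longrightarrow> a + b \<in> star_algebra_generated s"
| scale: "a \<in> star_algebra_generated s \<Longrightarrow> c *\<^sub>C a \<in> star_algebra_generated s"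
| mult: "a \<in> star_algebra_generated s \<Longrightarrow> b \<in> star_algebra_generated s
          \<Longrightarrow> a * b \<in> star_algebra_generated s"
| star: "a \<in> star_algebra_generated s \<Longrightarrow> star a \<in> star_algebra_generated s"

text \<open>The type \<open>'o\<close> is \<open>\<O>\<^sub>\<infinity>\<close> with canonical generators \<open>s\<close>: it is generated by \<open>s\<close> as a C*-algebra,
  and every family satisfying the relations is the image of \<open>s\<close> under a unique unital
  *-homomorphism. A C*-algebra generated by countably many elements is separable, hence embeds
  into the bounded operators on \<open>l\<^sub>2(\<nat>)\<close>, so it suffices to state universality for families
  of operators on that space.\<close>

definition cuntz_algebra_infinity :: "(nat \<Rightarrow> 'o::cstar_algebra_1) \<Rightarrow> bool" where
  "cuntz_algebra_infinity s \<longleftrightarrow>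
     cuntz_relations s \<and>
     closure (star_algebra_generated s) = UNIV \<and>
     (\<forall>T :: nat \<Rightarrow> nat ell2 \<Rightarrow> nat ell2. cuntz_operators T \<longrightarrow>
        (\<exists>!\<pi>. star_rep UNIV \<pi> \<and> \<pi> 1 = id \<and> (\<forall>i\<ge>1. \<pi> (s i) = T i)))"

definition permutative_rep ::
  "(nat \<Rightarrow> 'o::cstar_algebra_1) \<Rightarrow> 'h::chilbert_space set \<Rightarrow> ('o \<Rightarrow> 'h \<Rightarrow> 'h) \<Rightarrow> bool" where
  "permutative_rep s K \<pi> \<longleftrightarrow>
     star_rep K \<pi> \<and>
     (\<exists>E. orthonormal_basis K E \<and> (\<forall>i\<ge>1. \<pi> (s i) ` E \<subseteq> E)) \<and>
     orthogonal_direct_sum K {1..} (\<lambda>i. \<pi> (s i) ` K)"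

definition cyclic_vector ::
  "'h::chilbert_space set \<Rightarrow> ('o::cstar_algebra_1 \<Rightarrow> 'h \<Rightarrow> 'h) \<Rightarrow> 'h \<Rightarrow> bool" where
  "cyclic_vector K \<pi> v \<longleftrightarrow> v \<in> K \<and> closure (range (\<lambda>a. \<pi> a v)) = K"

definition s_word :: "(nat \<Rightarrow> 'o::cstar_algebra_1) \<Rightarrow> nat list \<Rightarrow> 'o" where
  "s_word s J = prod_list (map s J)"

text \<open>\<open>drop l J\<close> is \<open>(j\<^bsub>l+1\<^esub>, \<dots>, j\<^bsub>k\<^esub>)\<close>.\<close>

definition P_finite ::
  "(nat \<Rightarrow> 'o::cstar_algebra_1) \<Rightarrow> nat list \<Rightarrow> 'h::chilbert_space set \<Rightarrow> ('o \<Rightarrow> 'h \<Rightarrow> 'h) \<Rightarrow> bool" where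
  "P_finite s J K \<pi> \<longleftrightarrow>
     J \<noteq> [] \<and> (\<forall>j\<in>set J. j \<ge> 1) \<and> star_rep K \<pi> \<and>
     (\<exists>v. norm v = 1 \<and> cyclic_vector K \<pi> v \<and> \<pi> (s_word s J) v = v \<and>
        orthonormal_family {..<length J} (\<lambda>l. \<pi> (s_word s (drop l J)) v))"

text \<open>An infinite sequence \<open>(j\<^sub>1, j\<^sub>2, \<dots>)\<close> is the function \<open>l \<mapsto> j\<^bsub>l+1\<^esub>\<close> on \<open>nat\<close>. The operator
  \<open>\<pi>(s)\<^sup>*\<close> is \<open>\<pi>(s\<^sup>*)\<close>.\<close>

definition P_infinite ::
  "(nat \<Rightarrow> 'o::cstar_algebra_1) \<Rightarrow> (nat \<Rightarrow> nat) \<Rightarrow> 'h::chilbert_space set \<Rightarrow> ('o \<Rightarrow> 'h \<Rightarrow> 'h) \<Rightarrow> bool" where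
  "P_infinite s J K \<pi> \<longleftrightarrow>
     (\<forall>l. J l \<ge> 1) \<and> star_rep K \<pi> \<and>
     (\<exists>v. norm v = 1 \<and> cyclic_vector K \<pi> v \<and>
        orthonormal_family {1..} (\<lambda>n. \<pi> (star (s_word s (map J [0..<n]))) v))"


section \<open>Modular equivalence and continued fractions\<close>

definition Omega :: "real set" where
  "Omega = {0..1} - \<rat>"

definition modular_equiv :: "real \<Rightarrow> real \<Rightarrow> bool"  (infix "\<sim>\<^sub>m" 50) where
  "x \<sim>\<^sub>m y \<longleftrightarrow>
     (\<exists>a b c d :: int. (a * d - b * c = 1 \<or> a * d - b * c = -1) \<and>
        of_int c * y + of_int d \<noteq> 0 \<and> x = (of_int a * y + of_int b) / (of_int c * y + of_int d))"

definition modular_class :: "real \<Rightarrow> real set" where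
  "modular_class x = {y \<in> Omega. y \<sim>\<^sub>m x}"

definition modular_classes :: "real set set" where
  "modular_classes = modular_class ` Omega"

definition H_class :: "real set \<Rightarrow> real ell2 set" where
  "H_class C = closure (cspan (ket ` C))"

text \<open>\<open>cf_value a n\<close> is the finite continued fraction with partial quotients
  \<open>a 0, \<dots>, a (n - 1)\<close> and zero integer part; thus \<open>CFE x l\<close> is \<open>a\<^bsub>l+1\<^esub>(x)\<close>.\<close>

primrec cf_value :: "(nat \<Rightarrow> nat) \<Rightarrow> nat \<Rightarrow> real" where
  "cf_value a 0 = 0"
| "cf_value a (Suc n) = 1 / (real (a 0) + cf_value (\<lambda>i. a (Suc i)) n)"

definition CFE :: "real \<Rightarrow> nat \<Rightarrow> nat" where
  "CFE x = (THE a. (\<forall>i. a i \<ge> 1) \<and> cf_value a \<longlonglongrightarrow> x)"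

definition quadratic_irrationals :: "real set" where
  "quadratic_irrationals =
     {x \<in> Omega. \<exists>a b c :: int. a \<noteq> 0 \<and> of_int a * x\<^sup>2 + of_int b * x + of_int c = 0}"

definition nonperiodic :: "nat list \<Rightarrow> bool" where
  "nonperiodic n \<longleftrightarrow> (\<forall>p. 0 < p \<and> p < length n \<longrightarrow> rotate p n \<noteq> n)"

text \<open>\<open>J = (m\<^sub>1, \<dots>, m\<^sub>l, n\<^sub>1, \<dots>, n\<^sub>k, n\<^sub>1, \<dots>, n\<^sub>k, \<dots>)\<close> with \<open>(n\<^sub>1, \<dots>, n\<^sub>k)\<close> nonperiodic\<close>

definition eventually_repeats :: "(nat \<Rightarrow> nat) \<Rightarrow> nat list \<Rightarrow> nat list \<Rightarrow> bool" where
  "eventually_repeats J m n \<longleftrightarrow>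
     n \<noteq> [] \<and> nonperiodic n \<and>
     (\<forall>i. J i = (if i < length m then m ! i else n ! ((i - length m) mod length n)))"

text \<open>The repeating block is determined up to a cyclic permutation by these conditions, so it is
  rendered as a predicate.\<close>

definition repeating_block :: "(nat \<Rightarrow> nat) \<Rightarrow> nat list \<Rightarrow> bool" where
  "repeating_block J n \<longleftrightarrow>
     (\<exists>m. eventually_repeats J m n \<and> (\<nexists>m\<^sub>0. m = m\<^sub>0 @ n)) \<and>
     (\<forall>m' n'. eventually_repeats J m' n' \<longrightarrow> length n \<le> length n')"

end

theory Submission
  imports Defs
begin

text \<open>In terms of continued fractions the map \<open>x \<mapsto> 1 / (x + i)\<close> prepends the digit \<open>i\<close> to the expansion
  of \<open>x\<close>, and the Gauss map deletes the first digit. So \<open>\<pi>\<close> acts on the basis \<open>ket x\<close> as the shift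
  representation acts on infinite sequences, and every part of the theorem is read off from the
  dynamics of the digit shift. By Serret's theorem (\<open>modular_equiv_iff_tail\<close>) the modular classes are
  the orbits of this dynamics, that is, the classes of sequences with a common tail.

  Irreducibility and inequivalence of the components both come from one observation. If \<open>w\<close> consists
  of the first \<open>n\<close> digits of \<open>x\<close>, then \<open>\<pi> (s\<^sub>w s\<^sub>w\<^sup>*)\<close> is the projection onto the sequences starting with
  \<open>w\<close>, and for \<open>n \<rightarrow> \<infinity>\<close> these projections converge strongly to the projection onto the line of \<open>ket x\<close>,
  because \<open>x\<close> is determined by its digits. Hence an invariant closed subspace is spanned by basis
  vectors (\<open>subrepresentation_eq_closure\<close>), which must form a union of orbits, and a unitary equivalence
  of two subrepresentations can only rescale basis vectors (\<open>unitarily_equivalent_imp_eq\<close>). The latter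
  gives the absence of multiplicities for arbitrary subrepresentations as well.

  The vector \<open>ket x\<close> belongs to a class \<open>P(J)\<close> with infinite \<open>J\<close> if the Gauss orbit of \<open>x\<close> is injective,
  and a tail of \<open>x\<close> is a periodic point otherwise. The theorems of Euler and Lagrange
  (\<open>eventually_periodic_imp_quadratic\<close>, \<open>quadratic_imp_eventually_periodic\<close>) identify the second case
  with that of a quadratic irrational.

  A permutative representation carries the same kind of dynamics on its basis, and each basis vector
  again has a digit sequence, hence is labelled by an irrational number. The crucial point is that in
  an irreducible representation different basis vectors have different labels
  (\<open>irreducible_imp_separated\<close>). Otherwise the vectors with a common label, chosen purely periodic or
  not eventually periodic, would be permuted by a power of the shift, and two vectors supported there
  whose translates under this permutation are orthogonal generate orthogonal invariant subspaces.
  Such pairs always exist (\<open>uncorrelated_pair\<close>); on an infinite orbit they amount to two functions on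
  the circle with disjoint supports.

  Representations of the algebra are handled through the generators and their adjoints, which is
  legitimate because a representation is continuous in the algebra element (\<open>star_rep_norm_le\<close>).\<close>

section \<open>Complex Hilbert spaces\<close>

lemma cinner_add_right: "cinner x (y + z) = cinner x y + cinner x z"
  for x y z :: "'h::complex_inner"
  by (metis cinner_add_left cinner_commute complex_cnj_add)

lemma cinner_scaleC_right: "cinner x (c *\<^sub>C y) = cnj c * cinner x y"
  for x y :: "'h::complex_inner"
  by (metis cinner_commute cinner_scaleC_left complex_cnj_mult)

lemma cinner_zero_left [simp]: "cinner 0 y = 0" for y :: "'h::complex_inner"
  using cinner_add_left[of 0 0 y] by simp

lemma cinner_zero_right [simp]: "cinner y 0 = 0" for y :: "'h::complex_inner"
  using cinner_add_right[of y 0 0] by simp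

lemma cinner_diff_left: "cinner (x - y) z = cinner x z - cinner y z"
  for x y z :: "'h::complex_inner"
  using cinner_add_left[of "x - y" y z] by simp

lemma cinner_diff_right: "cinner x (y - z) = cinner x y - cinner x z"
  for x y z :: "'h::complex_inner"
  using cinner_add_right[of x "y - z" z] by simp

lemma cinner_sum_left: "cinner (\<Sum>i\<in>I. f i) z = (\<Sum>i\<in>I. cinner (f i) z)"
  for z :: "'h::complex_inner"
  by (induction I rule: infinite_finite_induct) (auto simp: cinner_add_left)

lemma cinner_self: "cinner x x = complex_of_real ((norm x)\<^sup>2)" for x :: "'h::complex_inner"
proof -
  have "Im (cinner x x) = 0" using cinner_commute[of x x] by (metis Reals_cnj_iff complex_is_Real_iff)
  moreover have "Re (cinner x x) = (norm x)\<^sup>2" by (simp add: inner_eq_Re_cinner[symmetric] power2_norm_eq_inner)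
  ultimately show ?thesis by (simp add: complex_eq_iff)
qed

lemma norm_scaleC_hilbert: "norm (c *\<^sub>C x) = cmod c * norm x" for x :: "'h::complex_inner"
proof -
  have "complex_of_real ((norm (c *\<^sub>C x))\<^sup>2) = complex_of_real ((cmod c * norm x)\<^sup>2)"
  proof -
    have "complex_of_real ((norm (c *\<^sub>C x))\<^sup>2) = c * cnj c * complex_of_real ((norm x)\<^sup>2)"
      unfolding cinner_self[symmetric] by (simp add: cinner_scaleC_left cinner_scaleC_right)
    also have "\<dots> = complex_of_real ((cmod c * norm x)\<^sup>2)"
      unfolding complex_norm_square[symmetric] of_real_mult[symmetric] power_mult_distrib ..
    finally show ?thesis .
  qed
  then have "(norm (c *\<^sub>C x))\<^sup>2 = (cmod c * norm x)\<^sup>2" unfolding of_real_eq_iff .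
  then show ?thesis by (simp add: power2_eq_iff_nonneg)
qed

text \<open>Rotating \<open>x\<close> by a phase makes \<open>cinner x y\<close> real and nonnegative, which reduces the complex
  Cauchy--Schwarz inequality to the real one.\<close>

lemma cmod_cinner_le: "cmod (cinner x y) \<le> norm x * norm y" for x y :: "'h::complex_inner"
proof (cases "cinner x y = 0")
  case False
  define c where "c = cnj (cinner x y) / complex_of_real (cmod (cinner x y))"
  have "cmod c = 1" using False by (simp add: c_def norm_divide)
  have "cinner (c *\<^sub>C x) y = complex_of_real (cmod (cinner x y))"
    using False by (simp add: c_def cinner_scaleC_left field_simps complex_norm_square[symmetric] power2_eq_square)
  then have "cmod (cinner x y) = inner (c *\<^sub>C x) y" by (simp add: inner_eq_Re_cinner)
  also have "\<dots> \<le> norm (c *\<^sub>C x) * norm y" by (rule norm_cauchy_schwarz)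
  finally show ?thesis by (simp add: norm_scaleC_hilbert \<open>cmod c = 1\<close>)
qed simp

lemma tendsto_cinner_left:
  fixes f :: "'a \<Rightarrow> 'h::complex_inner"
  assumes "(f \<longlongrightarrow> l) F"
  shows "((\<lambda>n. cinner (f n) y) \<longlongrightarrow> cinner l y) F"
proof -
  have "((\<lambda>n. norm (f n - l) * norm y) \<longlongrightarrow> 0) F"
    using tendsto_mult_left_zero[OF tendsto_norm_zero[OF LIM_zero[OF assms]]] .
  then have "((\<lambda>n. cinner (f n) y - cinner l y) \<longlongrightarrow> 0) F"
    by (rule Lim_null_comparison[rotated])
      (auto simp: cinner_diff_left[symmetric] cmod_cinner_le)
  then show ?thesis by (rule LIM_zero_cancel)
qed

lemma continuous_on_cinner_left: "continuous_on S (\<lambda>v. cinner v y)"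
  for y :: "'h::complex_inner"
  unfolding continuous_on_def by (auto intro!: tendsto_cinner_left tendsto_ident_at)

lemma continuous_on_scaleC: "continuous_on S (\<lambda>v. c *\<^sub>C v)" for S :: "'h::complex_inner set"
proof -
  have "dist (c *\<^sub>C x) (c *\<^sub>C y) = cmod c * dist x y" for x y :: 'h
    by (simp add: dist_norm complex_vector.scale_right_diff_distrib[symmetric] norm_scaleC_hilbert)
  then have "lipschitz_on (cmod c) S (\<lambda>v. c *\<^sub>C v)" by (auto simp: lipschitz_on_def)
  then show ?thesis by (rule lipschitz_on_continuous_on)
qed

lemma csubspace_closure:
  fixes S :: "'h::complex_inner set"
  assumes "csubspace S"
  shows "csubspace (closure S)"
proof (rule complex_vector.subspaceI)
  show "0 \<in> closure S" using complex_vector.subspace_0[OF assms] closure_subset by blast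
next
  fix x y assume "x \<in> closure S" "y \<in> closure S"
  then obtain f g where "\<forall>n. f n \<in> S" "f \<longlonglongrightarrow> x" "\<forall>n. g n \<in> S" "g \<longlonglongrightarrow> y"
    unfolding closure_sequential by blast
  then show "x + y \<in> closure S" unfolding closure_sequential
    by (intro exI[of _ "\<lambda>n. f n + g n"]) (auto intro: tendsto_add complex_vector.subspace_add[OF assms])
next
  fix c x assume "x \<in> closure S"
  have "(\<lambda>v. c *\<^sub>C v) ` closure S \<subseteq> closure S"
    using closure_subset
    by (intro image_closure_subset continuous_on_scaleC closed_closure)
      (fastforce intro: complex_vector.subspace_scale[OF assms])
  then show "c *\<^sub>C x \<in> closure S" using \<open>x \<in> closure S\<close> by blast
qed

lemma closed_csubspace_closure_cspan: "closed_csubspace (closure (cspan S))"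
  by (simp add: closed_csubspace_def csubspace_closure complex_vector.subspace_span)

lemma closure_cspan_minimal:
  "closed_csubspace M \<Longrightarrow> S \<subseteq> M \<Longrightarrow> closure (cspan S) \<subseteq> M"
  unfolding closed_csubspace_def by (intro closure_minimal complex_vector.span_minimal) auto

lemma subset_closure_cspan: "S \<subseteq> closure (cspan S)"
  using closure_subset complex_vector.span_superset by blast

lemma closed_csubspace_annihilator: "closed_csubspace {v. \<forall>w\<in>W. cinner v w = 0}"
  for W :: "'h::chilbert_space set"
proof -
  have "{v. \<forall>w\<in>W. cinner v w = 0} = (\<Inter>w\<in>W. (\<lambda>v. cinner v w) -` {0})" by auto
  moreover have "closed ((\<lambda>v. cinner v w) -` {0})" for w :: 'h
    by (intro closed_vimage continuous_on_cinner_left) simp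
  moreover have "csubspace {v. \<forall>w\<in>W. cinner v w = 0}"
    by (rule complex_vector.subspaceI) (auto simp: cinner_add_left cinner_scaleC_left)
  ultimately show ?thesis unfolding closed_csubspace_def by auto
qed

lemma closed_csubspace_Int:
  "closed_csubspace M \<Longrightarrow> closed_csubspace N \<Longrightarrow> closed_csubspace (M \<inter> N)"
  unfolding closed_csubspace_def by (auto intro: complex_vector.subspace_inter)

section \<open>Automatic continuity of representations\<close>

lemma norm_star: "norm (star a) = norm a" for a :: "'o::cstar_algebra_1"
proof -
  have le: "norm a \<le> norm (star a)" for a :: 'o
  proof (cases "a = 0")
    case False
    have "norm a * norm a \<le> norm (star a) * norm a"
      using norm_mult_ineq[of "star a" a] cstar_identity[of a] by (simp add: power2_eq_square)
    then show ?thesis using False by simp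
  qed simp
  show ?thesis using le[of a] le[of "star a"] by (simp add: star_star)
qed

lemma star_zero [simp]: "star 0 = (0 :: 'o::cstar_algebra_1)"
  using star_add[of "0::'o" 0] by simp

lemma star_minus: "star (- a) = - star a" for a :: "'o::cstar_algebra_1"
  using star_add[of a "- a"] by (simp add: eq_neg_iff_add_eq_0 add.commute)

lemma star_diff: "star (a - b) = star a - star b" for a b :: "'o::cstar_algebra_1"
  using star_add[of a "- b"] by (simp add: star_minus)

lemma star_one [simp]: "star 1 = (1 :: 'o::cstar_algebra_1)"
  by (metis mult_1 mult_1_right star_mult star_star)

lemma star_scaleR: "star (r *\<^sub>R a) = r *\<^sub>R star a" for a :: "'o::cstar_algebra_1"
  by (simp add: scaleR_scaleC star_scaleC)

lemma continuous_on_star: "continuous_on S (star :: 'o \<Rightarrow> 'o::cstar_algebra_1)"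
proof -
  have "lipschitz_on 1 S (star :: 'o \<Rightarrow> 'o)"
    by (auto simp: lipschitz_on_def dist_norm star_diff[symmetric] norm_star)
  then show ?thesis by (rule lipschitz_on_continuous_on)
qed

text \<open>With \<open>c = 1 - y\<close> the equation \<open>c\<^sup>2 = 1 - b\<close> becomes the fixed point equation
  \<open>y = (b + y\<^sup>2) / 2\<close>, whose right-hand side is a contraction of the self-adjoint elements of a
  ball of radius \<open>r < 1\<close> as soon as \<open>norm b \<le> 1 - (1 - r)\<^sup>2\<close>.\<close>

lemma exists_selfadjoint_sqrt:
  fixes b :: "'o::cstar_algebra_1"
  assumes "norm b < 1" "star b = b"
  shows "\<exists>c. star c = c \<and> c * c = 1 - b"
proof -
  define r where "r = 1 - sqrt (1 - norm b)"
  have r: "0 \<le> r" "r < 1" using assms(1) by (auto simp: r_def)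
  have nb: "norm b = 2 * r - r\<^sup>2" using assms(1) by (simp add: r_def power2_eq_square algebra_simps)
  define S where "S = cball 0 r \<inter> {y :: 'o. star y = y}"
  define f where "f y = (1/2) *\<^sub>R (b + y * y)" for y :: 'o
  have "closed {y :: 'o. star y = y}"
    by (intro closed_Collect_eq continuous_on_star continuous_on_id)
  then have complete: "complete S" unfolding S_def by (intro closed_Int closed_cball complete_eq_closed[THEN iffD2])
  have "0 \<in> S" unfolding S_def using r by simp
  then have nonempty: "S \<noteq> {}" by blast
  have image: "f ` S \<subseteq> S"
  proof safe
    fix y assume "y \<in> S"
    then have y: "norm y \<le> r" "star y = y" by (auto simp: S_def)
    have "norm (y * y) \<le> r * r"
      using norm_mult_ineq[of y y] mult_mono[OF y(1) y(1)] r by simp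
    then have "norm (b + y * y) \<le> 2 * r"
      using norm_triangle_ineq[of b "y * y"] nb by (simp add: power2_eq_square)
    then show "f y \<in> S" using y assms(2) by (simp add: S_def f_def star_scaleR star_add star_mult)
  qed
  have lipschitz: "dist (f x) (f y) \<le> r * dist x y" if "x \<in> S" "y \<in> S" for x y
  proof -
    have n: "norm x \<le> r" "norm y \<le> r" using that by (auto simp: S_def)
    have "f x - f y = (1/2) *\<^sub>R (x * (x - y) + (x - y) * y)"
      by (simp add: f_def algebra_simps)
    moreover have "norm (x * (x - y)) \<le> r * norm (x - y)" "norm ((x - y) * y) \<le> r * norm (x - y)"
      using norm_mult_ineq[of x "x - y"] norm_mult_ineq[of "x - y" y] n
        mult_right_mono[OF n(1), of "norm (x - y)"] mult_left_mono[OF n(2), of "norm (x - y)"]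
      by (auto simp: mult.commute)
    ultimately show "dist (f x) (f y) \<le> r * dist x y"
      using norm_triangle_ineq[of "x * (x - y)" "(x - y) * y"] by (simp add: dist_norm)
  qed
  obtain y where y: "y \<in> S" "f y = y"
    using Banach_fix[OF complete nonempty r image lipschitz] by blast
  have "(1 - y) * (1 - y) = 1 - 2 *\<^sub>R y + y * y" by (simp add: algebra_simps scaleR_2)
  moreover have "2 *\<^sub>R y = b + y * y" using arg_cong[OF y(2), of "\<lambda>u. 2 *\<^sub>R u"] by (simp add: f_def)
  ultimately have "(1 - y) * (1 - y) = 1 - b" by simp
  moreover have "star (1 - y) = 1 - y" using y by (simp add: S_def star_diff)
  ultimately show ?thesis by blast
qed

text \<open>A positive functional on a unital C*-algebra is bounded: \<open>t - a\<^sup>* a\<close> is a square \<open>c\<^sup>* c\<close>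
  for every \<open>t > norm (a\<^sup>* a)\<close>, and \<open>a \<mapsto> cinner (\<rho> a v) v\<close> is nonnegative on such elements. So every
  representation is continuous in the algebra element.\<close>

lemma star_rep_norm_le:
  fixes \<rho> :: "'o::cstar_algebra_1 \<Rightarrow> 'h::chilbert_space \<Rightarrow> 'h"
  assumes rep: "star_rep K \<rho>" and v: "v \<in> K"
  shows "norm (\<rho> a v) \<le> norm a * norm (\<rho> 1 v)"
proof -
  have adj: "cinner (\<rho> a u) w = cinner u (\<rho> (star a) w)" if "u \<in> K" "w \<in> K" for a u w
    using rep that unfolding star_rep_def by blast
  have mem: "\<rho> a u \<in> K" if "u \<in> K" for a u
    using rep that unfolding star_rep_def bounded_operator_on_def by blast
  have mult: "\<rho> (a * b) u = \<rho> a (\<rho> b u)" if "u \<in> K" for a b u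
    using rep that unfolding star_rep_def by blast
  have sq: "(norm (\<rho> a v))\<^sup>2 = Re (cinner (\<rho> (star a * a) v) v)" for a
  proof -
    have "cinner (\<rho> (star a * a) v) v = cinner (\<rho> a v) (\<rho> a v)"
      using adj[of "\<rho> a v" v "star a"] v by (simp add: mem mult star_star)
    then show ?thesis by (simp add: cinner_self)
  qed
  have le: "(norm (\<rho> a v))\<^sup>2 \<le> t * (norm (\<rho> 1 v))\<^sup>2" if t: "t > (norm a)\<^sup>2" for t
  proof -
    have "t > 0" using t by (meson le_less_trans zero_le_power2)
    have "norm ((1 / t) *\<^sub>R (star a * a)) < 1" using t \<open>t > 0\<close> by (simp add: cstar_identity)
    then obtain c where c: "star c = c" "c * c = 1 - (1 / t) *\<^sub>R (star a * a)"
      using exists_selfadjoint_sqrt[of "(1 / t) *\<^sub>R (star a * a)"]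
      by (auto simp: star_scaleR star_mult star_star)
    then have dec: "1 = star c * c + (complex_of_real (1 / t)) *\<^sub>C (star a * a)"
      by (simp add: scaleR_scaleC)
    have "\<rho> (star 1 * 1) v = \<rho> (star c * c) v + complex_of_real (1 / t) *\<^sub>C \<rho> (star a * a) v"
      using rep v arg_cong[OF dec, of "\<lambda>x. \<rho> x v"] unfolding star_rep_def by simp
    then have "(norm (\<rho> 1 v))\<^sup>2 = (norm (\<rho> c v))\<^sup>2 + (1 / t) * (norm (\<rho> a v))\<^sup>2"
      unfolding sq by (simp add: cinner_add_left cinner_scaleC_left)
    then have "(1 / t) * (norm (\<rho> a v))\<^sup>2 \<le> (norm (\<rho> 1 v))\<^sup>2" by simp
    then show ?thesis using \<open>t > 0\<close> by (simp add: field_simps)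
  qed
  have "(norm (\<rho> a v))\<^sup>2 \<le> (norm a)\<^sup>2 * (norm (\<rho> 1 v))\<^sup>2"
  proof (rule field_le_epsilon)
    fix e :: real assume "e > 0"
    define d where "d = e / (1 + (norm (\<rho> 1 v))\<^sup>2)"
    have "d > 0" using \<open>e > 0\<close> by (simp add: d_def add_pos_nonneg)
    have "d * (norm (\<rho> 1 v))\<^sup>2 \<le> d * (1 + (norm (\<rho> 1 v))\<^sup>2)" using \<open>d > 0\<close> by simp
    also have "\<dots> = e" unfolding d_def by (smt (verit) nonzero_eq_divide_eq zero_le_power2)
    finally have "d * (norm (\<rho> 1 v))\<^sup>2 \<le> e" .
    moreover have "(norm (\<rho> a v))\<^sup>2 \<le> ((norm a)\<^sup>2 + d) * (norm (\<rho> 1 v))\<^sup>2"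
      using \<open>d > 0\<close> by (intro le) simp
    ultimately show "(norm (\<rho> a v))\<^sup>2 \<le> (norm a)\<^sup>2 * (norm (\<rho> 1 v))\<^sup>2 + e"
      by (simp add: algebra_simps)
  qed
  then show ?thesis by (simp add: power_mult_distrib[symmetric] abs_le_square_iff[symmetric])
qed

locale cuntz_rep =
  fixes s :: "nat \<Rightarrow> 'o::cstar_algebra_1" and K :: "'h::chilbert_space set" and \<rho> :: "'o \<Rightarrow> 'h \<Rightarrow> 'h"
  assumes cuntz: "cuntz_algebra_infinity s" and rep: "star_rep K \<rho>"
begin

lemma closed_csubspace_K: "closed_csubspace K"
  using rep by (simp add: star_rep_def)

lemma in_K [simp, intro]: "v \<in> K \<Longrightarrow> \<rho> a v \<in> K"
  using rep unfolding star_rep_def bounded_operator_on_def by blast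

lemma diff_in_K [intro]: "v \<in> K \<Longrightarrow> w \<in> K \<Longrightarrow> v - w \<in> K"
  using closed_csubspace_K unfolding closed_csubspace_def by (blast intro: complex_vector.subspace_diff)

lemma scaleC_in_K [intro]: "v \<in> K \<Longrightarrow> c *\<^sub>C v \<in> K"
  using closed_csubspace_K unfolding closed_csubspace_def by (blast intro: complex_vector.subspace_scale)

lemma zero_in_K [simp, intro]: "0 \<in> K"
  using closed_csubspace_K unfolding closed_csubspace_def by (blast intro: complex_vector.subspace_0)

lemma rep_add_right: "v \<in> K \<Longrightarrow> w \<in> K \<Longrightarrow> \<rho> a (v + w) = \<rho> a v + \<rho> a w"
  and rep_scaleC_right: "v \<in> K \<Longrightarrow> \<rho> a (c *\<^sub>C v) = c *\<^sub>C \<rho> a v"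
  using rep unfolding star_rep_def bounded_operator_on_def by blast+

lemma rep_bounded: "\<exists>B. \<forall>v\<in>K. norm (\<rho> a v) \<le> B * norm v"
proof -
  have "bounded_operator_on K (\<rho> a)" using rep by (simp add: star_rep_def)
  then show ?thesis by (simp add: bounded_operator_on_def)
qed

lemma rep_diff_right: "v \<in> K \<Longrightarrow> w \<in> K \<Longrightarrow> \<rho> a (v - w) = \<rho> a v - \<rho> a w"
  using rep_add_right[of "v - w" w a] by (simp add: diff_in_K)

lemma rep_zero_right [simp]: "\<rho> a 0 = 0"
  using rep_diff_right[of 0 0 a] by simp

lemma rep_add: "v \<in> K \<Longrightarrow> \<rho> (a + b) v = \<rho> a v + \<rho> b v"
  and rep_scaleC: "v \<in> K \<Longrightarrow> \<rho> (c *\<^sub>C a) v = c *\<^sub>C \<rho> a v"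
  and rep_mult: "v \<in> K \<Longrightarrow> \<rho> (a * b) v = \<rho> a (\<rho> b v)"
  and adjoint: "v \<in> K \<Longrightarrow> w \<in> K \<Longrightarrow> cinner (\<rho> a v) w = cinner v (\<rho> (star a) w)"
  using rep unfolding star_rep_def by blast+

lemma rep_diff: "v \<in> K \<Longrightarrow> \<rho> (a - b) v = \<rho> a v - \<rho> b v"
  using rep_add[of v "a - b" b] by simp

lemma star_gen_mult_gen: "i \<ge> 1 \<Longrightarrow> j \<ge> 1 \<Longrightarrow> star (s i) * s j = (if i = j then 1 else 0)"
  using cuntz unfolding cuntz_algebra_infinity_def cuntz_relations_def by blast

lemma continuous_on_rep: "v \<in> K \<Longrightarrow> continuous_on S (\<lambda>a. \<rho> a v)"
proof -
  assume v: "v \<in> K"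
  have "dist (\<rho> a v) (\<rho> b v) \<le> norm (\<rho> 1 v) * dist a b" for a b
    using star_rep_norm_le[OF rep v, of "a - b"] by (simp add: dist_norm rep_diff v mult.commute)
  then have "lipschitz_on (norm (\<rho> 1 v)) S (\<lambda>a. \<rho> a v)" by (auto simp: lipschitz_on_def)
  then show ?thesis by (rule lipschitz_on_continuous_on)
qed

lemma continuous_on_rep_right: "S \<subseteq> K \<Longrightarrow> continuous_on S (\<rho> a)"
proof -
  assume S: "S \<subseteq> K"
  obtain B where B: "\<And>v. v \<in> K \<Longrightarrow> norm (\<rho> a v) \<le> B * norm v"
    using rep_bounded by blast
  have "dist (\<rho> a v) (\<rho> a w) \<le> \<bar>B\<bar> * dist v w" if "v \<in> S" "w \<in> S" for v w
  proof -
    have "dist (\<rho> a v) (\<rho> a w) \<le> B * norm (v - w)"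
      using B[of "v - w"] S that by (auto simp: dist_norm rep_diff_right[symmetric] subsetD)
    also have "\<dots> \<le> \<bar>B\<bar> * norm (v - w)" by (intro mult_right_mono) auto
    finally show ?thesis by (simp add: dist_norm)
  qed
  then have "lipschitz_on \<bar>B\<bar> S (\<rho> a)" by (auto simp: lipschitz_on_def)
  then show ?thesis by (rule lipschitz_on_continuous_on)
qed

text \<open>The elements \<open>a\<close> for which \<open>a\<close> and \<open>a\<^sup>*\<close> have a property that is closed and stable under the
  algebra operations form a C*-subalgebra, which is everything once it contains the generators. This
  reduces invariance and intertwining relations to the generators and their adjoints.\<close>

lemma generator_induct [consumes 0, case_names closed one gen star_gen add scale mult]:
  assumes closed: "closed {a. P a}"
    and one: "P 1"
    and gen: "\<And>i. i \<ge> 1 \<Longrightarrow> P (s i)"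
    and star_gen: "\<And>i. i \<ge> 1 \<Longrightarrow> P (star (s i))"
    and add: "\<And>a b. P a \<Longrightarrow> P b \<Longrightarrow> P (a + b)"
    and scale: "\<And>a c. P a \<Longrightarrow> P (c *\<^sub>C a)"
    and mult: "\<And>a b. P a \<Longrightarrow> P b \<Longrightarrow> P (a * b)"
  shows "P a"
proof -
  have "P a \<and> P (star a)" if "a \<in> star_algebra_generated s" for a
    using that by induction (auto simp: one gen star_gen add scale mult star_add star_scaleC star_mult star_star)
  then have "star_algebra_generated s \<subseteq> {a. P a}" by blast
  then have "closure (star_algebra_generated s) \<subseteq> {a. P a}" by (rule closure_minimal[OF _ closed])
  then show ?thesis using cuntz unfolding cuntz_algebra_infinity_def by blast
qed

lemma subrepresentationI:
  assumes M: "closed_csubspace M" "M \<subseteq> K"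
    and one: "\<And>v. v \<in> M \<Longrightarrow> \<rho> 1 v \<in> M"
    and gen: "\<And>i v. i \<ge> 1 \<Longrightarrow> v \<in> M \<Longrightarrow> \<rho> (s i) v \<in> M"
    and star_gen: "\<And>i v. i \<ge> 1 \<Longrightarrow> v \<in> M \<Longrightarrow> \<rho> (star (s i)) v \<in> M"
  shows "subrepresentation K \<rho> M"
proof -
  have sub: "csubspace M" and cl: "closed M" using M by (auto simp: closed_csubspace_def)
  have K: "v \<in> K" if "v \<in> M" for v using M that by blast
  have "\<forall>v\<in>M. \<rho> a v \<in> M" for a
  proof (induction a rule: generator_induct)
    case closed
    have "{a. \<forall>v\<in>M. \<rho> a v \<in> M} = (\<Inter>v\<in>M. (\<lambda>a. \<rho> a v) -` M)" by auto
    then show ?case using cl K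
      by (auto intro!: closed_INT closed_vimage continuous_on_rep)
  qed (use assms sub K in \<open>auto simp: rep_add rep_scaleC rep_mult
      intro: complex_vector.subspace_add complex_vector.subspace_scale\<close>)
  then show ?thesis using M by (simp add: subrepresentation_def)
qed

lemma subrepresentation_cuntz_rep:
  assumes "subrepresentation K \<rho> M"
  shows "cuntz_rep s M \<rho>"
proof
  have M: "closed_csubspace M" "M \<subseteq> K" "\<And>a v. v \<in> M \<Longrightarrow> \<rho> a v \<in> M"
    using assms by (auto simp: subrepresentation_def)
  have K: "v \<in> K" if "v \<in> M" for v using that M by blast
  have "\<exists>B. \<forall>v\<in>M. norm (\<rho> a v) \<le> B * norm v" for a
    using rep_bounded[of a] K by blast
  then show "star_rep M \<rho>"
    using M K unfolding star_rep_def bounded_operator_on_def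
    by (auto simp: rep_add rep_add_right rep_scaleC rep_scaleC_right rep_mult adjoint)
qed (rule cuntz)

text \<open>The closure of an orbit is an invariant subspace, so it is everything.\<close>

lemma cyclic_if_irreducible:
  assumes irr: "irreducible_rep K \<rho>" and v: "v \<in> K" "v \<noteq> 0" "\<rho> 1 v = v"
  shows "cyclic_vector K \<rho> v"
proof -
  define M where "M = closure (range (\<lambda>a. \<rho> a v))"
  have "csubspace (range (\<lambda>a. \<rho> a v))"
  proof (rule complex_vector.subspaceI)
    show "0 \<in> range (\<lambda>a. \<rho> a v)" using rep_scaleC[of v 0 1] v by (auto simp: image_iff intro!: exI[of _ "0 *\<^sub>C 1"])
    show "x + y \<in> range (\<lambda>a. \<rho> a v)" if "x \<in> range (\<lambda>a. \<rho> a v)" "y \<in> range (\<lambda>a. \<rho> a v)" for x y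
      using that v by (auto simp: rep_add[symmetric])
    show "c *\<^sub>C x \<in> range (\<lambda>a. \<rho> a v)" if "x \<in> range (\<lambda>a. \<rho> a v)" for c x
      using that v by (auto simp: rep_scaleC[symmetric])
  qed
  then have cM: "closed_csubspace M" unfolding M_def closed_csubspace_def by (simp add: csubspace_closure)
  have "range (\<lambda>a. \<rho> a v) \<subseteq> K" using v by auto
  then have MK: "M \<subseteq> K" unfolding M_def using closed_csubspace_K by (intro closure_minimal) (auto simp: closed_csubspace_def)
  have "\<rho> b ` M \<subseteq> M" for b
    unfolding M_def using closure_subset v MK[unfolded M_def]
    by (intro image_closure_subset continuous_on_rep_right closed_closure) (force simp: rep_mult[symmetric])+
  then have "subrepresentation K \<rho> M" using cM MK by (auto simp: subrepresentation_def)
  moreover have "v \<in> M" unfolding M_def using closure_subset v by (metis rangeI subsetD)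
  ultimately have "M = K" using irr v unfolding irreducible_rep_def by blast
  then show ?thesis using v by (simp add: cyclic_vector_def M_def)
qed

end

section \<open>The Gauss map and continued fractions\<close>

definition gauss_map :: "real \<Rightarrow> real" where
  "gauss_map x = frac (1 / x)"

definition cf_digit :: "real \<Rightarrow> nat" where
  "cf_digit x = nat \<lfloor>1 / x\<rfloor>"

lemma Omega_iff: "x \<in> Omega \<longleftrightarrow> 0 < x \<and> x < 1 \<and> x \<notin> \<rat>"
proof -
  have "x \<noteq> 0" "x \<noteq> 1" if "x \<notin> \<rat>" using that by auto
  then show ?thesis unfolding Omega_def by (auto simp: less_le)
qed

lemma Rats_add_of_nat_iff [simp]: "x + of_nat n \<in> \<rat> \<longleftrightarrow> x \<in> \<rat>" for x :: real
  by (metis Rats_add Rats_diff Rats_of_nat add_diff_cancel_right')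

lemma Rats_inverse_iff [simp]: "1 / x \<in> \<rat> \<longleftrightarrow> x \<in> \<rat>" for x :: real
  by (metis Rats_1 Rats_divide div_by_1 divide_divide_eq_right mult_1)

lemma frac_in_Omega: "x \<notin> \<rat> \<Longrightarrow> frac x \<in> Omega" for x :: real
proof -
  assume x: "x \<notin> \<rat>"
  have "x = frac x + of_int \<lfloor>x\<rfloor>" by (simp add: frac_def)
  then have "frac x \<notin> \<rat>" using x by (metis Rats_add Rats_of_int)
  then show ?thesis using frac_ge_0[of x] frac_lt_1[of x]
    unfolding Omega_iff by (metis Rats_0 less_le)
qed

lemma cf_digit_ge_1:
  assumes "x \<in> Omega"
  shows "cf_digit x \<ge> 1"
proof -
  have "1 / x > 1" using assms by (simp add: Omega_iff)
  then show ?thesis unfolding cf_digit_def by linarith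
qed

lemma gauss_map_in_Omega: "x \<in> Omega \<Longrightarrow> gauss_map x \<in> Omega"
  unfolding gauss_map_def by (rule frac_in_Omega) (simp add: Omega_iff)

lemma gauss_map_eq: "x \<in> Omega \<Longrightarrow> gauss_map x = 1 / x - real (cf_digit x)"
  by (simp add: gauss_map_def cf_digit_def frac_def Omega_iff)

lemma gauss_map_inverse: "x \<in> Omega \<Longrightarrow> 1 / (gauss_map x + real (cf_digit x)) = x"
  by (simp add: gauss_map_eq)

lemma gauss_map_funpow_in_Omega: "x \<in> Omega \<Longrightarrow> (gauss_map ^^ n) x \<in> Omega"
  by (induction n) (auto simp: gauss_map_in_Omega)

lemma
  assumes "x \<in> Omega" "i \<ge> 1"
  shows branch_in_Omega: "1 / (x + real i) \<in> Omega"
    and gauss_map_branch: "gauss_map (1 / (x + real i)) = x"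
    and cf_digit_branch: "cf_digit (1 / (x + real i)) = i"
proof -
  have x: "0 < x" "x < 1" "x \<notin> \<rat>" using assms by (auto simp: Omega_iff)
  have "x + real i > 1" using x assms by linarith
  then show "1 / (x + real i) \<in> Omega" using x by (simp add: Omega_iff)
  have fl: "\<lfloor>x + real i\<rfloor> = int i" using x by linarith
  show "gauss_map (1 / (x + real i)) = x" by (simp add: gauss_map_def frac_def fl)
  show "cf_digit (1 / (x + real i)) = i" by (simp add: cf_digit_def fl)
qed

text \<open>A branch maps two points at distance \<open>d\<close> to points at distance at most \<open>d / (1 + d)\<close>, because
  \<open>(k + u) (k + v) \<ge> 1 + u + v \<ge> 1 + d\<close>; iterating from \<open>d \<le> 1\<close> gives \<open>1 / (n + 1)\<close>. This crude
  contraction rate suffices for every convergence statement on continued fractions.\<close>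

lemma branch_contraction:
  fixes u v :: real
  assumes "0 \<le> u" "0 \<le> v" "k \<ge> 1" and d: "\<bar>u - v\<bar> \<le> 1 / (real n + 1)"
  shows "\<bar>1 / (real k + u) - 1 / (real k + v)\<bar> \<le> 1 / (real (Suc n) + 1)"
proof -
  have k: "real k \<ge> 1" using assms by simp
  have pos: "real k + u > 0" "real k + v > 0" using assms k by linarith+
  have "(real k + u) * (real k + v) \<ge> (1 + u) * (1 + v)"
    using assms k by (intro mult_mono) auto
  moreover have "(1 + u) * (1 + v) \<ge> 1 + u + v" using assms by (simp add: algebra_simps)
  moreover have "u + v \<ge> \<bar>u - v\<bar>" using assms by linarith
  ultimately have ge: "(real k + u) * (real k + v) \<ge> 1 + \<bar>u - v\<bar>" by linarith
  have "1 / (real k + u) - 1 / (real k + v) = (v - u) / ((real k + u) * (real k + v))"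
    using pos by (simp add: field_simps)
  then have "\<bar>1 / (real k + u) - 1 / (real k + v)\<bar> = \<bar>u - v\<bar> / ((real k + u) * (real k + v))"
    using pos by (simp add: abs_mult abs_minus_commute)
  also have "\<dots> \<le> \<bar>u - v\<bar> / (1 + \<bar>u - v\<bar>)"
    using ge by (intro divide_left_mono) (auto intro!: mult_pos_pos pos)
  also have "\<dots> \<le> 1 / (real (Suc n) + 1)"
  proof -
    have "\<bar>u - v\<bar> * (real n + 1) \<le> 1" using d by (simp add: field_simps)
    then show ?thesis by (simp add: field_simps)
  qed
  finally show ?thesis .
qed

lemma cf_value_range: "\<forall>i. a i \<ge> 1 \<Longrightarrow> 0 \<le> cf_value a n \<and> cf_value a n \<le> 1"
proof (induction n arbitrary: a)
  case (Suc n)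
  have "0 \<le> cf_value (\<lambda>i. a (Suc i)) n" using Suc by auto
  moreover have "real (a 0) \<ge> 1" using Suc.prems by (simp add: Suc_leI)
  ultimately show ?case by simp
qed simp

lemma cf_value_Cauchy_bound:
  assumes "\<forall>i. a i \<ge> 1" "n \<le> m" "n \<le> m'"
  shows "\<bar>cf_value a m - cf_value a m'\<bar> \<le> 1 / (real n + 1)"
  using assms
proof (induction n arbitrary: a m m')
  case 0
  then show ?case using cf_value_range[of a m] cf_value_range[of a m'] by simp linarith
next
  case (Suc n)
  obtain k k' where k: "m = Suc k" "m' = Suc k'" "n \<le> k" "n \<le> k'"
    using Suc.prems by (metis Suc_le_D Suc_le_mono)
  have a: "\<forall>i. a (Suc i) \<ge> 1" using Suc.prems by simp
  show ?case unfolding k cf_value.simps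
    using cf_value_range[OF a] Suc.prems(1)
    by (intro branch_contraction Suc.IH a k) auto
qed

lemma cf_value_convergent:
  assumes "\<forall>i. a i \<ge> 1"
  shows "\<exists>x. cf_value a \<longlonglongrightarrow> x"
proof -
  have "Cauchy (cf_value a)"
    unfolding Cauchy_iff
  proof (intro allI impI)
    fix e :: real assume "e > 0"
    then obtain n where n: "1 / (real n + 1) < e" using nat_approx_posE[of e] by (auto simp: add.commute)
    then show "\<exists>M. \<forall>m\<ge>M. \<forall>n\<ge>M. norm (cf_value a m - cf_value a n) < e"
      using cf_value_Cauchy_bound[OF assms] by (intro exI[of _ n]) (force intro: le_less_trans)
  qed
  then show ?thesis by (simp add: Cauchy_convergent_iff convergent_def)
qed

text \<open>Peeling off the first partial quotient: passing to the limit in the recursion of \<open>cf_value\<close>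
  exhibits \<open>x\<close> as the image of the limit of the shifted continued fraction under a branch.\<close>

lemma cf_value_limit_step:
  assumes a: "\<forall>i. a i \<ge> 1" and x: "cf_value a \<longlonglongrightarrow> x"
  shows "\<exists>y. cf_value (\<lambda>i. a (Suc i)) \<longlonglongrightarrow> y \<and> 0 \<le> y \<and> y \<le> 1 \<and> x = 1 / (y + real (a 0))"
proof -
  have a': "\<forall>i. a (Suc i) \<ge> 1" using a by simp
  obtain y where y: "cf_value (\<lambda>i. a (Suc i)) \<longlonglongrightarrow> y" using cf_value_convergent[OF a'] by blast
  have r: "0 \<le> y" "y \<le> 1"
    using cf_value_range[OF a'] by (auto intro: LIMSEQ_le_const[OF y] LIMSEQ_le_const2[OF y])
  have "real (a 0) \<ge> 1" using a by simp
  then have "(\<lambda>n. cf_value a (Suc n)) \<longlonglongrightarrow> 1 / (real (a 0) + y)"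
    using r by (auto intro!: tendsto_intros y)
  then have "x = 1 / (real (a 0) + y)" using x LIMSEQ_Suc LIMSEQ_unique by blast
  then show ?thesis using y r by (auto simp: add.commute)
qed

lemma cf_value_limit_pos:
  assumes a: "\<forall>i. a i \<ge> 1" and x: "cf_value a \<longlonglongrightarrow> x"
  shows "x > 0"
  using cf_value_limit_step[OF assms] a by (metis add_nonneg_pos divide_pos_pos less_le_trans of_nat_0_less_iff zero_less_one)

text \<open>Infinite descent: if the limit is \<open>p / q\<close>, the limit of the shifted continued fraction
  has denominator \<open>p < q\<close>.\<close>

lemma cf_value_limit_irrational:
  assumes "\<forall>i. a i \<ge> 1" "cf_value a \<longlonglongrightarrow> x"
  shows "x \<notin> \<rat>"
proof -
  have "x \<noteq> of_int p / of_int q" if "q > 0" for p q :: int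
    using that assms
  proof (induction "nat q" arbitrary: p q a x rule: less_induct)
    case less
    show ?case
    proof
      assume eq: "x = of_int p / of_int q"
      obtain y where y: "cf_value (\<lambda>i. a (Suc i)) \<longlonglongrightarrow> y" "x = 1 / (y + real (a 0))"
        using cf_value_limit_step[OF less.prems(2,3)] by blast
      have a': "\<forall>i. a (Suc i) \<ge> 1" using less.prems by simp
      have "y > 0" using cf_value_limit_pos[OF a' y(1)] .
      moreover have "real (a 0) \<ge> 1" using less.prems(2) by simp
      ultimately have "0 < x" "x < 1" unfolding y(2) by auto
      then have p: "0 < p" "p < q" using less.prems(1) unfolding eq
        by (auto simp: zero_less_divide_iff divide_less_eq)
      have "y = 1 / x - real (a 0)" using y(2) by simp
      also have "\<dots> = of_int (q - int (a 0) * p) / of_int p"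
        unfolding eq using p by (simp add: field_simps)
      finally have "y = of_int (q - int (a 0) * p) / of_int p" .
      moreover have "y \<noteq> of_int (q - int (a 0) * p) / of_int p"
        by (rule less.hyps[OF _ p(1) a' y(1)]) (use p in simp)
      ultimately show False by contradiction
    qed
  qed
  then show ?thesis by (metis Rats_cases')
qed

lemma cf_value_limit_in_Omega:
  assumes "\<forall>i. a i \<ge> 1" "cf_value a \<longlonglongrightarrow> x"
  shows "x \<in> Omega"
proof -
  have "x \<le> 1" using cf_value_range[OF assms(1)] by (auto intro: LIMSEQ_le_const2[OF assms(2)])
  then show ?thesis using cf_value_limit_pos[OF assms] cf_value_limit_irrational[OF assms]
    by (metis Omega_iff Rats_1 less_le)
qed

lemma cf_value_limit_digit:
  assumes "\<forall>i. a i \<ge> 1" "cf_value a \<longlonglongrightarrow> x"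
  shows "a i = cf_digit ((gauss_map ^^ i) x)"
  using assms
proof (induction i arbitrary: a x)
  case (0 a x)
  then obtain y where y: "cf_value (\<lambda>i. a (Suc i)) \<longlonglongrightarrow> y" "x = 1 / (y + real (a 0))"
    using cf_value_limit_step by blast
  then have "y \<in> Omega" using 0 by (intro cf_value_limit_in_Omega[OF _ y(1)]) simp
  then show ?case using 0 y(2) by (simp add: cf_digit_branch)
next
  case (Suc i a x)
  then obtain y where y: "cf_value (\<lambda>i. a (Suc i)) \<longlonglongrightarrow> y" "x = 1 / (y + real (a 0))"
    using cf_value_limit_step by blast
  then have "y \<in> Omega" using Suc.prems by (intro cf_value_limit_in_Omega[OF _ y(1)]) simp
  then have "gauss_map x = y" using y Suc.prems by (simp add: gauss_map_branch)
  moreover have "a (Suc i) = cf_digit ((gauss_map ^^ i) y)"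
    using Suc.prems by (intro Suc.IH[OF _ y(1)]) simp
  ultimately show ?case by (simp add: funpow_swap1)
qed

lemma cf_value_orbit_tendsto:
  assumes "x \<in> Omega"
  shows "cf_value (\<lambda>i. cf_digit ((gauss_map ^^ i) x)) \<longlonglongrightarrow> x"
proof -
  have bound: "\<bar>cf_value (\<lambda>i. cf_digit ((gauss_map ^^ i) x)) n - x\<bar> \<le> 1 / (real n + 1)" if "x \<in> Omega" for x n
    using that
  proof (induction n arbitrary: x)
    case 0
    then show ?case by (simp add: Omega_iff)
  next
    case (Suc n)
    define a where "a = (\<lambda>i. cf_digit ((gauss_map ^^ i) (gauss_map x)))"
    have a: "\<forall>i. a i \<ge> 1" unfolding a_def
      using Suc.prems by (auto intro: cf_digit_ge_1 gauss_map_funpow_in_Omega gauss_map_in_Omega simp del: One_nat_def)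
    have g: "gauss_map x \<in> Omega" using Suc.prems by (rule gauss_map_in_Omega)
    have "\<bar>1 / (real (cf_digit x) + cf_value a n) - 1 / (real (cf_digit x) + gauss_map x)\<bar> \<le> 1 / (real (Suc n) + 1)"
      using cf_value_range[OF a, of n] g cf_digit_ge_1[OF Suc.prems] Suc.IH[OF g]
      by (intro branch_contraction) (auto simp: Omega_iff a_def)
    then show ?case using gauss_map_inverse[OF Suc.prems]
      by (simp add: a_def funpow_swap1 add.commute)
  qed
  have "(\<lambda>n. 1 / (real n + 1)) \<longlonglongrightarrow> 0"
    using LIMSEQ_inverse_real_of_nat by (simp add: inverse_eq_divide add.commute)
  then have "(\<lambda>n. cf_value (\<lambda>i. cf_digit ((gauss_map ^^ i) x)) n - x) \<longlonglongrightarrow> 0"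
    by (rule Lim_null_comparison[rotated]) (auto simp: bound[OF assms])
  then show ?thesis by (rule LIM_zero_cancel)
qed

lemma CFE_eq:
  assumes "x \<in> Omega"
  shows "CFE x i = cf_digit ((gauss_map ^^ i) x)"
proof -
  have "CFE x = (\<lambda>i. cf_digit ((gauss_map ^^ i) x))"
    unfolding CFE_def
    using assms cf_value_limit_digit
    by (intro the_equality conjI allI cf_value_orbit_tendsto cf_digit_ge_1 gauss_map_funpow_in_Omega ext) blast+
  then show ?thesis by simp
qed

lemma CFE_ge_1: "x \<in> Omega \<Longrightarrow> CFE x i \<ge> 1"
  unfolding CFE_eq by (intro cf_digit_ge_1 gauss_map_funpow_in_Omega)

lemma CFE_funpow: "x \<in> Omega \<Longrightarrow> CFE ((gauss_map ^^ n) x) i = CFE x (n + i)"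
  by (simp add: CFE_eq gauss_map_funpow_in_Omega add.commute[of n i] funpow_add)

text \<open>The branches therefore code \<open>Omega\<close> faithfully by the full sequence space: this and
  \<open>CFE_surj\<close> say that \<open>CFE\<close> is a bijection, under which the Gauss map becomes the shift.\<close>

lemma CFE_inject:
  assumes "x \<in> Omega" "y \<in> Omega" "\<And>i. CFE x i = CFE y i"
  shows "x = y"
proof -
  have "(\<lambda>i. cf_digit ((gauss_map ^^ i) x)) = (\<lambda>i. cf_digit ((gauss_map ^^ i) y))"
    using assms by (auto simp: CFE_eq)
  then show ?thesis
    using cf_value_orbit_tendsto[OF assms(1)] cf_value_orbit_tendsto[OF assms(2)] LIMSEQ_unique by metis
qed

lemma CFE_surj:
  assumes "\<forall>i. a i \<ge> 1"
  shows "\<exists>x\<in>Omega. CFE x = a"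
proof -
  obtain x where x: "cf_value a \<longlonglongrightarrow> x" using cf_value_convergent[OF assms] by blast
  then show ?thesis
    using cf_value_limit_in_Omega[OF assms x] cf_value_limit_digit[OF assms x]
    by (auto simp: CFE_eq fun_eq_iff intro!: bexI[of _ x])
qed

lemma CFE_branch:
  assumes "x \<in> Omega" "k \<ge> 1"
  shows "CFE (1 / (x + real k)) = case_nat k (CFE x)"
proof
  fix i show "CFE (1 / (x + real k)) i = case_nat k (CFE x) i"
    using assms by (cases i)
      (simp_all add: CFE_eq branch_in_Omega cf_digit_branch gauss_map_branch funpow_swap1)
qed

section \<open>Modular equivalence is tail equivalence\<close>

text \<open>Tail equivalence is extended to all irrational numbers by ignoring the integer part, so that
  it can be tested on the generators \<open>x + 1\<close>, \<open>- x\<close> and \<open>1 / x\<close> of the modular group.\<close>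

definition tail_equiv :: "real \<Rightarrow> real \<Rightarrow> bool" where
  "tail_equiv x y \<longleftrightarrow> (\<exists>m n. (gauss_map ^^ m) (frac x) = (gauss_map ^^ n) (frac y))"

lemma tail_equiv_sym: "tail_equiv x y \<Longrightarrow> tail_equiv y x"
  unfolding tail_equiv_def by metis

lemma tail_equiv_trans [trans]:
  assumes "tail_equiv x y" "tail_equiv y z"
  shows "tail_equiv x z"
proof -
  obtain m n k l where "(gauss_map ^^ m) (frac x) = (gauss_map ^^ n) (frac y)"
    "(gauss_map ^^ k) (frac y) = (gauss_map ^^ l) (frac z)"
    using assms unfolding tail_equiv_def by blast
  then have "(gauss_map ^^ (k + m)) (frac x) = (gauss_map ^^ (n + l)) (frac z)"
    by (simp add: funpow_add) (metis add.commute comp_apply funpow_add)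
  then show ?thesis unfolding tail_equiv_def by blast
qed

lemma frac_add_of_int [simp]: "frac (x + of_int k) = frac x" for x :: real
  by (simp add: frac_def)

lemma tail_equiv_add_int: "tail_equiv (x + of_int k) x"
  by (simp add: tail_equiv_def exI[of _ 0])

text \<open>For \<open>t < 1/2\<close> the expansion of \<open>1 - t\<close> arises from that of \<open>t\<close> by splitting the first
  digit \<open>k\<close> into \<open>1, k - 1\<close>.\<close>

lemma gauss_map_complement:
  assumes "t \<in> Omega" "t < 1/2"
  shows "gauss_map (gauss_map (1 - t)) = gauss_map t"
proof -
  have t: "0 < t" "t < 1/2" using assms by (auto simp: Omega_iff)
  then have "\<lfloor>1 / (1 - t)\<rfloor> = 1" by (intro floor_unique) (auto simp: field_simps)
  then have "gauss_map (1 - t) = 1 / (1 - t) - 1" by (simp add: gauss_map_def frac_def)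
  also have "\<dots> = t / (1 - t)" using t by (simp add: field_simps)
  finally have "gauss_map (gauss_map (1 - t)) = frac ((1 - t) / t)" by (simp add: gauss_map_def)
  also have "(1 - t) / t = 1 / t + of_int (- 1)" using t by (simp add: field_simps)
  finally show ?thesis unfolding frac_add_of_int by (simp add: gauss_map_def)
qed

lemma tail_equiv_minus:
  assumes "x \<notin> \<rat>"
  shows "tail_equiv (- x) x"
proof -
  define t where "t = frac x"
  have t: "t \<in> Omega" using frac_in_Omega[OF assms] by (simp add: t_def)
  have "frac (- x) = 1 - t"
    using assms by (auto simp: frac_neg t_def elim!: Ints_cases)
  moreover have "\<exists>m n. (gauss_map ^^ m) (1 - t) = (gauss_map ^^ n) t"
  proof (cases "t < 1/2")
    case True
    then show ?thesis using gauss_map_complement[OF t] by (intro exI[of _ 2] exI[of _ 1]) (simp add: numeral_2_eq_2)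
  next
    case False
    have "1 - t \<in> Omega" using t by (auto simp: Omega_iff) (metis Rats_1 Rats_diff diff_diff_eq2 add_diff_cancel_left')
    moreover have "t \<noteq> 1/2" using t by (metis Omega_iff Rats_inverse_iff Rats_number_of)
    ultimately have "gauss_map (gauss_map t) = gauss_map (1 - t)"
      using gauss_map_complement[of "1 - t"] False by simp
    then show ?thesis by (intro exI[of _ 1] exI[of _ 2]) (simp add: numeral_2_eq_2)
  qed
  ultimately show ?thesis by (simp add: tail_equiv_def t_def)
qed

lemma tail_equiv_inverse:
  assumes "x \<notin> \<rat>"
  shows "tail_equiv (1 / x) x"
proof -
  have less1: "tail_equiv (1 / x) x" if "0 < x" "x < 1" for x
  proof -
    have "frac x = x" using that by (simp add: frac_eq)
    then show ?thesis unfolding tail_equiv_def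
      by (intro exI[of _ 0] exI[of _ 1]) (simp add: gauss_map_def)
  qed
  have pos: "tail_equiv (1 / x) x" if x: "0 < x" "x \<notin> \<rat>" for x
  proof (cases "x < 1")
    case False
    moreover have "x \<noteq> 1" using x by auto
    ultimately show ?thesis using tail_equiv_sym[OF less1[of "1 / x"]] by simp
  qed (use x less1 in auto)
  consider "x > 0" | "x < 0" using assms by (metis Rats_0 linorder_neqE_linordered_idom)
  then show ?thesis
  proof cases
    case 2
    have "tail_equiv (1 / x) (1 / (- x))"
      using tail_equiv_minus[of "1 / (- x)"] assms by simp
    also have "tail_equiv (1 / (- x)) (- x)" using 2 assms by (intro pos) auto
    also have "tail_equiv (- x) x" by (rule tail_equiv_minus[OF assms])
    finally show ?thesis .
  qed (use pos assms in auto)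
qed

lemma mobius_inverse:
  fixes x y :: real
  assumes det: "a * d - b * c = 1 \<or> a * d - b * c = (-1::int)"
    and nz: "of_int c * y + of_int d \<noteq> 0" and x: "x = (of_int a * y + of_int b) / (of_int c * y + of_int d)"
  shows "of_int (- c) * x + of_int a \<noteq> 0" "y = (of_int d * x + of_int (- b)) / (of_int (- c) * x + of_int a)"
proof -
  have e: "x * (of_int c * y + of_int d) = of_int a * y + of_int b" using nz x by simp
  define D :: real where "D = of_int (a * d - b * c)"
  have D: "D \<noteq> 0" using det unfolding D_def of_int_eq_0_iff by linarith
  have "(of_int (- c) * x + of_int a) * (of_int c * y + of_int d) = of_int a * (of_int c * y + of_int d) - of_int c * (x * (of_int c * y + of_int d))"
    by (simp add: algebra_simps)
  also have "\<dots> = D" unfolding e D_def by (simp add: algebra_simps)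
  finally show nz': "of_int (- c) * x + of_int a \<noteq> 0" using D by auto
  have "y * (of_int (- c) * x + of_int a) = of_int d * x + of_int (- b)"
    using e by (simp add: algebra_simps)
  then show "y = (of_int d * x + of_int (- b)) / (of_int (- c) * x + of_int a)"
    using nz' by (simp add: nonzero_eq_divide_eq)
qed

lemma mobius_irrational:
  fixes y :: real
  assumes "a * d - b * c = 1 \<or> a * d - b * c = (-1::int)" "of_int c * y + of_int d \<noteq> 0" "y \<notin> \<rat>"
  shows "(of_int a * y + of_int b) / (of_int c * y + of_int d) \<notin> \<rat>"
proof
  define x where "x = (of_int a * y + of_int b) / (of_int c * y + of_int d)"
  assume "(of_int a * y + of_int b) / (of_int c * y + of_int d) \<in> \<rat>"
  then have "x \<in> \<rat>" by (simp add: x_def)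
  then have "(of_int d * x + of_int (- b)) / (of_int (- c) * x + of_int a) \<in> \<rat>"
    by (intro Rats_divide Rats_add Rats_mult Rats_of_int)
  then have "y \<in> \<rat>" using mobius_inverse(2)[OF assms(1,2) x_def] by simp
  then show False using assms by simp
qed

text \<open>The Euclidean algorithm on the pair \<open>(a, c)\<close> writes a Moebius transformation of determinant
  \<open>\<plusminus>1\<close> as a product of integer translations, inversions and a sign.\<close>

lemma tail_equiv_mobius:
  fixes y :: real and a b c d :: int
  assumes "a * d - b * c = 1 \<or> a * d - b * c = -1" "y \<notin> \<rat>" "of_int c * y + of_int d \<noteq> 0"
  shows "tail_equiv ((of_int a * y + of_int b) / (of_int c * y + of_int d)) y"
  using assms
proof (induction "nat \<bar>c\<bar>" arbitrary: a b c d rule: less_induct)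
  case less
  show ?case
  proof (cases "c = 0")
    case True
    then have "a * d = 1 \<or> a * d = - 1" using less.prems by simp
    then have "(a = 1 \<or> a = -1) \<and> (d = 1 \<or> d = -1)"
      by (metis zmult_eq_1_iff minus_mult_right minus_equation_iff)
    then consider "a = d" "d = 1 \<or> d = -1" | "a = - d" "d = 1 \<or> d = -1" by auto
    then show ?thesis
    proof cases
      case 1
      then have "(of_int a * y + of_int b) / (of_int c * y + of_int d) = y + of_int (d * b)" using True by auto
      then show ?thesis by (simp only: tail_equiv_add_int)
    next
      case 2
      then have "(of_int a * y + of_int b) / (of_int c * y + of_int d) = - y + of_int (d * b)" using True by auto
      also have "tail_equiv (- y + of_int (d * b)) (- y)" by (rule tail_equiv_add_int)
      also have "tail_equiv (- y) y" using less.prems by (intro tail_equiv_minus)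
      finally show ?thesis .
    qed
  next
    case False
    define q r where "q = a div c" and "r = a mod c"
    have a: "a = q * c + r" by (simp add: q_def r_def)
    define x where "x = (of_int a * y + of_int b) / (of_int c * y + of_int d)"
    define x' where "x' = (of_int r * y + of_int (b - q * d)) / (of_int c * y + of_int d)"
    have x: "x = x' + of_int q" using less.prems(3)
      by (simp add: x_def x'_def a field_simps)
    have det: "c * (b - q * d) - d * r = 1 \<or> c * (b - q * d) - d * r = -1"
      using less.prems(1) by (auto simp: a algebra_simps)
    have "x \<notin> \<rat>" unfolding x_def by (rule mobius_irrational[OF less.prems(1,3,2)])
    then have x': "x' \<notin> \<rat>" unfolding x by (metis Rats_add Rats_of_int)
    then have nz: "of_int r * y + of_int (b - q * d) \<noteq> 0" unfolding x'_def by (metis Rats_0 div_0)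
    have "nat \<bar>r\<bar> < nat \<bar>c\<bar>" using False abs_mod_less[of c a] by (simp add: r_def)
    then have "tail_equiv (1 / x') y" unfolding x'_def
      using less.hyps[OF _ det less.prems(2) nz] by simp
    moreover have "tail_equiv x x'" unfolding x by (rule tail_equiv_add_int)
    moreover have "tail_equiv x' (1 / x')" using tail_equiv_sym[OF tail_equiv_inverse[OF x']] .
    ultimately show ?thesis unfolding x_def[symmetric] using tail_equiv_trans by blast
  qed
qed

lemma modular_equiv_refl: "x \<sim>\<^sub>m x"
  unfolding modular_equiv_def
  by (rule exI[of _ 1], rule exI[of _ 0], rule exI[of _ 0], rule exI[of _ 1]) simp

lemma modular_equiv_sym: "x \<sim>\<^sub>m y \<Longrightarrow> y \<sim>\<^sub>m x"
proof -
  assume "x \<sim>\<^sub>m y"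
  then obtain a b c d :: int where det: "a * d - b * c = 1 \<or> a * d - b * c = -1"
    and nz: "of_int c * y + of_int d \<noteq> 0" and x: "x = (of_int a * y + of_int b) / (of_int c * y + of_int d)"
    unfolding modular_equiv_def by blast
  have "d * a - (- b) * (- c) = 1 \<or> d * a - (- b) * (- c) = -1" using det by (simp add: algebra_simps)
  then show ?thesis unfolding modular_equiv_def using mobius_inverse[OF det nz x] by blast
qed

lemma modular_equiv_trans:
  assumes "x \<sim>\<^sub>m y" "y \<sim>\<^sub>m z"
  shows "x \<sim>\<^sub>m z"
proof -
  obtain a b c d :: int where det: "a * d - b * c = 1 \<or> a * d - b * c = -1"
    and nz: "of_int c * y + of_int d \<noteq> 0" and x: "x = (of_int a * y + of_int b) / (of_int c * y + of_int d)"
    using assms(1) unfolding modular_equiv_def by blast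
  obtain a' b' c' d' :: int where det': "a' * d' - b' * c' = 1 \<or> a' * d' - b' * c' = -1"
    and nz': "of_int c' * z + of_int d' \<noteq> 0" and y: "y = (of_int a' * z + of_int b') / (of_int c' * z + of_int d')"
    using assms(2) unfolding modular_equiv_def by blast
  define w where "w = of_int c' * z + of_int d'"
  have yw: "y * w = of_int a' * z + of_int b'" using y nz' by (simp add: w_def)
  have num: "(of_int a * y + of_int b) * w = of_int (a * a' + b * c') * z + of_int (a * b' + b * d')"
    by (simp add: distrib_right mult.assoc yw) (simp add: w_def algebra_simps)
  have den: "(of_int c * y + of_int d) * w = of_int (c * a' + d * c') * z + of_int (c * b' + d * d')"
    by (simp add: distrib_right mult.assoc yw) (simp add: w_def algebra_simps)
  have "w \<noteq> 0" using nz' by (simp add: w_def)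
  then have "x = ((of_int a * y + of_int b) * w) / ((of_int c * y + of_int d) * w)" using x by simp
  then have x': "x = (of_int (a * a' + b * c') * z + of_int (a * b' + b * d')) / (of_int (c * a' + d * c') * z + of_int (c * b' + d * d'))"
    unfolding num den .
  have nz'': "of_int (c * a' + d * c') * z + of_int (c * b' + d * d') \<noteq> 0"
    using den nz \<open>w \<noteq> 0\<close> by (metis mult_eq_0_iff)
  have "(a * a' + b * c') * (c * b' + d * d') - (a * b' + b * d') * (c * a' + d * c') = (a * d - b * c) * (a' * d' - b' * c')"
    by (simp add: algebra_simps)
  then have "(a * a' + b * c') * (c * b' + d * d') - (a * b' + b * d') * (c * a' + d * c') = 1 \<or>
     (a * a' + b * c') * (c * b' + d * d') - (a * b' + b * d') * (c * a' + d * c') = -1"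
    using det det' by auto
  then show ?thesis unfolding modular_equiv_def using nz'' x' by blast
qed

lemma modular_equiv_gauss_map: "x \<in> Omega \<Longrightarrow> x \<sim>\<^sub>m gauss_map x"
proof -
  assume x: "x \<in> Omega"
  have "x = (of_int 0 * gauss_map x + of_int 1) / (of_int 1 * gauss_map x + of_int (int (cf_digit x)))"
    using gauss_map_inverse[OF x] by simp
  moreover have "of_int 1 * gauss_map x + of_int (int (cf_digit x)) \<noteq> 0"
    using gauss_map_in_Omega[OF x] by (simp add: Omega_iff add_pos_nonneg less_imp_neq[symmetric])
  ultimately show ?thesis unfolding modular_equiv_def
    by (intro exI[of _ 0] exI[of _ 1] exI[of _ "int (cf_digit x)"]) auto
qed

lemma modular_equiv_funpow: "x \<in> Omega \<Longrightarrow> x \<sim>\<^sub>m (gauss_map ^^ n) x"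
  by (induction n)
    (auto intro: modular_equiv_refl modular_equiv_trans modular_equiv_gauss_map gauss_map_funpow_in_Omega)

text \<open>Serret's theorem. Conversely to the preceding lemma, one step of the Gauss map is itself a
  transformation of determinant \<open>- 1\<close>, so numbers with a common tail are equivalent.\<close>

theorem modular_equiv_iff_tail:
  assumes "x \<in> Omega" "y \<in> Omega"
  shows "x \<sim>\<^sub>m y \<longleftrightarrow> (\<exists>m n. (gauss_map ^^ m) x = (gauss_map ^^ n) y)"
proof
  assume "x \<sim>\<^sub>m y"
  then have "tail_equiv x y" unfolding modular_equiv_def
    using tail_equiv_mobius assms(2) by (auto simp: Omega_iff)
  moreover have "frac x = x" "frac y = y" using assms by (auto simp: Omega_iff frac_eq)
  ultimately show "\<exists>m n. (gauss_map ^^ m) x = (gauss_map ^^ n) y" by (simp add: tail_equiv_def)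
next
  assume "\<exists>m n. (gauss_map ^^ m) x = (gauss_map ^^ n) y"
  then show "x \<sim>\<^sub>m y" using modular_equiv_funpow assms modular_equiv_sym modular_equiv_trans by metis
qed

section \<open>Periodic continued fractions and quadratic irrationals\<close>

lemma quadratic_form_root:
  fixes x :: real and a b c k :: int
  assumes "x \<noteq> 0" "of_int a * x\<^sup>2 + of_int b * x + of_int c = 0"
  shows "of_int c * (1 / x - of_int k)\<^sup>2 + of_int (b + 2 * k * c) * (1 / x - of_int k)
    + of_int (a + b * k + c * k\<^sup>2) = 0"
proof -
  define u where "u = 1 / x"
  have "of_int a * x\<^sup>2 * u\<^sup>2 + of_int b * x * u\<^sup>2 + of_int c * u\<^sup>2 = 0"
    using assms(2) by (metis distrib_right mult_zero_left)
  moreover have "x * u = 1" using assms by (simp add: u_def)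
  then have "x\<^sup>2 * u\<^sup>2 = 1" "x * u\<^sup>2 = u"
    by (metis power_mult_distrib one_power2, metis power2_eq_square mult.assoc mult_1)
  ultimately have "of_int a + of_int b * u + of_int c * u\<^sup>2 = 0" by (simp add: mult.assoc)
  then show ?thesis by (simp add: u_def[symmetric] power2_eq_square algebra_simps)
qed

lemma quadratic_root_coeff_nonzero:
  fixes x :: real and a b c :: int
  assumes "x \<notin> \<rat>" "of_int a * x\<^sup>2 + of_int b * x + of_int c = 0" "\<not> (a = 0 \<and> b = 0 \<and> c = 0)"
  shows "a \<noteq> 0"
proof
  assume a: "a = 0"
  have "b \<noteq> 0" using assms a by auto
  then have "x = - of_int c / of_int b" using assms a by (simp add: field_simps)
  then show False using assms(1) by (metis Rats_divide Rats_minus_iff Rats_of_int)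
qed

text \<open>Euler: a fixed point of a product of branches satisfies the quadratic equation
  \<open>c y\<^sup>2 + (d - a) y - b = 0\<close>, where \<open>(a, b; c, d)\<close> is the matrix of the product. The bounds on \<open>c\<close> and
  \<open>d\<close> are carried through the induction because the equation must not degenerate.\<close>

lemma fixed_point_quadratic:
  assumes y: "y \<in> Omega" and p: "p > 0" "(gauss_map ^^ p) y = y"
  shows "y \<in> quadratic_irrationals"
proof -
  have "\<exists>a b c d :: int. y * (of_int c * (gauss_map ^^ p) y + of_int d) = of_int a * (gauss_map ^^ p) y + of_int b
     \<and> d \<ge> 1 \<and> c \<ge> 0 \<and> (p > 0 \<longrightarrow> c \<ge> 1)" for p
  proof (induction p)
    case 0
    show ?case by (rule exI[of _ 1], rule exI[of _ 0], rule exI[of _ 0], rule exI[of _ 1]) simp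
  next
    case (Suc p)
    then obtain a b c d :: int where
      e: "y * (of_int c * (gauss_map ^^ p) y + of_int d) = of_int a * (gauss_map ^^ p) y + of_int b"
      and cd: "d \<ge> 1" "c \<ge> 0" by blast
    define t k where "t = (gauss_map ^^ Suc p) y" and "k = cf_digit ((gauss_map ^^ p) y)"
    have "(gauss_map ^^ p) y \<in> Omega" using y by (rule gauss_map_funpow_in_Omega)
    then have t: "(gauss_map ^^ p) y * (t + real k) = 1" "k \<ge> 1"
      using cf_digit_ge_1[of "(gauss_map ^^ p) y"]
      by (auto simp: t_def k_def Omega_iff gauss_map_eq simp del: One_nat_def)
    have "y * (of_int c * ((gauss_map ^^ p) y * (t + real k)) + of_int d * (t + real k)) =
        of_int a * ((gauss_map ^^ p) y * (t + real k)) + of_int b * (t + real k)"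
      using arg_cong[OF e, of "\<lambda>u. u * (t + real k)"] by (simp add: algebra_simps)
    then have "y * (of_int d * t + of_int (c + d * int k)) = of_int b * t + of_int (a + b * int k)"
      unfolding t by (simp add: algebra_simps)
    moreover have "c + d * int k \<ge> 1"
      using cd t(2) mult_mono[of 1 d 1 "int k"] by simp
    ultimately show ?case unfolding t_def[symmetric] using cd by (intro exI conjI) (assumption, auto)
  qed
  from this[of p] obtain a b c d :: int where
    "y * (of_int c * y + of_int d) = of_int a * y + of_int b" "c \<ge> 1"
    using p by auto
  then have "of_int c * y\<^sup>2 + of_int (d - a) * y + of_int (- b) = 0" "c \<noteq> 0"
    by (auto simp: power2_eq_square algebra_simps)
  then show ?thesis using y unfolding quadratic_irrationals_def by blast
qed

text \<open>Quadratic equations are pulled back along the Gauss map, so that it suffices to have one for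
  some tail.\<close>

lemma quadratic_if_gauss_map_quadratic:
  assumes "x \<in> Omega" "gauss_map x \<in> quadratic_irrationals"
  shows "x \<in> quadratic_irrationals"
proof -
  define k where "k = int (cf_digit x)"
  have x: "x \<noteq> 0" "x \<notin> \<rat>" using assms by (auto simp: Omega_iff)
  obtain a b c :: int where a: "a \<noteq> 0"
    and e: "of_int a * (gauss_map x)\<^sup>2 + of_int b * gauss_map x + of_int c = 0"
    using assms unfolding quadratic_irrationals_def by blast
  have g: "gauss_map x = 1 / x - of_int k" using gauss_map_eq[OF assms(1)] by (simp add: k_def)
  then have xg: "x * gauss_map x = 1 - of_int k * x" using x by (simp add: field_simps)
  have "of_int a * (x * gauss_map x)\<^sup>2 + of_int b * (x * gauss_map x) * x + of_int c * x\<^sup>2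
      = x\<^sup>2 * (of_int a * (gauss_map x)\<^sup>2 + of_int b * gauss_map x + of_int c)"
    by (simp add: power2_eq_square algebra_simps)
  then have "of_int (a * k\<^sup>2 - b * k + c) * x\<^sup>2 + of_int (b - 2 * a * k) * x + of_int a = 0"
    unfolding e xg by (simp add: power2_eq_square algebra_simps)
  moreover from this have "a * k\<^sup>2 - b * k + c \<noteq> 0"
    using a by (intro quadratic_root_coeff_nonzero[OF x(2), of _ "b - 2 * a * k" a]) auto
  ultimately show ?thesis using assms(1) unfolding quadratic_irrationals_def by blast
qed

theorem eventually_periodic_imp_quadratic:
  assumes x: "x \<in> Omega" and eq: "(gauss_map ^^ m) x = (gauss_map ^^ n) x" "m < n"
  shows "x \<in> quadratic_irrationals"
proof -
  have "(gauss_map ^^ (n - m)) ((gauss_map ^^ m) x) = (gauss_map ^^ m) x"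
    using eq by (metis comp_apply funpow_add le_add_diff_inverse2 less_imp_le)
  then have "(gauss_map ^^ m) x \<in> quadratic_irrationals"
    using eq x by (intro fixed_point_quadratic) (auto intro: gauss_map_funpow_in_Omega)
  then show ?thesis
  proof (induction m)
    case (Suc m)
    then show ?case using quadratic_if_gauss_map_quadratic[of "(gauss_map ^^ m) x"] gauss_map_funpow_in_Omega[OF x]
      by auto
  qed simp
qed

text \<open>Lagrange: apply the digits of \<open>x\<close> to the conjugate \<open>z\<close> of \<open>x\<close>. If all the resulting numbers
  were positive, \<open>z\<close> would have the same continued fraction as \<open>x\<close>. Once one of them is negative,
  so are all later ones, and then the quadratic forms of the tails of \<open>x\<close> have outer coefficients
  of opposite signs; with the fixed discriminant this leaves finitely many forms.\<close>

primrec conj_orbit :: "real \<Rightarrow> real \<Rightarrow> nat \<Rightarrow> real" where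
  "conj_orbit x z 0 = z"
| "conj_orbit x z (Suc n) = 1 / conj_orbit x z n - real (cf_digit ((gauss_map ^^ n) x))"

lemma conj_orbit_negative:
  assumes x: "x \<in> Omega" and z: "z \<notin> \<rat>" "z \<noteq> x"
  shows "\<exists>N. \<forall>n\<ge>N. conj_orbit x z n < 0"
proof -
  let ?z = "conj_orbit x z" and ?x = "\<lambda>n. (gauss_map ^^ n) x"
  have O: "?x n \<in> Omega" for n using gauss_map_funpow_in_Omega[OF x] .
  have irr: "?z n \<notin> \<rat>" for n
  proof (induction n)
    case (Suc n)
    show ?case
    proof
      assume "?z (Suc n) \<in> \<rat>"
      then have "?z (Suc n) + real (cf_digit (?x n)) \<in> \<rat>" by (intro Rats_add Rats_of_nat)
      then show False using Suc by simp
    qed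
  qed (simp add: z)
  have "\<exists>N. ?z N < 0"
  proof (rule ccontr)
    assume "\<nexists>N. ?z N < 0"
    then have pos: "?z n > 0" for n using irr[of n] by (metis Rats_0 linorder_neqE_linordered_idom)
    have xs: "1 / (real (cf_digit (?x n)) + ?x (Suc n)) = ?x n" for n
      using gauss_map_inverse[OF O[of n]] by (simp add: add.commute)
    have zs: "1 / (real (cf_digit (?x n)) + ?z (Suc n)) = ?z n" for n by simp
    have z1: "?z n \<le> 1" for n
    proof -
      have "real (cf_digit (?x n)) \<ge> 1" using cf_digit_ge_1[OF O[of n]] by simp
      then have "real (cf_digit (?x n)) + ?z (Suc n) \<ge> 1" using pos[of "Suc n"] by linarith
      moreover have "1 / u \<le> 1" if "u \<ge> 1" for u :: real using that by simp
      ultimately have "1 / (real (cf_digit (?x n)) + ?z (Suc n)) \<le> 1" by blast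
      then show ?thesis unfolding zs .
    qed
    have "\<bar>?z n - ?x n\<bar> \<le> 1 / (real k + 1)" for n k
    proof (induction k arbitrary: n)
      case 0
      then show ?case using z1[of n] pos[of n] O[of n] by (auto simp: Omega_iff abs_if)
    next
      case (Suc k)
      have "\<bar>1 / (real (cf_digit (?x n)) + ?z (Suc n)) - 1 / (real (cf_digit (?x n)) + ?x (Suc n))\<bar> \<le> 1 / (real (Suc k) + 1)"
        using pos[of "Suc n"] O[of "Suc n"] cf_digit_ge_1[OF O[of n]] Suc.IH[of "Suc n"]
        by (intro branch_contraction) (auto simp: Omega_iff simp del: funpow.simps)
      then show ?case unfolding xs zs .
    qed
    from this[of 0] have small: "\<bar>z - x\<bar> \<le> 1 / (real k + 1)" for k by simp
    obtain k where "1 / (real k + 1) < \<bar>z - x\<bar>" using nat_approx_posE[of "\<bar>z - x\<bar>"] z by (auto simp: add.commute)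
    then show False using small[of k] by simp
  qed
  then obtain N where N: "?z N < 0" by blast
  have "?z (N + k) < 0" for k
  proof (induction k)
    case (Suc k)
    then have "1 / ?z (N + k) < 0" by simp
    then have "1 / ?z (N + k) < real (cf_digit (?x (N + k)))" by (rule less_le_trans) simp
    then show ?case by simp
  qed (simp add: N)
  then show ?thesis by (metis le_add_diff_inverse)
qed

lemma finite_quadratic_roots:
  fixes a b c :: real
  assumes "a \<noteq> 0"
  shows "finite {x. a * x\<^sup>2 + b * x + c = 0}"
proof -
  have "{x. a * x\<^sup>2 + b * x + c = 0} = {x. poly [:c, b, a:] x = 0}"
    by (auto simp: power2_eq_square algebra_simps)
  then show ?thesis using poly_roots_finite[of "[:c, b, a:]"] assms by simp
qed

theorem quadratic_imp_eventually_periodic: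
  assumes "x \<in> quadratic_irrationals"
  shows "\<exists>m n. m < n \<and> (gauss_map ^^ m) x = (gauss_map ^^ n) x"
proof -
  let ?x = "\<lambda>n. (gauss_map ^^ n) x"
  obtain a b c :: int where x: "x \<in> Omega" and a: "a \<noteq> 0"
    and e: "of_int a * x\<^sup>2 + of_int b * x + of_int c = 0"
    using assms unfolding quadratic_irrationals_def by blast
  have O: "?x n \<in> Omega" for n using gauss_map_funpow_in_Omega[OF x] .
  have xirr: "x \<notin> \<rat>" using x by (simp add: Omega_iff)
  define z where "z = - of_int b / of_int a - x"
  have z: "z \<notin> \<rat>"
  proof
    assume "z \<in> \<rat>"
    then have "- of_int b / of_int a - z \<in> \<rat>" by (intro Rats_diff Rats_divide Rats_minus_iff[THEN iffD2] Rats_of_int)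
    then show False using xirr by (simp add: z_def)
  qed
  have "z \<noteq> x"
  proof
    assume "z = x"
    then have "x = - of_int b / of_int (2 * a)" using a by (simp add: z_def field_simps)
    then show False using xirr by (metis Rats_divide Rats_minus_iff Rats_of_int)
  qed
  have az: "of_int a * z = - of_int b - of_int a * x" using a by (simp add: z_def field_simps)
  have "of_int a * z\<^sup>2 + of_int b * z + of_int c - (of_int a * x\<^sup>2 + of_int b * x + of_int c)
      = (z - x) * (of_int a * z + of_int b + of_int a * x)"
    by (simp add: power2_eq_square algebra_simps)
  then have ez: "of_int a * z\<^sup>2 + of_int b * z + of_int c = 0" unfolding az using e by simp
  let ?z = "conj_orbit x z"
  define D where "D = b\<^sup>2 - 4 * a * c"
  have forms: "\<exists>A B C :: int. A \<noteq> 0 \<and> B\<^sup>2 - 4 * A * C = D \<and> ?x n \<noteq> ?z n \<and> ?z n \<notin> \<rat> \<and>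
      of_int A * (?x n)\<^sup>2 + of_int B * ?x n + of_int C = 0 \<and>
      of_int A * (?z n)\<^sup>2 + of_int B * ?z n + of_int C = 0" for n
  proof (induction n)
    case 0
    show ?case using a e ez z \<open>z \<noteq> x\<close> by (auto simp: D_def)
  next
    case (Suc n)
    then obtain A B C :: int where A: "A \<noteq> 0" "B\<^sup>2 - 4 * A * C = D" "?x n \<noteq> ?z n" "?z n \<notin> \<rat>"
      "of_int A * (?x n)\<^sup>2 + of_int B * ?x n + of_int C = 0"
      "of_int A * (?z n)\<^sup>2 + of_int B * ?z n + of_int C = 0" by blast
    define k where "k = int (cf_digit (?x n))"
    have xn: "?x (Suc n) = 1 / ?x n - of_int k" using gauss_map_eq[OF O[of n]] by (simp add: k_def)
    have zn: "?z (Suc n) = 1 / ?z n - of_int k" by (simp add: k_def)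
    have nz: "?x n \<noteq> 0" "?z n \<noteq> 0" using O[of n] A(4) by (auto simp: Omega_iff)
    have "C \<noteq> 0"
    proof
      assume "C = 0"
      then have "(of_int A * ?x n + of_int B) * ?x n = 0" using A(5) by (simp add: power2_eq_square algebra_simps)
      then have "of_int A * ?x n = - of_int B" using nz by (simp add: eq_neg_iff_add_eq_0)
      then have "?x n = - of_int B / of_int A" using A(1) by (simp add: field_simps)
      moreover have "?x n \<notin> \<rat>" using O[of n] by (simp add: Omega_iff)
      ultimately show False by (metis Rats_divide Rats_minus_iff Rats_of_int)
    qed
    moreover have "(B + 2 * k * C)\<^sup>2 - 4 * C * (A + B * k + C * k\<^sup>2) = D"
      unfolding A(2)[symmetric] by (simp add: power2_eq_square algebra_simps)
    moreover have "?x (Suc n) \<noteq> ?z (Suc n)" unfolding xn zn using A(3) nz by (simp add: field_simps)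
    moreover have "?z (Suc n) \<notin> \<rat>" unfolding zn
      by (metis A(4) Rats_add Rats_inverse_iff Rats_of_int diff_add_cancel)
    moreover note quadratic_form_root[OF nz(1) A(5), of k, folded xn] quadratic_form_root[OF nz(2) A(6), of k, folded zn]
    ultimately show ?case by blast
  qed
  obtain N where N: "\<And>n. n \<ge> N \<Longrightarrow> ?z n < 0" using conj_orbit_negative[OF x z \<open>z \<noteq> x\<close>] by blast
  \<comment> \<open>Opposite signs of \<open>A\<close> and \<open>C\<close> turn \<open>B\<^sup>2 - 4 A C = D\<close> into bounds for all three coefficients.\<close>
  define F where "F = (\<Union>A\<in>{-D..D} - {0}. \<Union>B\<in>{-D..D}. \<Union>C\<in>{-D..D}.
      {w :: real. of_int A * w\<^sup>2 + of_int B * w + of_int C = 0})"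
  have "finite F" unfolding F_def by (auto intro!: finite_quadratic_roots)
  moreover have "?x n \<in> F" if "n \<ge> N" for n
  proof -
    obtain A B C :: int where A: "A \<noteq> 0" "B\<^sup>2 - 4 * A * C = D" "?x n \<noteq> ?z n"
      "of_int A * (?x n)\<^sup>2 + of_int B * ?x n + of_int C = 0"
      "of_int A * (?z n)\<^sup>2 + of_int B * ?z n + of_int C = 0" using forms[of n] by blast
    have "(?x n - ?z n) * (of_int A * (?x n + ?z n) + of_int B) = 0"
      using A(4,5) by (simp add: power2_eq_square algebra_simps)
    then have B: "of_int B = - of_int A * (?x n + ?z n)" using A(3) by (simp add: eq_neg_iff_add_eq_0 add.commute)
    have C: "of_int C = of_int A * (?x n * ?z n)" using A(4) unfolding B
      by (simp add: power2_eq_square algebra_simps)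
    have "?x n * ?z n < 0" using N[OF that] O[of n] by (simp add: Omega_iff mult_pos_neg)
    have "of_int A * of_int C = (of_int A)\<^sup>2 * (?x n * ?z n)" unfolding C by (simp add: power2_eq_square)
    also have "\<dots> < 0" using \<open>?x n * ?z n < 0\<close> A(1)
      by (intro mult_pos_neg[OF _ \<open>?x n * ?z n < 0\<close>]) simp
    finally have AC: "A * C < 0" by (metis of_int_less_0_iff of_int_mult)
    have "\<bar>A\<bar> * \<bar>C\<bar> = - (A * C)" using AC by (simp add: abs_mult[symmetric])
    moreover have "0 \<le> B\<^sup>2" by simp
    ultimately have le: "\<bar>A\<bar> * \<bar>C\<bar> \<le> D" using A(2) AC by linarith
    have abs: "\<bar>u\<bar> \<le> \<bar>u\<bar> * \<bar>v\<bar>" if "v \<noteq> 0" for u v :: int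
      using that mult_left_mono[of 1 "\<bar>v\<bar>" "\<bar>u\<bar>"] by simp
    have "\<bar>A\<bar> \<le> \<bar>A\<bar> * \<bar>C\<bar>" "\<bar>C\<bar> \<le> \<bar>C\<bar> * \<bar>A\<bar>" using AC by (auto intro!: abs)
    then have "\<bar>A\<bar> \<le> D" "\<bar>C\<bar> \<le> D" using le mult.commute[of "\<bar>A\<bar>" "\<bar>C\<bar>"] by linarith+
    moreover have "\<bar>B\<bar> \<le> B\<^sup>2"
      using abs[of B B] by (cases "B = 0") (auto simp: power2_eq_square)
    moreover have "B\<^sup>2 \<le> D" using A(2) AC by linarith
    ultimately have "A \<in> {-D..D} - {0}" "B \<in> {-D..D}" "C \<in> {-D..D}"
      using A(1) by auto
    then show ?thesis unfolding F_def using A(4) by blast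
  qed
  ultimately have "finite (?x ` {N..})" by (metis (no_types, lifting) finite_subset image_subsetI atLeast_iff)
  then have "\<not> inj_on ?x {N..}" using finite_imageD infinite_Ici by blast
  then show ?thesis unfolding inj_on_def by (metis linorder_neqE_nat)
qed

section \<open>Periods and repeating blocks\<close>

text \<open>The value \<open>p = 0\<close>, for which equality modulo \<open>p\<close> is equality, stands for an injective orbit. In
  this way periodic and injective orbits can be treated together.\<close>

lemma exists_periodic_point:
  fixes f :: "'a \<Rightarrow> 'a"
  obtains k p where "(f ^^ p) ((f ^^ k) x) = (f ^^ k) x"
    "\<And>m n. (f ^^ m) ((f ^^ k) x) = (f ^^ n) ((f ^^ k) x) \<Longrightarrow> m mod p = n mod p"
proof (cases "inj (\<lambda>n. (f ^^ n) x)")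
  case True
  then show ?thesis using that[of 0 0] by (auto simp: inj_def)
next
  case False
  then obtain k l where kl: "k < l" "(f ^^ k) x = (f ^^ l) x" unfolding inj_def by (metis linorder_neqE_nat)
  define y where "y = (f ^^ k) x"
  define p where "p = (LEAST q. q > 0 \<and> (f ^^ q) y = y)"
  have "l - k > 0 \<and> (f ^^ (l - k)) y = y"
    using kl unfolding y_def by (metis comp_apply funpow_add le_add_diff_inverse2 less_imp_le zero_less_diff)
  then have p: "p > 0" "(f ^^ p) y = y" unfolding p_def by (metis (mono_tags, lifting) LeastI)+
  have least: "q = 0" if "(f ^^ q) y = y" "q < p" for q
    using that not_less_Least[of q "\<lambda>q. q > 0 \<and> (f ^^ q) y = y"] unfolding p_def by auto
  have aux: "r = s" if "(f ^^ r) y = (f ^^ s) y" "r \<le> s" "s < p" for r s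
  proof -
    have "(f ^^ (p - s + r)) y = (f ^^ (p - s)) ((f ^^ r) y)" by (simp add: funpow_add)
    also have "\<dots> = (f ^^ (p - s + s)) y" unfolding that(1) by (simp only: funpow_add comp_apply)
    also have "\<dots> = y" using that p by simp
    finally show ?thesis using least[of "p - s + r"] that by fastforce
  qed
  have mod_eq: "m mod p = n mod p" if "(f ^^ m) y = (f ^^ n) y" for m n
  proof -
    have e: "(f ^^ (m mod p)) y = (f ^^ (n mod p)) y" using that funpow_mod_eq[OF p(2)] by metis
    have "m mod p < p" "n mod p < p" using p(1) by simp_all
    then show ?thesis using aux[OF e] aux[OF e[symmetric]] by (metis nat_le_linear)
  qed
  show ?thesis by (rule that[of p k, OF p(2)[unfolded y_def] mod_eq[unfolded y_def]])
qed

lemma eventually_repeats_CFE: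
  assumes "x \<in> quadratic_irrationals"
  shows "\<exists>m n. eventually_repeats (CFE x) m n"
proof -
  have x: "x \<in> Omega" using assms by (simp add: quadratic_irrationals_def)
  obtain k p where kp: "(gauss_map ^^ p) ((gauss_map ^^ k) x) = (gauss_map ^^ k) x"
    and mod: "\<And>m n. (gauss_map ^^ m) ((gauss_map ^^ k) x) = (gauss_map ^^ n) ((gauss_map ^^ k) x) \<Longrightarrow> m mod p = n mod p"
    using exists_periodic_point[of gauss_map x] by metis
  define y where "y = (gauss_map ^^ k) x"
  have y: "y \<in> Omega" unfolding y_def by (rule gauss_map_funpow_in_Omega[OF x])
  have p: "p > 0"
  proof (rule ccontr)
    assume "\<not> p > 0"
    obtain m n where mn: "m < n" "(gauss_map ^^ m) x = (gauss_map ^^ n) x"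
      using quadratic_imp_eventually_periodic[OF assms] by blast
    then have "(gauss_map ^^ m) ((gauss_map ^^ k) x) = (gauss_map ^^ n) ((gauss_map ^^ k) x)"
      by (metis add.commute comp_apply funpow_add)
    from mod[OF this] show False using mn(1) \<open>\<not> p > 0\<close> by simp
  qed
  define n where "n = map (CFE y) [0..<p]"
  have n_len: "length n = p" by (simp add: n_def)
  have per: "CFE y i = n ! (i mod p)" for i
  proof -
    have "CFE y i = CFE ((gauss_map ^^ (i mod p)) y) 0"
      using funpow_mod_eq[of p gauss_map y i] kp y unfolding y_def[symmetric]
      by (simp add: CFE_eq gauss_map_funpow_in_Omega)
    then show ?thesis using p y by (simp add: n_def CFE_funpow)
  qed
  have "nonperiodic n" unfolding nonperiodic_def
  proof (intro allI impI notI)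
    fix q assume q: "0 < q \<and> q < length n" "rotate q n = n"
    have "CFE ((gauss_map ^^ q) y) i = CFE y i" for i
    proof -
      have "CFE ((gauss_map ^^ q) y) i = n ! ((q + i) mod p)" using y by (simp add: CFE_funpow per)
      also have "\<dots> = rotate q n ! (i mod p)" using p by (simp add: nth_rotate n_def mod_add_right_eq)
      finally show ?thesis by (simp add: per q(2))
    qed
    then have "(gauss_map ^^ q) y = (gauss_map ^^ 0) y" using y
      by (intro CFE_inject) (auto intro: gauss_map_funpow_in_Omega)
    then have "q mod p = 0" using mod[of q 0] unfolding y_def[symmetric] by simp
    then show False using q(1) by (simp add: n_def)
  qed
  moreover have "CFE x i = (if i < k then map (CFE x) [0..<k] ! i else n ! ((i - k) mod p))" for i
  proof (cases "i < k")
    case False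
    have "CFE x (k + (i - k)) = CFE y (i - k)" unfolding y_def by (rule CFE_funpow[OF x, symmetric])
    then show ?thesis unfolding per using False by simp
  qed simp
  moreover have "n \<noteq> []" using p n_len by auto
  ultimately have "eventually_repeats (CFE x) (map (CFE x) [0..<k]) n"
    unfolding eventually_repeats_def length_map length_upt diff_zero n_len by blast
  then show ?thesis by blast
qed

text \<open>Minimize first the length of the block and then that of the initial part: an initial part that
  ends with the block could be shortened by absorbing this copy into the periodic part.\<close>

lemma exists_repeating_block:
  assumes "x \<in> quadratic_irrationals"
  shows "\<exists>n. repeating_block (CFE x) n"
proof -
  let ?R = "eventually_repeats (CFE x)"
  define k where "k = (LEAST k. \<exists>m n. ?R m n \<and> length n = k)"
  have "\<exists>k m n. ?R m n \<and> length n = k" using eventually_repeats_CFE[OF assms] by blast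
  from LeastI_ex[OF this] obtain m n where "?R m n" and k: "length n = k" unfolding k_def by blast
  have min: "k \<le> length n'" if "?R m' n'" for m' n'
    unfolding k_def using that by (intro Least_le) blast
  define l where "l = (LEAST l. \<exists>m. ?R m n \<and> length m = l)"
  have "\<exists>l m. ?R m n \<and> length m = l" using \<open>?R m n\<close> by blast
  from LeastI_ex[OF this] obtain m where m: "?R m n" "length m = l" unfolding l_def by blast
  have "m \<noteq> m\<^sub>0 @ n" for m\<^sub>0
  proof
    assume m0: "m = m\<^sub>0 @ n"
    have "?R m\<^sub>0 n" unfolding eventually_repeats_def
    proof (intro conjI allI)
      fix i
      have R: "CFE x i = (if i < length m then m ! i else n ! ((i - length m) mod length n))"
        using m(1) unfolding eventually_repeats_def by blast
      consider "i < length m\<^sub>0" | "length m\<^sub>0 \<le> i" "i < length m" | "length m \<le> i" by linarith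
      then show "CFE x i = (if i < length m\<^sub>0 then m\<^sub>0 ! i else n ! ((i - length m\<^sub>0) mod length n))"
      proof cases
        case 3
        then have "i - length m\<^sub>0 = (i - length m) + length n" by (simp add: m0)
        then have "(i - length m\<^sub>0) mod length n = (i - length m) mod length n" by (simp only: mod_add_self2)
        then show ?thesis using R 3 by (simp add: m0)
      qed (use R in \<open>auto simp: m0 nth_append\<close>)
    qed (use m(1) in \<open>auto simp: eventually_repeats_def\<close>)
    then have "l \<le> length m\<^sub>0" unfolding l_def by (intro Least_le) blast
    then show False using m m0 by (auto simp: eventually_repeats_def)
  qed
  then show ?thesis using m min k unfolding repeating_block_def by blast
qed

lemma foldr_branch_in_Omega:
  "\<forall>i\<in>set w. i \<ge> 1 \<Longrightarrow> y \<in> Omega \<Longrightarrow> foldr (\<lambda>i x. 1 / (x + real i)) w y \<in> Omega"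
  by (induction w) (auto intro: branch_in_Omega)

lemma CFE_foldr_branch:
  assumes "\<forall>i\<in>set w. i \<ge> 1" "y \<in> Omega"
  shows "CFE (foldr (\<lambda>i x. 1 / (x + real i)) w y) j = (if j < length w then w ! j else CFE y (j - length w))"
  using assms(1)
proof (induction w arbitrary: j)
  case (Cons i w)
  have "foldr (\<lambda>i x. 1 / (x + real i)) w y \<in> Omega" using Cons.prems assms(2) by (intro foldr_branch_in_Omega) auto
  then have "CFE (foldr (\<lambda>i x. 1 / (x + real i)) (i # w) y) j = case_nat i (CFE (foldr (\<lambda>i x. 1 / (x + real i)) w y)) j"
    using Cons.prems by (simp add: CFE_branch)
  then show ?case using Cons by (cases j) auto
qed simp

text \<open>The tail of \<open>x\<close> that starts with the block is fixed by the word of the block, and nonperiodicity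
  of the block makes its first images under the Gauss map distinct.\<close>

lemma repeating_block_point:
  assumes x: "x \<in> Omega" and R: "eventually_repeats (CFE x) m n"
  obtains k y where "y = (gauss_map ^^ k) x" "y \<in> Omega" "\<forall>i\<in>set n. i \<ge> 1"
    "foldr (\<lambda>i x. 1 / (x + real i)) n y = y"
    "\<And>l. l \<le> length n \<Longrightarrow> foldr (\<lambda>i x. 1 / (x + real i)) (drop l n) y = (gauss_map ^^ l) y"
    "inj_on (\<lambda>l. (gauss_map ^^ l) y) {..<length n}"
proof -
  define y where "y = (gauss_map ^^ length m) x"
  have y: "y \<in> Omega" unfolding y_def by (rule gauss_map_funpow_in_Omega[OF x])
  have n: "n \<noteq> []" "nonperiodic n" using R by (auto simp: eventually_repeats_def)
  have per: "CFE y i = n ! (i mod length n)" for i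
    using R unfolding eventually_repeats_def y_def by (simp add: CFE_funpow[OF x])
  have ge: "\<forall>i\<in>set n. i \<ge> 1"
    using per CFE_ge_1[OF y] by (metis in_set_conv_nth mod_less)
  have dr: "foldr (\<lambda>i x. 1 / (x + real i)) (drop l n) y = (gauss_map ^^ l) y" if l: "l \<le> length n" for l
  proof (rule CFE_inject)
    have ge': "\<forall>i\<in>set (drop l n). i \<ge> 1" using ge by (meson in_set_dropD)
    show "foldr (\<lambda>i x. 1 / (x + real i)) (drop l n) y \<in> Omega" by (rule foldr_branch_in_Omega[OF ge' y])
    show "(gauss_map ^^ l) y \<in> Omega" by (rule gauss_map_funpow_in_Omega[OF y])
    fix i
    have "(if i < length n - l then n ! (l + i) else n ! ((i - (length n - l)) mod length n)) = n ! ((l + i) mod length n)"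
    proof (cases "i < length n - l")
      case False
      then have "l + i = (i - (length n - l)) + length n" using l by simp
      then show ?thesis using False by (metis mod_add_self2)
    qed (simp add: add.commute)
    then show "CFE (foldr (\<lambda>i x. 1 / (x + real i)) (drop l n) y) i = CFE ((gauss_map ^^ l) y) i"
      unfolding CFE_foldr_branch[OF ge' y] CFE_funpow[OF y] per length_drop nth_drop[OF l] .
  qed
  have "l = l'" if "(gauss_map ^^ l) y = (gauss_map ^^ l') y" "l \<le> l'" "l' < length n" for l l'
  proof (rule ccontr)
    assume "l \<noteq> l'"
    have e: "n ! ((l + i) mod length n) = n ! ((l' + i) mod length n)" for i
      using CFE_funpow[OF y, of l i] CFE_funpow[OF y, of l' i] that(1) by (simp add: per)
    have "rotate (l' - l) n = n"
    proof (rule nth_equalityI)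
      fix j assume "j < length (rotate (l' - l) n)"
      then have j: "j < length n" by simp
      have "n ! j = n ! ((l + (length n - l + j)) mod length n)" using that j by simp
      also have "\<dots> = n ! ((l' + (length n - l + j)) mod length n)" by (rule e)
      also have "l' + (length n - l + j) = (l' - l + j) + length n" using that by simp
      also have "n ! (((l' - l + j) + length n) mod length n) = rotate (l' - l) n ! j"
        using j by (simp add: nth_rotate)
      finally show "rotate (l' - l) n ! j = n ! j" by simp
    qed simp
    then show False using n(2) \<open>l \<noteq> l'\<close> that unfolding nonperiodic_def
      by (auto dest!: spec[of _ "l' - l"])
  qed
  then have "inj_on (\<lambda>l. (gauss_map ^^ l) y) {..<length n}"
    by (intro inj_onI) (metis lessThan_iff linorder_linear)
  moreover have "foldr (\<lambda>i x. 1 / (x + real i)) n y = y" using dr[of 0] by simp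
  ultimately show ?thesis by (intro that[OF y_def y ge _ dr])
qed

section \<open>Coordinates with respect to an orthonormal basis\<close>

lemma ell2_eqI: "(\<And>a. ell2_coeff f a = ell2_coeff g a) \<Longrightarrow> f = g"
  by (metis ell2_coeff_inject ext)

lemma cinner_ket_right [simp]: "cinner f (ket a) = ell2_coeff f a"
proof -
  have "cinner f (ket a) = (\<Sum>\<^sub>\<infinity>b\<in>{a}. ell2_coeff f b * cnj (ell2_coeff (ket a) b))"
    unfolding cinner_ell2_def by (rule infsum_cong_neutral) (auto simp: ket.rep_eq)
  then show ?thesis by (simp add: ket.rep_eq)
qed

lemma cinner_ket_ket: "cinner (ket a) (ket b) = (if a = b then 1 else 0)"
  by (simp add: ket.rep_eq)

lemma ket_inject [simp]: "ket a = ket b \<longleftrightarrow> a = b"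
  by (metis cinner_ket_ket zero_neq_one)

lemma norm_ket [simp]: "norm (ket a) = 1"
proof -
  have "complex_of_real ((norm (ket a))\<^sup>2) = 1" unfolding cinner_self[symmetric] by (simp add: cinner_ket_ket del: cinner_ket_right)
  then have "(norm (ket a))\<^sup>2 = 1" by (metis of_real_1 of_real_eq_iff)
  then show ?thesis by (metis norm_ge_zero power2_eq_1_iff not_one_le_zero neg_0_le_iff_le)
qed

lemma l2_eq_annihilator: "l2 A = {f. \<forall>w\<in>ket ` (- A). cinner f w = 0}"
  by (auto simp: l2_def)

lemma closed_csubspace_l2: "closed_csubspace (l2 A)"
  unfolding l2_eq_annihilator by (rule closed_csubspace_annihilator)

definition ell2_restrict :: "'a set \<Rightarrow> 'a ell2 \<Rightarrow> 'a ell2" where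
  "ell2_restrict S f = Abs_ell2 (\<lambda>a. if a \<in> S then ell2_coeff f a else 0)"

lemma coeff_ell2_restrict [simp]: "ell2_coeff (ell2_restrict S f) a = (if a \<in> S then ell2_coeff f a else 0)"
proof -
  have "(\<lambda>a. (cmod (if a \<in> S then ell2_coeff f a else 0))\<^sup>2) summable_on UNIV"
    by (rule summable_on_comparison_test[OF ell2_coeff_summable[of f]]) auto
  then show ?thesis unfolding ell2_restrict_def by (simp add: ell2_coeff_Abs)
qed

text \<open>The restrictions of a square summable sequence tend to \<open>0\<close> as the support avoids larger and
  larger finite sets.\<close>

lemma ell2_restrict_small:
  assumes "\<epsilon> > 0"
  obtains F where "finite F" "\<And>S. S \<inter> F = {} \<Longrightarrow> norm (ell2_restrict S f) < \<epsilon>"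
proof -
  let ?g = "\<lambda>a. (cmod (ell2_coeff f a))\<^sup>2"
  have "(?g has_sum (norm f)\<^sup>2) UNIV"
    unfolding norm_ell2_sq by (rule has_sum_infsum[OF ell2_coeff_summable])
  then obtain F where F: "finite F" "dist (sum ?g F) ((norm f)\<^sup>2) \<le> (\<epsilon> / 2)\<^sup>2"
    using has_sum_finite_approximation[of ?g UNIV "(norm f)\<^sup>2" "(\<epsilon> / 2)\<^sup>2"] assms by auto
  have "norm (ell2_restrict S f) < \<epsilon>" if S: "S \<inter> F = {}" for S
  proof -
    have "(norm (ell2_restrict S f))\<^sup>2 \<le> (\<epsilon> / 2)\<^sup>2"
      unfolding norm_ell2_sq
    proof (rule infsum_le_finite_sums[OF ell2_coeff_summable])
      fix G :: "'a set" assume "finite G"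
      have "(\<Sum>a\<in>G. (cmod (ell2_coeff (ell2_restrict S f) a))\<^sup>2) = sum ?g (G \<inter> S)"
        using \<open>finite G\<close> by (intro sum.mono_neutral_cong_right) auto
      moreover have "sum ?g (G \<inter> S) + sum ?g F = sum ?g (G \<inter> S \<union> F)"
        using \<open>finite G\<close> F(1) S by (intro sum.union_disjoint[symmetric]) auto
      moreover have "\<dots> \<le> (norm f)\<^sup>2" using \<open>finite G\<close> F(1) by (intro finite_sum_le_norm) auto
      ultimately show "(\<Sum>a\<in>G. (cmod (ell2_coeff (ell2_restrict S f) a))\<^sup>2) \<le> (\<epsilon> / 2)\<^sup>2"
        using F(2) unfolding dist_real_def by linarith
    qed
    then have "norm (ell2_restrict S f) \<le> \<epsilon> / 2" using assms by (auto intro: power2_le_imp_le[OF _ less_imp_le])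
    then show ?thesis using assms by simp
  qed
  then show ?thesis using that F(1) by blast
qed

lemma l2_eq_closure: "l2 A = closure (cspan (ket ` A))"
proof
  show "closure (cspan (ket ` A)) \<subseteq> l2 A"
    by (intro closure_cspan_minimal closed_csubspace_l2) (auto simp: l2_def ket.rep_eq)
  show "l2 A \<subseteq> closure (cspan (ket ` A))"
  proof
    fix f :: "'a ell2" assume f: "f \<in> l2 A"
    show "f \<in> closure (cspan (ket ` A))"
      unfolding closure_approachable
    proof (intro allI impI)
      fix \<epsilon> :: real assume "\<epsilon> > 0"
      then obtain F where F: "finite F" "\<And>S. S \<inter> F = {} \<Longrightarrow> norm (ell2_restrict S f) < \<epsilon>"
        using ell2_restrict_small by blast
      define g where "g = (\<Sum>a\<in>F \<inter> A. ell2_coeff f a *\<^sub>C ket a)"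
      have "g \<in> cspan (ket ` A)" unfolding g_def
        by (intro complex_vector.span_sum complex_vector.span_scale complex_vector.span_base) auto
      moreover have "g - f = - ell2_restrict (- F) f"
      proof (rule ell2_eqI)
        fix b
        have "ell2_coeff g b = (\<Sum>a\<in>F \<inter> A. ell2_coeff f a * (if a = b then 1 else 0))"
          unfolding cinner_ket_right[symmetric] g_def cinner_sum_left cinner_scaleC_left cinner_ket_ket ..
        also have "\<dots> = (if b \<in> F then ell2_coeff f b else 0)"
          using F(1) f by (auto simp: l2_def if_distrib cong: if_cong)
        finally show "ell2_coeff (g - f) b = ell2_coeff (- ell2_restrict (- F) f) b"
          by (simp add: ell2_coeff_diff uminus_ell2.rep_eq)
      qed
      then have "dist g f < \<epsilon>" using F(2)[of "- F"] by (simp add: dist_norm)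
      ultimately show "\<exists>y\<in>cspan (ket ` A). dist y f < \<epsilon>" by blast
    qed
  qed
qed

text \<open>The coordinate map identifies a closed subspace with orthonormal basis \<open>e\<close> with \<open>l2 A\<close>. It serves
  both to construct vectors with prescribed coordinates and to construct unitaries.\<close>

definition coords :: "'i set \<Rightarrow> ('i \<Rightarrow> 'h::chilbert_space) \<Rightarrow> 'h \<Rightarrow> 'i ell2" where
  "coords A e v = Abs_ell2 (\<lambda>i. if i \<in> A then cinner v (e i) else 0)"

text \<open>Bessel's inequality makes the coordinate map a contraction of the whole space.\<close>

lemma bessel:
  assumes on: "orthonormal_family A e" and F: "finite F" "F \<subseteq> A"
  shows "(\<Sum>i\<in>F. (cmod (cinner v (e i)))\<^sup>2) \<le> (norm v)\<^sup>2"
proof -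
  define p where "p = (\<Sum>i\<in>F. cinner v (e i) *\<^sub>C e i)"
  have pe: "cinner p (e j) = cinner v (e j)" if "j \<in> F" for j
  proof -
    have "cinner p (e j) = (\<Sum>i\<in>F. cinner v (e i) * (if i = j then 1 else 0))"
      unfolding p_def cinner_sum_left cinner_scaleC_left
      using on F that by (intro sum.cong) (auto simp: orthonormal_family_def subset_iff)
    then show ?thesis using that F(1) by (simp add: if_distrib cong: if_cong)
  qed
  have pr: "cinner p x = (\<Sum>i\<in>F. cinner v (e i) * cinner (e i) x)" for x
    by (simp add: p_def cinner_sum_left cinner_scaleC_left)
  have pp: "cinner p p = complex_of_real (\<Sum>i\<in>F. (cmod (cinner v (e i)))\<^sup>2)"
    unfolding pr[of p] of_real_sum complex_norm_square
    by (intro sum.cong refl) (metis pe cinner_commute)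
  have "cinner p (v - p) = 0"
    unfolding pr[of "v - p"]
  proof (intro sum.neutral ballI)
    fix i assume "i \<in> F"
    then have "cinner (v - p) (e i) = 0" by (simp add: cinner_diff_left pe)
    then show "cinner v (e i) * cinner (e i) (v - p) = 0" by (metis cinner_commute complex_cnj_zero mult_zero_right)
  qed
  then have vp: "cinner v p = cinner p p"
    by (metis cinner_commute cinner_diff_right eq_iff_diff_eq_0)
  have "0 \<le> Re (cinner (v - p) (v - p))" by (simp add: cinner_self)
  also have "cinner (v - p) (v - p) = cinner v v - cinner p p"
    using vp \<open>cinner p (v - p) = 0\<close> by (simp add: cinner_diff_left cinner_diff_right)
  finally show ?thesis unfolding pp cinner_self[of v] minus_complex.sel Re_complex_of_real by simp
qed

context
  fixes A :: "'i set" and e :: "'i \<Rightarrow> 'h::chilbert_space" and K :: "'h set"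
  assumes on: "orthonormal_family A e" and K: "closure (cspan (e ` A)) = K"
begin

lemma coeff_coords: "ell2_coeff (coords A e v) i = (if i \<in> A then cinner v (e i) else 0)"
proof -
  have "(\<Sum>i\<in>F. (cmod (if i \<in> A then cinner v (e i) else 0))\<^sup>2) \<le> (norm v)\<^sup>2" if "finite F" for F
  proof -
    have "(\<Sum>i\<in>F. (cmod (if i \<in> A then cinner v (e i) else 0))\<^sup>2) = (\<Sum>i\<in>F \<inter> A. (cmod (cinner v (e i)))\<^sup>2)"
      using that by (intro sum.mono_neutral_cong_right) auto
    then show ?thesis using bessel[OF on, of "F \<inter> A" v] that by simp
  qed
  then have "(\<lambda>i. (cmod (if i \<in> A then cinner v (e i) else 0))\<^sup>2) summable_on UNIV"
    by (intro nonneg_bdd_above_summable_on) (auto simp: bdd_above_def)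
  then show ?thesis unfolding coords_def by (simp add: ell2_coeff_Abs)
qed

lemma norm_coords_le: "norm (coords A e v) \<le> norm v"
proof (rule power2_le_imp_le)
  show "(norm (coords A e v))\<^sup>2 \<le> (norm v)\<^sup>2" unfolding norm_ell2_sq
  proof (rule infsum_le_finite_sums[OF ell2_coeff_summable])
    fix F :: "'i set" assume "finite F"
    have "(\<Sum>i\<in>F. (cmod (ell2_coeff (coords A e v) i))\<^sup>2) = (\<Sum>i\<in>F \<inter> A. (cmod (cinner v (e i)))\<^sup>2)"
      unfolding coeff_coords using \<open>finite F\<close> by (intro sum.mono_neutral_cong_right) auto
    then show "(\<Sum>i\<in>F. (cmod (ell2_coeff (coords A e v) i))\<^sup>2) \<le> (norm v)\<^sup>2"
      using bessel[OF on, of "F \<inter> A" v] \<open>finite F\<close> by simp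
  qed
qed simp

lemma coords_add: "coords A e (v + w) = coords A e v + coords A e w"
  by (rule ell2_eqI) (simp add: coeff_coords plus_ell2.rep_eq cinner_add_left)

lemma coords_scaleC: "coords A e (c *\<^sub>C v) = c *\<^sub>C coords A e v"
  by (rule ell2_eqI) (simp add: coeff_coords scaleC_ell2.rep_eq cinner_scaleC_left)

lemma bounded_linear_coords: "bounded_linear (coords A e)"
  by (rule bounded_linear_intro[of _ 1])
    (auto simp: coords_add coords_scaleC scaleR_scaleC norm_coords_le)

lemma coords_basis: "i \<in> A \<Longrightarrow> coords A e (e i) = ket i"
  by (rule ell2_eqI) (use on in \<open>auto simp: coeff_coords ket.rep_eq orthonormal_family_def\<close>)

text \<open>The vectors \<open>v\<close> for which the identity holds form a closed subspace containing the basis.\<close>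

lemma cinner_coords:
  assumes "v \<in> K"
  shows "cinner (coords A e v) (coords A e w) = cinner v w"
proof -
  let ?M = "{v. cinner (coords A e v) (coords A e w) = cinner v w}"
  have "cinner (coords A e (e i)) (coords A e w) = cinner (e i) w" if "i \<in> A" for i
    using that cinner_commute[of "ket i" "coords A e w"] cinner_commute[of "e i" w]
    by (simp add: coords_basis coeff_coords)
  then have "e ` A \<subseteq> ?M" by blast
  moreover have "csubspace ?M"
    by (rule complex_vector.subspaceI)
      (auto simp: coords_add coords_scaleC cinner_add_left cinner_scaleC_left
        linear_0[OF bounded_linear.linear[OF bounded_linear_coords]])
  moreover have "closed ?M"
    by (intro closed_Collect_eq continuous_on_cinner_left continuous_on_compose2[OF continuous_on_cinner_left
          linear_continuous_on[OF bounded_linear_coords], of _ UNIV]) auto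
  ultimately have "closure (cspan (e ` A)) \<subseteq> ?M"
    by (intro closure_cspan_minimal) (auto simp: closed_csubspace_def)
  then show ?thesis using assms K by auto
qed

lemma norm_coords: "v \<in> K \<Longrightarrow> norm (coords A e v) = norm v"
  using cinner_coords[of v v] unfolding cinner_self of_real_eq_iff by (simp add: power2_eq_iff_nonneg)

lemma basis_closed_csubspace: "closed_csubspace K"
  unfolding K[symmetric] by (rule closed_csubspace_closure_cspan)

lemma basis_in: "i \<in> A \<Longrightarrow> e i \<in> K"
  using subset_closure_cspan[of "e ` A"] K by blast

lemma basis_eqI:
  assumes "v \<in> K" "w \<in> K" "\<And>i. i \<in> A \<Longrightarrow> cinner v (e i) = cinner w (e i)"
  shows "v = w"
proof -
  have "v - w \<in> K" using assms basis_closed_csubspace complex_vector.subspace_diff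
    unfolding closed_csubspace_def by blast
  moreover have "coords A e (v - w) = 0"
    by (rule ell2_eqI) (simp add: coeff_coords cinner_diff_left assms zero_ell2.rep_eq)
  ultimately show ?thesis using norm_coords[of "v - w"] by simp
qed

text \<open>The image is complete, being an isometric image of a complete space, and it contains the
  standard basis of \<open>l2 A\<close>.\<close>

lemma coords_image: "coords A e ` K = l2 A"
proof
  show "coords A e ` K \<subseteq> l2 A" by (auto simp: l2_def coeff_coords)
  have "complete (coords A e ` K)"
  proof (rule complete_isometric_image[OF zero_less_one _ bounded_linear_coords])
    show "subspace K" using basis_closed_csubspace unfolding closed_csubspace_def
      by (auto simp: real_vector.subspace_def scaleR_scaleC
          intro: complex_vector.subspace_0 complex_vector.subspace_add complex_vector.subspace_scale)
    show "complete K" using basis_closed_csubspace by (simp add: closed_csubspace_def complete_eq_closed)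
  qed (simp add: norm_coords)
  then have "closed (coords A e ` K)" by (simp add: complete_eq_closed)
  moreover have sub: "csubspace K" using basis_closed_csubspace by (simp add: closed_csubspace_def)
  have "csubspace (coords A e ` K)"
  proof (rule complex_vector.subspaceI)
    show "0 \<in> coords A e ` K" using linear_0[OF bounded_linear.linear[OF bounded_linear_coords]]
      complex_vector.subspace_0[OF sub] by (metis imageI)
  qed (auto simp: coords_add[symmetric] coords_scaleC[symmetric]
        intro!: imageI complex_vector.subspace_add[OF sub] complex_vector.subspace_scale[OF sub])
  moreover have "ket ` A \<subseteq> coords A e ` K" using coords_basis basis_in by force
  ultimately show "l2 A \<subseteq> coords A e ` K" unfolding l2_eq_closure
    by (intro closure_cspan_minimal) (auto simp: closed_csubspace_def)
qed

end

section \<open>Representations that permute an orthonormal basis\<close>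

text \<open>The common setting of \<open>\<pi>\<^sub>\<alpha>\<close> and of an arbitrary permutative representation: the generators act
  on a basis indexed by \<open>A\<close> through injections \<open>br i\<close> whose images partition \<open>A\<close>. An element \<open>a\<close>
  lies in the image of \<open>br (lab a)\<close> and has the preimage \<open>sh a\<close>, so \<open>sh\<close> plays the role of the Gauss
  map and \<open>lab\<close> that of the first digit.\<close>

locale branching_rep = cuntz_rep s K \<rho>
  for s :: "nat \<Rightarrow> 'o::cstar_algebra_1" and K :: "'h::chilbert_space set" and \<rho> +
  fixes A :: "'i set" and e :: "'i \<Rightarrow> 'h" and br :: "nat \<Rightarrow> 'i \<Rightarrow> 'i" and lab :: "'i \<Rightarrow> nat" and sh :: "'i \<Rightarrow> 'i"
  assumes on: "orthonormal_family A e" and basis: "closure (cspan (e ` A)) = K"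
    and gen_basis: "i \<ge> 1 \<Longrightarrow> a \<in> A \<Longrightarrow> \<rho> (s i) (e a) = e (br i a)"
    and lab_ge_1: "a \<in> A \<Longrightarrow> lab a \<ge> 1" and sh_in: "a \<in> A \<Longrightarrow> sh a \<in> A"
    and br_sh: "a \<in> A \<Longrightarrow> br (lab a) (sh a) = a"
    and br_in: "i \<ge> 1 \<Longrightarrow> a \<in> A \<Longrightarrow> br i a \<in> A"
    and lab_br: "i \<ge> 1 \<Longrightarrow> a \<in> A \<Longrightarrow> lab (br i a) = i"
    and sh_br: "i \<ge> 1 \<Longrightarrow> a \<in> A \<Longrightarrow> sh (br i a) = a"
begin

lemma e_in_K [simp, intro]: "a \<in> A \<Longrightarrow> e a \<in> K"
  using basis_in[OF on basis] .

lemma cinner_e: "a \<in> A \<Longrightarrow> b \<in> A \<Longrightarrow> cinner (e a) (e b) = (if a = b then 1 else 0)"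
  using on by (simp add: orthonormal_family_def)

lemma e_nonzero: "a \<in> A \<Longrightarrow> e a \<noteq> 0"
  using cinner_e[of a a] by auto

text \<open>The unit acts as the identity because every basis vector lies in the range of a generator.\<close>

lemma rep_one_basis: "a \<in> A \<Longrightarrow> \<rho> 1 (e a) = e a"
  using rep_mult[of "e (sh a)" 1 "s (lab a)"] gen_basis[of "lab a" "sh a"] lab_ge_1[of a] sh_in[of a] br_sh[of a] by simp

lemma rep_one: "v \<in> K \<Longrightarrow> \<rho> 1 v = v"
  by (rule basis_eqI[OF on basis]) (simp_all add: adjoint rep_one_basis)

lemma rep_zero: "v \<in> K \<Longrightarrow> \<rho> 0 v = 0"
  using rep_add[of v 0 0] by simp

lemma star_gen_basis:
  assumes "i \<ge> 1" "a \<in> A"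
  shows "\<rho> (star (s i)) (e a) = (if lab a = i then e (sh a) else 0)"
proof -
  have "e a = \<rho> (s (lab a)) (e (sh a))"
    using assms by (simp add: gen_basis lab_ge_1 sh_in br_sh del: One_nat_def)
  then have "\<rho> (star (s i)) (e a) = \<rho> (star (s i) * s (lab a)) (e (sh a))"
    using assms by (simp add: rep_mult sh_in)
  then show ?thesis using assms
    by (simp add: star_gen_mult_gen lab_ge_1 rep_one rep_zero sh_in del: One_nat_def)
qed

lemma coeff_gen:
  assumes "i \<ge> 1" "a \<in> A" "v \<in> K"
  shows "cinner (\<rho> (s i) v) (e a) = (if lab a = i then cinner v (e (sh a)) else 0)"
  using assms by (simp add: adjoint star_gen_basis)

lemma coeff_star_gen:
  assumes "i \<ge> 1" "a \<in> A" "v \<in> K"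
  shows "cinner (\<rho> (star (s i)) v) (e a) = cinner v (e (br i a))"
  using assms by (simp add: adjoint star_star gen_basis)

lemma subspace_if_invariant:
  assumes S: "\<And>a. a \<in> S \<Longrightarrow> sh a \<in> S" "\<And>i a. i \<ge> 1 \<Longrightarrow> a \<in> S \<Longrightarrow> br i a \<in> S"
  shows "subrepresentation K \<rho> {v \<in> K. \<forall>a\<in>A - S. cinner v (e a) = 0}"
proof (rule subrepresentationI)
  have "{v \<in> K. \<forall>a\<in>A - S. cinner v (e a) = 0} = K \<inter> {v. \<forall>w\<in>e ` (A - S). cinner v w = 0}" by auto
  then show "closed_csubspace {v \<in> K. \<forall>a\<in>A - S. cinner v (e a) = 0}"
    by (simp only: closed_csubspace_Int[OF closed_csubspace_K closed_csubspace_annihilator])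
next
  fix i v assume i: "i \<ge> (1::nat)" and v: "v \<in> {v \<in> K. \<forall>a\<in>A - S. cinner v (e a) = 0}"
  have "sh a \<notin> S" if "a \<in> A - S" for a
    using S(2)[of "lab a" "sh a"] that lab_ge_1[of a] br_sh[of a] by auto
  then show "\<rho> (s i) v \<in> {v \<in> K. \<forall>a\<in>A - S. cinner v (e a) = 0}"
    using i v by (auto simp: coeff_gen sh_in)
  have "br i a \<notin> S" if "a \<in> A - S" for a
    using S(1)[of "br i a"] that i sh_br[of i a] by auto
  then show "\<rho> (star (s i)) v \<in> {v \<in> K. \<forall>a\<in>A - S. cinner v (e a) = 0}"
    using i v by (auto simp: coeff_star_gen br_in)
qed (auto simp: rep_one)

subsection \<open>Words and itineraries\<close>

definition itin :: "nat \<Rightarrow> 'i \<Rightarrow> nat list" where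
  "itin n a = map (\<lambda>l. lab ((sh ^^ l) a)) [0..<n]"

lemma length_itin [simp]: "length (itin n a) = n"
  by (simp add: itin_def)

lemma nth_itin: "l < n \<Longrightarrow> itin n a ! l = lab ((sh ^^ l) a)"
  by (simp add: itin_def)

lemma itin_0 [simp]: "itin 0 a = []"
  by (simp add: itin_def)

lemma itin_Suc: "itin (Suc n) a = lab a # itin n (sh a)"
  by (rule nth_equalityI) (auto simp: nth_itin nth_Cons funpow_swap1 split: nat.split)

lemma sh_funpow_in: "a \<in> A \<Longrightarrow> (sh ^^ n) a \<in> A"
  by (induction n) (auto simp: sh_in)

lemma itin_ge_1: "a \<in> A \<Longrightarrow> \<forall>i\<in>set (itin n a). i \<ge> 1"
  by (auto simp: itin_def lab_ge_1 sh_funpow_in simp del: One_nat_def)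

lemma foldr_br_in: "\<forall>i\<in>set w. i \<ge> 1 \<Longrightarrow> a \<in> A \<Longrightarrow> foldr br w a \<in> A"
  by (induction w) (auto simp: br_in)

lemma foldr_br_itin: "a \<in> A \<Longrightarrow> foldr br (itin n a) ((sh ^^ n) a) = a"
proof (induction n arbitrary: a)
  case (Suc n)
  have "foldr br (itin n (sh a)) ((sh ^^ n) (sh a)) = sh a" using Suc sh_in by blast
  then show ?case using Suc.prems by (simp add: itin_Suc br_sh funpow_swap1)
qed simp

lemma itin_foldr_br:
  "\<forall>i\<in>set w. i \<ge> 1 \<Longrightarrow> a \<in> A \<Longrightarrow> itin (length w) (foldr br w a) = w"
  by (induction w) (auto simp: itin_Suc lab_br sh_br foldr_br_in)

lemma sh_foldr_br:
  "\<forall>i\<in>set w. i \<ge> 1 \<Longrightarrow> a \<in> A \<Longrightarrow> (sh ^^ length w) (foldr br w a) = a"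
  by (induction w) (auto simp: sh_br foldr_br_in funpow_swap1)

lemma s_word_simps [simp]: "s_word s [] = 1" "s_word s (i # w) = s i * s_word s w"
  by (simp_all add: s_word_def)

lemma s_word_snoc: "s_word s (w @ [i]) = s_word s w * s i"
  by (simp add: s_word_def)

lemma word_basis:
  "\<forall>i\<in>set w. i \<ge> 1 \<Longrightarrow> a \<in> A \<Longrightarrow> \<rho> (s_word s w) (e a) = e (foldr br w a)"
  by (induction w) (auto simp: rep_one rep_mult gen_basis foldr_br_in)

lemma coeff_star_word:
  "\<forall>i\<in>set w. i \<ge> 1 \<Longrightarrow> a \<in> A \<Longrightarrow> v \<in> K \<Longrightarrow>
    cinner (\<rho> (star (s_word s w)) v) (e a) = cinner v (e (foldr br w a))"
  by (simp add: adjoint star_star word_basis)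

lemma star_word_basis:
  assumes w: "\<forall>i\<in>set w. i \<ge> 1" and a: "a \<in> A"
  shows "\<rho> (star (s_word s w)) (e a) = (if itin (length w) a = w then e ((sh ^^ length w) a) else 0)"
proof (rule basis_eqI[OF on basis])
  fix b assume b: "b \<in> A"
  have "cinner (\<rho> (star (s_word s w)) (e a)) (e b) = (if a = foldr br w b then 1 else 0)"
    using assms b by (simp add: coeff_star_word cinner_e foldr_br_in)
  moreover have "a = foldr br w b \<longleftrightarrow> itin (length w) a = w \<and> (sh ^^ length w) a = b"
    using foldr_br_itin[OF a] itin_foldr_br[OF w b] sh_foldr_br[OF w b] by metis
  ultimately show "cinner (\<rho> (star (s_word s w)) (e a)) (e b) =
      cinner (if itin (length w) a = w then e ((sh ^^ length w) a) else 0) (e b)"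
    using b a by (simp add: cinner_e sh_funpow_in)
qed (use a in \<open>auto simp: sh_funpow_in\<close>)

text \<open>For a word \<open>w\<close> the element \<open>s\<^sub>w s\<^sub>w\<^sup>*\<close> acts as the projection onto the span of the basis vectors
  whose itineraries start with \<open>w\<close>.\<close>

lemma coeff_cylinder:
  assumes w: "\<forall>i\<in>set w. i \<ge> 1" and b: "b \<in> A" and v: "v \<in> K"
  shows "cinner (\<rho> (s_word s w * star (s_word s w)) v) (e b) = (if itin (length w) b = w then cinner v (e b) else 0)"
proof -
  have "cinner (\<rho> (s_word s w * star (s_word s w)) v) (e b) = cinner v (\<rho> (s_word s w) (\<rho> (star (s_word s w)) (e b)))"
    using b v by (simp add: rep_mult adjoint star_star)
  moreover have "foldr br w ((sh ^^ length w) b) = b" if "itin (length w) b = w"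
    using foldr_br_itin[OF b, of "length w"] that by simp
  ultimately show ?thesis using w b
    by (simp add: star_word_basis word_basis sh_funpow_in del: One_nat_def)
qed

definition orbit :: "'i \<Rightarrow> 'i set" where
  "orbit a = {b \<in> A. \<exists>m n. (sh ^^ m) a = (sh ^^ n) b}"

lemma orbit_refl: "a \<in> A \<Longrightarrow> a \<in> orbit a"
  by (auto simp: orbit_def)

lemma sh_orbit: "b \<in> orbit a \<Longrightarrow> sh b \<in> orbit a"
proof -
  assume "b \<in> orbit a"
  then obtain m n where b: "b \<in> A" "(sh ^^ m) a = (sh ^^ n) b" by (auto simp: orbit_def)
  then have "(sh ^^ Suc m) a = (sh ^^ n) (sh b)" by (simp add: funpow_swap1)
  then show ?thesis using b sh_in unfolding orbit_def by blast
qed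

lemma br_orbit: "i \<ge> 1 \<Longrightarrow> b \<in> orbit a \<Longrightarrow> br i b \<in> orbit a"
proof -
  assume i: "i \<ge> 1" and "b \<in> orbit a"
  then obtain m n where b: "b \<in> A" "(sh ^^ m) a = (sh ^^ n) b" by (auto simp: orbit_def)
  then have "(sh ^^ m) a = (sh ^^ Suc n) (br i b)" using i by (simp add: funpow_swap1 sh_br)
  then show ?thesis using b br_in i unfolding orbit_def by blast
qed

text \<open>From \<open>a\<close> one reaches any \<open>b\<close> in its orbit by applying \<open>sh\<close> until the itineraries have merged and
  then the branches along the initial part of the itinerary of \<open>b\<close>; both moves are performed by
  elements of the algebra.\<close>

lemma orbit_in_subrepresentation:
  assumes M: "subrepresentation K \<rho> M" and a: "a \<in> A" "e a \<in> M" and b: "b \<in> orbit a"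
  shows "e b \<in> M"
proof -
  obtain m n where b: "b \<in> A" "(sh ^^ m) a = (sh ^^ n) b" using b by (auto simp: orbit_def)
  have inv: "\<rho> x v \<in> M" if "v \<in> M" for x v using M that by (auto simp: subrepresentation_def)
  have "e ((sh ^^ m) a) = \<rho> (star (s_word s (itin m a))) (e a)"
    using a by (simp add: star_word_basis itin_ge_1 del: One_nat_def)
  then have "e ((sh ^^ n) b) \<in> M" unfolding b(2)[symmetric] using inv[OF a(2)] by simp
  moreover have "e b = \<rho> (s_word s (itin n b)) (e ((sh ^^ n) b))"
    using b by (simp add: word_basis itin_ge_1 sh_funpow_in foldr_br_itin del: One_nat_def)
  ultimately show ?thesis using inv by simp
qed

lemma irreducible_imp_orbit:
  assumes "irreducible_rep K \<rho>" "a \<in> A"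
  shows "A = orbit a"
proof -
  let ?M = "{v \<in> K. \<forall>b\<in>A - orbit a. cinner v (e b) = 0}"
  have "subrepresentation K \<rho> ?M" by (rule subspace_if_invariant[OF sh_orbit br_orbit])
  moreover have "e a \<in> ?M" using assms orbit_refl by (auto simp: cinner_e)
  ultimately have "?M = K" using assms e_nonzero unfolding irreducible_rep_def by blast
  then have "b \<in> orbit a" if "b \<in> A" for b
    using that e_in_K[OF that] cinner_e[OF that that] by (metis (mono_tags, lifting) DiffI mem_Collect_eq zero_neq_one)
  then show ?thesis by (auto simp: orbit_def)
qed

end

subsection \<open>Points that are determined by their itineraries\<close>

locale separated_branching_rep = branching_rep +
  assumes separated: "a \<in> A \<Longrightarrow> b \<in> A \<Longrightarrow> (\<And>n. lab ((sh ^^ n) a) = lab ((sh ^^ n) b)) \<Longrightarrow> a = b"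
begin

lemma itin_separates:
  assumes "a \<in> A" "b \<in> A" "a \<noteq> b"
  obtains n where "\<And>m. m \<ge> n \<Longrightarrow> itin m b \<noteq> itin m a"
proof -
  obtain l where l: "lab ((sh ^^ l) a) \<noteq> lab ((sh ^^ l) b)" using separated assms by blast
  have "itin m b \<noteq> itin m a" if "m \<ge> Suc l" for m
    using l nth_itin[of l m a] nth_itin[of l m b] that by auto
  then show ?thesis using that by blast
qed

text \<open>The projections onto the cylinders around \<open>a\<close> converge strongly to the projection onto the
  line spanned by \<open>e a\<close>. Hence an invariant closed subspace contains the components of its elements
  with respect to the basis.\<close>

lemma component_in_subrepresentation:
  assumes M: "subrepresentation K \<rho> M" and v: "v \<in> M" and a: "a \<in> A"
  shows "cinner v (e a) *\<^sub>C e a \<in> M"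
proof -
  have clM: "closed M" and inv: "\<And>x v. v \<in> M \<Longrightarrow> \<rho> x v \<in> M" and vK: "v \<in> K"
    using M v by (auto simp: subrepresentation_def closed_csubspace_def)
  let ?P = "\<lambda>n. \<rho> (s_word s (itin n a) * star (s_word s (itin n a))) v"
  have "cinner v (e a) *\<^sub>C e a \<in> closure M"
    unfolding closure_approachable
  proof (intro allI impI)
    fix \<epsilon> :: real assume "\<epsilon> > 0"
    then obtain F where F: "finite F" "\<And>S. S \<inter> F = {} \<Longrightarrow> norm (ell2_restrict S (coords A e v)) < \<epsilon>"
      using ell2_restrict_small by blast
    have "\<forall>b\<in>F \<inter> A - {a}. \<exists>n. \<forall>m\<ge>n. itin m b \<noteq> itin m a" using itin_separates[OF a] by blast
    then obtain f where f: "\<And>b m. b \<in> F \<inter> A - {a} \<Longrightarrow> m \<ge> f b \<Longrightarrow> itin m b \<noteq> itin m a" by metis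
    define n where "n = Max (insert 0 (f ` (F \<inter> A - {a})))"
    have n: "itin n b \<noteq> itin n a" if "b \<in> F \<inter> A - {a}" for b
      using F(1) that by (intro f[OF that]) (auto simp: n_def intro!: Max_ge)
    \<comment> \<open>By the choice of \<open>n\<close> the cylinder of length \<open>n\<close> around \<open>a\<close> meets \<open>F\<close> at most in \<open>a\<close>.\<close>
    define S where "S = {b \<in> A. itin n b = itin n a \<and> b \<noteq> a}"
    have PK: "?P n - cinner v (e a) *\<^sub>C e a \<in> K" using vK a by (intro diff_in_K scaleC_in_K) auto
    have "coords A e (?P n - cinner v (e a) *\<^sub>C e a) = ell2_restrict S (coords A e v)"
    proof (rule ell2_eqI)
      fix b
      show "ell2_coeff (coords A e (?P n - cinner v (e a) *\<^sub>C e a)) b = ell2_coeff (ell2_restrict S (coords A e v)) b"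
        using a vK itin_ge_1[OF a, of n]
        by (cases "b \<in> A") (auto simp: coeff_coords[OF on basis] S_def cinner_diff_left cinner_scaleC_left
            coeff_cylinder cinner_e simp del: One_nat_def)
    qed
    moreover have "S \<inter> F = {}" using n by (auto simp: S_def)
    ultimately have "norm (?P n - cinner v (e a) *\<^sub>C e a) < \<epsilon>"
      using F(2)[of S] norm_coords[OF on basis PK] by simp
    then show "\<exists>y\<in>M. dist y (cinner v (e a) *\<^sub>C e a) < \<epsilon>" using inv[OF v] by (auto simp: dist_norm)
  qed
  then show ?thesis using clM by simp
qed

lemma basis_in_subrepresentation:
  assumes M: "subrepresentation K \<rho> M" and v: "v \<in> M" and a: "a \<in> A" "cinner v (e a) \<noteq> 0"
  shows "e a \<in> M"
proof -
  have "csubspace M" using M by (simp add: subrepresentation_def closed_csubspace_def)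
  from complex_vector.subspace_scale[OF this component_in_subrepresentation[OF M v a(1)], of "1 / cinner v (e a)"]
  show ?thesis using a(2) by simp
qed

lemma subrepresentation_eq_closure:
  assumes M: "subrepresentation K \<rho> M"
  shows "M = closure (cspan (e ` {a \<in> A. e a \<in> M}))"
proof
  let ?S = "{a \<in> A. e a \<in> M}"
  have MK: "M \<subseteq> K" and cM: "closed_csubspace M" using M by (auto simp: subrepresentation_def)
  show "closure (cspan (e ` ?S)) \<subseteq> M" by (rule closure_cspan_minimal[OF cM]) auto
  have onS: "orthonormal_family ?S e" using on by (auto simp: orthonormal_family_def)
  have SK: "closure (cspan (e ` ?S)) \<subseteq> K" by (rule closure_cspan_minimal[OF closed_csubspace_K]) auto
  show "M \<subseteq> closure (cspan (e ` ?S))"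
  proof
    fix v assume v: "v \<in> M"
    have zero: "cinner v (e a) = 0" if "a \<in> A" "a \<notin> ?S" for a
      using basis_in_subrepresentation[OF M v] that by blast
    have "coords A e v \<in> l2 ?S"
      using zero by (auto simp: l2_def coeff_coords[OF on basis])
    then obtain w where w: "w \<in> closure (cspan (e ` ?S))" "coords ?S e w = coords A e v"
      using coords_image[OF onS refl] by (metis (no_types, lifting) imageE)
    have "w = v"
    proof (rule basis_eqI[OF on basis])
      show "w \<in> K" "v \<in> K" using w SK v MK by auto
      fix a assume a: "a \<in> A"
      show "cinner w (e a) = cinner v (e a)"
      proof (cases "a \<in> ?S")
        case True
        then show ?thesis using arg_cong[OF w(2), of "\<lambda>f. ell2_coeff f a"] a
          by (simp add: coeff_coords[OF on basis] coeff_coords[OF onS refl])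
      next
        case False
        have "closure (cspan (e ` ?S)) \<subseteq> {u. \<forall>x\<in>{e a}. cinner u x = 0}"
          using False a by (intro closure_cspan_minimal closed_csubspace_annihilator) (auto simp: cinner_e)
        then show ?thesis using w(1) zero[OF a False] by auto
      qed
    qed
    then show "v \<in> closure (cspan (e ` ?S))" using w(1) by simp
  qed
qed

text \<open>An intertwiner preserves the property of being fixed by all cylinder projections around \<open>a\<close>.
  By the next lemma a unitary equivalence between subrepresentations can therefore only multiply
  each basis vector by a scalar.\<close>

lemma fixed_by_cylinders:
  assumes v: "v \<in> K" and a: "a \<in> A"
    and fixed: "\<And>n. \<rho> (s_word s (itin n a) * star (s_word s (itin n a))) v = v"
  shows "v = cinner v (e a) *\<^sub>C e a"
proof (rule basis_eqI[OF on basis])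
  fix b assume b: "b \<in> A"
  show "cinner v (e b) = cinner (cinner v (e a) *\<^sub>C e a) (e b)"
  proof (cases "b = a")
    case False
    then obtain n where n: "itin n b \<noteq> itin n a" using itin_separates[OF a b] by (metis order_refl)
    have "cinner v (e b) = cinner (\<rho> (s_word s (itin n a) * star (s_word s (itin n a))) v) (e b)"
      unfolding fixed ..
    also have "\<dots> = 0" using coeff_cylinder[OF itin_ge_1[OF a] b v, of n] n by simp
    finally show ?thesis using False a b by (simp add: cinner_scaleC_left cinner_e)
  qed (use a in \<open>simp add: cinner_scaleC_left cinner_e\<close>)
qed (use v a in auto)

lemma basis_fixed_by_cylinders:
  assumes "a \<in> A"
  shows "\<rho> (s_word s (itin n a) * star (s_word s (itin n a))) (e a) = e a"
  using assms by (simp add: rep_mult star_word_basis word_basis itin_ge_1 sh_funpow_in foldr_br_itin del: One_nat_def)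

theorem unitarily_equivalent_imp_eq:
  assumes M: "subrepresentation K \<rho> M" and N: "subrepresentation K \<rho> N"
    and eq: "unitarily_equivalent M \<rho> N \<rho>"
  shows "M = N"
proof -
  obtain u where img: "u ` M = N"
    and scale: "\<And>c v. v \<in> M \<Longrightarrow> u (c *\<^sub>C v) = c *\<^sub>C u v"
    and add: "\<And>v w. v \<in> M \<Longrightarrow> w \<in> M \<Longrightarrow> u (v + w) = u v + u w"
    and iso: "\<And>v w. v \<in> M \<Longrightarrow> w \<in> M \<Longrightarrow> cinner (u v) (u w) = cinner v w"
    and tw: "\<And>a w. w \<in> N \<Longrightarrow> u (\<rho> a (inv_into M u w)) = \<rho> a w"
    using eq unfolding unitarily_equivalent_def by metis
  have MK: "M \<subseteq> K" "N \<subseteq> K" and subM: "csubspace M" and invM: "\<And>a v. v \<in> M \<Longrightarrow> \<rho> a v \<in> M"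
    and subN: "csubspace N"
    using M N by (auto simp: subrepresentation_def closed_csubspace_def)
  have inj: "inj_on u M"
  proof (rule inj_onI)
    fix v w assume vw: "v \<in> M" "w \<in> M" "u v = u w"
    have d: "v - w \<in> M" using vw complex_vector.subspace_diff[OF subM] by blast
    have "u v = u ((v - w) + w)" by simp
    also have "\<dots> = u (v - w) + u w" using add d vw by blast
    finally have "u (v - w) = 0" using vw by simp
    then have "cinner (v - w) (v - w) = 0" using iso[OF d d] by simp
    then show "v = w" by (simp add: cinner_self)
  qed
  have tw': "u (\<rho> a v) = \<rho> a (u v)" if "v \<in> M" for a v
    using tw[OF img[THEN equalityD1, THEN subsetD, OF imageI[OF that]], of a] that inj by (simp add: inv_into_f_f)
  have nz: "u v \<noteq> 0" if "v \<in> M" "v \<noteq> 0" for v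
    using iso[OF that(1) that(1)] that(2) by (auto simp: cinner_self)
  have MN: "e a \<in> M \<longleftrightarrow> e a \<in> N" if a: "a \<in> A" for a
  proof
    assume eM: "e a \<in> M"
    then have uN: "u (e a) \<in> N" using img by blast
    have "u (e a) = cinner (u (e a)) (e a) *\<^sub>C e a"
    proof (rule fixed_by_cylinders[OF _ a])
      show "u (e a) \<in> K" using uN MK by blast
      show "\<rho> (s_word s (itin n a) * star (s_word s (itin n a))) (u (e a)) = u (e a)" for n
        unfolding tw'[OF eM, symmetric] basis_fixed_by_cylinders[OF a] ..
    qed
    then have "cinner (u (e a)) (e a) \<noteq> 0" using nz[OF eM e_nonzero[OF a]]
      by (metis complex_vector.scale_zero_left)
    then show "e a \<in> N" by (rule basis_in_subrepresentation[OF N uN a])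
  next
    assume eN: "e a \<in> N"
    then have "e a \<in> u ` M" unfolding img .
    then obtain v where v: "v \<in> M" "u v = e a" by (rule imageE) simp
    have "\<rho> (s_word s (itin n a) * star (s_word s (itin n a))) v = v" for n
      by (rule inj_onD[OF inj]) (simp_all add: tw'[OF v(1)] v basis_fixed_by_cylinders[OF a] invM)
    then have "v = cinner v (e a) *\<^sub>C e a" using v MK by (intro fixed_by_cylinders[OF _ a]) auto
    moreover have "v \<noteq> 0"
    proof
      assume "v = 0"
      then have "cinner (e a) (e a) = 0" using iso[OF v(1) v(1)] v(2) by simp
      then show False using cinner_e[OF a a] by simp
    qed
    ultimately have "cinner v (e a) \<noteq> 0" by (metis complex_vector.scale_zero_left)
    then show "e a \<in> M" by (rule basis_in_subrepresentation[OF M v(1) a])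
  qed
  then have "{a \<in> A. e a \<in> M} = {a \<in> A. e a \<in> N}" by blast
  then show ?thesis using subrepresentation_eq_closure[OF M] subrepresentation_eq_closure[OF N] by metis
qed

text \<open>An invariant closed subspace is spanned by the basis vectors in it, and with one of these it
  contains the whole orbit.\<close>

theorem orbit_subspace_irreducible:
  assumes a: "a \<in> A"
  shows "subrepresentation K \<rho> (closure (cspan (e ` orbit a)))"
    and "irreducible_rep (closure (cspan (e ` orbit a))) \<rho>"
proof -
  let ?M = "{v \<in> K. \<forall>b\<in>A - orbit a. cinner v (e b) = 0}"
  have M: "subrepresentation K \<rho> ?M" by (rule subspace_if_invariant[OF sh_orbit br_orbit])
  have "{b \<in> A. e b \<in> ?M} = orbit a"
  proof (intro subset_antisym subsetI)
    fix b assume "b \<in> {b \<in> A. e b \<in> ?M}"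
    then show "b \<in> orbit a" using cinner_e[of b b] by force
  next
    fix b assume "b \<in> orbit a"
    then show "b \<in> {b \<in> A. e b \<in> ?M}" by (auto simp: cinner_e orbit_def)
  qed
  then have M_eq: "?M = closure (cspan (e ` orbit a))" using subrepresentation_eq_closure[OF M] by simp
  then show sub: "subrepresentation K \<rho> (closure (cspan (e ` orbit a)))" using M by simp
  show "irreducible_rep (closure (cspan (e ` orbit a))) \<rho>"
    unfolding irreducible_rep_def
  proof (intro conjI allI impI)
    have ea: "e a \<in> closure (cspan (e ` orbit a))"
      using subset_closure_cspan[of "e ` orbit a"] orbit_refl[OF a] by blast
    then show "closure (cspan (e ` orbit a)) \<noteq> {0}" using e_nonzero[OF a] by auto
    fix N assume N: "subrepresentation (closure (cspan (e ` orbit a))) \<rho> N"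
    have N': "subrepresentation K \<rho> N" using N sub by (auto simp: subrepresentation_def)
    show "N = {0} \<or> N = closure (cspan (e ` orbit a))"
    proof (cases "\<exists>b\<in>A. e b \<in> N")
      case True
      then obtain b where b: "b \<in> A" "e b \<in> N" by blast
      then have "e b \<in> ?M" using N M_eq by (auto simp: subrepresentation_def)
      then have "b \<in> orbit a" using cinner_e[OF b(1) b(1)] b(1) by force
      then obtain m n where mn: "(sh ^^ m) a = (sh ^^ n) b" by (auto simp: orbit_def)
      have "e c \<in> N" if c: "c \<in> orbit a" for c
      proof -
        obtain k l where kl: "(sh ^^ k) a = (sh ^^ l) c" "c \<in> A" using c by (auto simp: orbit_def)
        have "(sh ^^ (k + n)) b = (sh ^^ (k + m)) a" by (simp add: funpow_add mn)
        also have "\<dots> = (sh ^^ (m + l)) c" by (simp add: add.commute[of k] funpow_add kl(1))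
        finally have "(sh ^^ (k + n)) b = (sh ^^ (m + l)) c" .
        then have "c \<in> orbit b" using kl(2) unfolding orbit_def by blast
        then show ?thesis by (rule orbit_in_subrepresentation[OF N' b])
      qed
      then have "closure (cspan (e ` orbit a)) \<subseteq> N"
        using N' by (intro closure_cspan_minimal) (auto simp: subrepresentation_def)
      then show ?thesis using N by (auto simp: subrepresentation_def)
    next
      case False
      then have "{b \<in> A. e b \<in> N} = {}" by blast
      then have "N = closure (cspan {})"
        using subrepresentation_eq_closure[OF N'] by (simp only: image_empty)
      then show ?thesis by (simp add: complex_vector.span_empty)
    qed
  qed
qed

end

section \<open>Sequences with vanishing correlations\<close>

text \<open>The bilateral shift has no eigenvectors, but it has proper reducing subspaces. They are exhibited
  by two sequences whose Fourier series have disjoint supports, namely the upper and the lower half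
  of the unit circle. Up to a factor these are \<open>\<delta>\<^sub>0 + H\<close> and \<open>\<delta>\<^sub>0 - H\<close>, where \<open>H\<close> is the sequence of
  Fourier coefficients of the square wave, a constant multiple of \<open>\<i> / k\<close> for odd \<open>k\<close> and \<open>0\<close> for
  even \<open>k\<close>. The relation \<open>H * H = \<delta>\<^sub>0\<close> for the convolution is proved by telescoping away from \<open>0\<close>, and at
  \<open>0\<close> it is the normalization that fixes the constant.\<close>

definition odd_recip :: "int \<Rightarrow> real" where
  "odd_recip j = 1 / (2 * real_of_int j + 1)"

lemma odd_recip_nonzero: "2 * real_of_int j + 1 \<noteq> 0"
proof
  assume "2 * real_of_int j + 1 = 0"
  then have "of_int (2 * j + 1) = (0 :: real)" by simp
  then have "2 * j + 1 = 0" unfolding of_int_eq_0_iff .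
  then show False by presburger
qed

lemma odd_recip_sq_summable: "(\<lambda>j. (odd_recip j)\<^sup>2) summable_on UNIV"
proof -
  have s: "summable (\<lambda>n. (odd_recip (int n))\<^sup>2)"
  proof (rule summable_comparison_test')
    show "summable (\<lambda>n. inverse (real (Suc n) ^ 2))"
      using inverse_power_summable[of 2, where 'a = real]
      by (subst summable_Suc_iff) simp
    fix n :: nat
    show "norm ((odd_recip (int n))\<^sup>2) \<le> inverse (real (Suc n) ^ 2)"
      by (simp add: odd_recip_def inverse_eq_divide power_divide divide_left_mono power_mono)
  qed
  have n: "(\<lambda>n. (odd_recip (int n))\<^sup>2) summable_on UNIV"
    using s by (intro norm_summable_imp_summable_on) simp
  have "(\<lambda>j. (odd_recip j)\<^sup>2) summable_on range int"
    using n by (subst summable_on_reindex) (auto simp: o_def)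
  moreover have "odd_recip (- int n - 1) = - odd_recip (int n)" for n
    by (simp add: odd_recip_def minus_divide_right)
  then have "(\<lambda>j. (odd_recip j)\<^sup>2) summable_on range (\<lambda>n. - int n - 1)"
    using n by (subst summable_on_reindex) (auto simp: o_def inj_on_def)
  ultimately have "(\<lambda>j. (odd_recip j)\<^sup>2) summable_on (range int \<union> range (\<lambda>n. - int n - 1))"
    by (rule summable_on_union)
  moreover have "j \<in> range int \<union> range (\<lambda>n. - int n - 1)" for j
  proof (cases "j \<ge> 0")
    case True
    then have "j = int (nat j)" by simp
    then show ?thesis by blast
  next
    case False
    then have "j = - int (nat (- j - 1)) - 1" by simp
    then show ?thesis by blast
  qed
  then have "range int \<union> range (\<lambda>n. - int n - 1) = UNIV" by blast
  ultimately show ?thesis by simp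
qed

lemma bij_int_add: "bij (\<lambda>j. j + r)" for r :: int
  by (rule bij_betw_byWitness[of _ "\<lambda>j. j - r"]) auto

lemma odd_recip_sq_shift_summable: "(\<lambda>j. (odd_recip (j + r))\<^sup>2) summable_on UNIV"
  using odd_recip_sq_summable summable_on_reindex_bij_betw[of "\<lambda>j. j + r" UNIV UNIV "\<lambda>j. (odd_recip j)\<^sup>2"]
    bij_int_add[of r] by simp

lemma odd_recip_prod_summable: "(\<lambda>j. odd_recip j * odd_recip (j + r)) summable_on UNIV"
proof (rule abs_summable_summable, rule Infinite_Sum.abs_summable_on_comparison_test')
  show "(\<lambda>j. (odd_recip j)\<^sup>2 + (odd_recip (j + r))\<^sup>2) summable_on UNIV"
    by (intro summable_on_add odd_recip_sq_summable odd_recip_sq_shift_summable)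
  fix j
  have "2 * (\<bar>odd_recip j\<bar> * \<bar>odd_recip (j + r)\<bar>) \<le> (odd_recip j)\<^sup>2 + (odd_recip (j + r))\<^sup>2"
    using sum_squares_bound[of "\<bar>odd_recip j\<bar>" "\<bar>odd_recip (j + r)\<bar>"] by simp
  moreover have "0 \<le> \<bar>odd_recip j\<bar> * \<bar>odd_recip (j + r)\<bar>" by simp
  ultimately have "\<bar>odd_recip j\<bar> * \<bar>odd_recip (j + r)\<bar> \<le> (odd_recip j)\<^sup>2 + (odd_recip (j + r))\<^sup>2"
    by linarith
  then show "norm (odd_recip j * odd_recip (j + r)) \<le> (odd_recip j)\<^sup>2 + (odd_recip (j + r))\<^sup>2"
    by (simp add: abs_mult)
qed

lemma odd_recip_diff: "odd_recip j - odd_recip (j + r) = 2 * of_int r * (odd_recip j * odd_recip (j + r))"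
  using odd_recip_nonzero[of j] odd_recip_nonzero[of "j + r"]
  by (simp add: odd_recip_def diff_frac_eq)

lemma odd_recip_telescope_1: "((\<lambda>j. odd_recip j - odd_recip (j + 1)) has_sum 0) UNIV"
proof -
  let ?f = "\<lambda>j. odd_recip j - odd_recip (j + 1)"
  have "?f summable_on UNIV"
    unfolding odd_recip_diff by (intro summable_on_cmult_right odd_recip_prod_summable)
  then obtain S where S: "(?f has_sum S) UNIV" by (auto simp: summable_on_def)
  have "filterlim (\<lambda>N. {- int N..<int N}) (finite_subsets_at_top (UNIV :: int set)) sequentially"
    unfolding filterlim_iff eventually_finite_subsets_at_top
  proof (intro allI impI)
    fix P :: "int set \<Rightarrow> bool" assume "\<exists>X. finite X \<and> X \<subseteq> UNIV \<and> (\<forall>Y. finite Y \<and> X \<subseteq> Y \<and> Y \<subseteq> UNIV \<longrightarrow> P Y)"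
    then obtain X :: "int set" where X: "finite X" "\<And>Y. finite Y \<Longrightarrow> X \<subseteq> Y \<Longrightarrow> P Y" by auto
    define M where "M = Max (insert 0 (abs ` X))"
    have M: "\<bar>x\<bar> \<le> M" if "x \<in> X" for x unfolding M_def using X(1) that by (intro Max_ge) auto
    show "eventually (\<lambda>N. P {- int N..<int N}) sequentially"
    proof (rule eventually_mono[OF eventually_ge_at_top[of "nat (M + 1)"]])
      fix N assume "N \<ge> nat (M + 1)"
      then have "X \<subseteq> {- int N..<int N}" using M by force
      then show "P {- int N..<int N}" by (intro X(2)) auto
    qed
  qed
  then have lim: "(\<lambda>N. sum ?f {- int N..<int N}) \<longlonglongrightarrow> S"
    using S unfolding has_sum_def by (rule filterlim_compose[rotated])
  have sum: "sum ?f {- int N..<int N} = odd_recip (- int N) - odd_recip (int N)" for N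
  proof (induction N)
    case (Suc N)
    have "{- int (Suc N)..<int (Suc N)} = insert (- int (Suc N)) (insert (int N) {- int N..<int N})" by auto
    then show ?case using Suc by (simp add: algebra_simps)
  qed simp
  have "(\<lambda>N. odd_recip (- int N) - odd_recip (int N)) \<longlonglongrightarrow> 0"
  proof (rule Lim_null_comparison)
    show "(\<lambda>N. 2 * inverse (real N)) \<longlonglongrightarrow> 0"
      using tendsto_mult[OF tendsto_const lim_inverse_n, of 2] by simp
    show "eventually (\<lambda>N. norm (odd_recip (- int N) - odd_recip (int N)) \<le> 2 * inverse (real N)) sequentially"
    proof (rule eventually_mono[OF eventually_ge_at_top[of 1]])
      fix N :: nat assume "N \<ge> 1"
      then have N: "real N \<ge> 1" by simp
      have "\<bar>odd_recip (int N)\<bar> \<le> inverse (real N)" "\<bar>odd_recip (- int N)\<bar> \<le> inverse (real N)"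
        using N by (auto simp: odd_recip_def inverse_eq_divide abs_divide intro!: divide_left_mono)
      then show "norm (odd_recip (- int N) - odd_recip (int N)) \<le> 2 * inverse (real N)"
        unfolding real_norm_def by linarith
    qed
  qed
  then have "S = 0" using lim LIMSEQ_unique unfolding sum by blast
  then show ?thesis using S by simp
qed

lemma odd_recip_telescope: "((\<lambda>j. odd_recip j - odd_recip (j + int n)) has_sum 0) UNIV"
proof (induction n)
  case (Suc n)
  have "((\<lambda>j. odd_recip (j + int n) - odd_recip (j + int n + 1)) has_sum 0) UNIV"
    using odd_recip_telescope_1 bij_int_add[of "int n"]
      has_sum_reindex_bij_betw[of "\<lambda>j. j + int n" UNIV UNIV "\<lambda>j. odd_recip j - odd_recip (j + 1)" 0]
    by simp
  from has_sum_add[OF Suc this] show ?case by (simp add: add.assoc add.commute[of 1])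
qed simp

lemma odd_recip_correlation:
  assumes "r \<noteq> 0"
  shows "((\<lambda>j. odd_recip j * odd_recip (j + r)) has_sum 0) UNIV"
proof -
  have pos: "((\<lambda>j. odd_recip j * odd_recip (j + r)) has_sum 0) UNIV" if "r > 0" for r
  proof -
    have "((\<lambda>j. (1 / (2 * of_int r)) * (odd_recip j - odd_recip (j + int (nat r)))) has_sum (1 / (2 * of_int r)) * 0) UNIV"
      by (intro has_sum_cmult_right odd_recip_telescope)
    then show ?thesis using that by (simp add: odd_recip_diff)
  qed
  show ?thesis
  proof (cases "r > 0")
    case False
    then have "((\<lambda>j. odd_recip j * odd_recip (j - r)) has_sum 0) UNIV" using assms pos[of "- r"] by simp
    then have "((\<lambda>j. odd_recip (j + r) * odd_recip (j + r - r)) has_sum 0) UNIV"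
      using bij_int_add[of r] has_sum_reindex_bij_betw[of "\<lambda>j. j + r" UNIV UNIV "\<lambda>j. odd_recip j * odd_recip (j - r)" 0]
      by simp
    then show ?thesis by (simp add: mult.commute)
  qed (rule pos)
qed

lemma has_sum_delta: "((\<lambda>k. if k = a then c else 0) has_sum c) UNIV"
  for c :: "'b::{comm_monoid_add,topological_space}"
proof -
  have "((\<lambda>k. if k = a then c else 0) has_sum (\<Sum>k\<in>{a}. if k = a then c else 0)) {a}"
    by (rule has_sum_finite) simp
  then show ?thesis by (subst has_sum_cong_neutral[where T = "{a}"]) auto
qed

lemma square_wave:
  obtains h :: "int \<Rightarrow> real" where "\<And>k. h (- k) = - h k"
    "\<And>q. ((\<lambda>k. h k * h (k + q)) has_sum (if q = 0 then 1 else 0)) UNIV"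
proof -
  define c where "c = (\<Sum>\<^sub>\<infinity>j. (odd_recip j)\<^sup>2)"
  have hc: "((\<lambda>j. (odd_recip j)\<^sup>2) has_sum c) UNIV"
    unfolding c_def by (rule has_sum_infsum[OF odd_recip_sq_summable])
  have "1 = sum (\<lambda>j. (odd_recip j)\<^sup>2) {0}" by (simp add: odd_recip_def)
  also have "\<dots> \<le> c" unfolding c_def by (rule finite_sum_le_infsum[OF odd_recip_sq_summable]) auto
  finally have c: "c > 0" by simp
  define h where "h k = (if odd k then 1 / (sqrt c * of_int k) else 0)" for k :: int
  have h_odd: "h (2 * j + 1) = odd_recip j / sqrt c" for j
    by (simp add: h_def odd_recip_def)
  have "((\<lambda>k. h k * h (k + q)) has_sum (if q = 0 then 1 else 0)) UNIV" for q
  proof (cases "even q")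
    case True
    then obtain r where r: "q = 2 * r" by blast
    have "((\<lambda>j. odd_recip j * odd_recip (j + r)) has_sum (if r = 0 then c else 0)) UNIV"
      using hc odd_recip_correlation[of r] by (auto simp: power2_eq_square)
    then have "((\<lambda>j. 1 / c * (odd_recip j * odd_recip (j + r))) has_sum (1 / c * (if r = 0 then c else 0))) UNIV"
      by (rule has_sum_cmult_right)
    moreover have "h (2 * j + 1) * h (2 * j + 1 + q) = 1 / c * (odd_recip j * odd_recip (j + r))" for j
    proof -
      have "2 * j + 1 + q = 2 * (j + r) + 1" by (simp add: r)
      then have "h (2 * j + 1) * h (2 * j + 1 + q) = odd_recip j * odd_recip (j + r) / (sqrt c * sqrt c)"
        by (simp only: h_odd times_divide_times_eq)
      then show ?thesis using c by simp
    qed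
    ultimately have "((\<lambda>j. h (2 * j + 1) * h (2 * j + 1 + q)) has_sum (if q = 0 then 1 else 0)) UNIV"
      using c r by (cases "r = 0") simp_all
    then have "((\<lambda>k. h k * h (k + q)) has_sum (if q = 0 then 1 else 0)) (range (\<lambda>j. 2 * j + 1))"
      by (subst has_sum_reindex) (auto simp: inj_on_def o_def)
    moreover have "h k * h (k + q) = 0" if "k \<notin> range (\<lambda>j. 2 * j + 1)" for k
    proof -
      have "even k" using that by (metis oddE rangeI)
      then show ?thesis by (simp add: h_def)
    qed
    ultimately show ?thesis
      by (subst has_sum_cong_neutral[where T = "range (\<lambda>j. 2 * j + 1)" and g = "\<lambda>k. h k * h (k + q)"]) auto
  next
    case False
    then have "h k * h (k + q) = 0" for k by (auto simp: h_def)
    then show ?thesis using False by (auto simp: has_sum_0)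
  qed
  moreover have "h (- k) = - h k" for k by (simp add: h_def)
  ultimately show ?thesis using that by blast
qed

lemma uncorrelated_int_sequences:
  obtains V W :: "int \<Rightarrow> complex" where "(\<lambda>k. (cmod (V k))\<^sup>2) summable_on UNIV" "(\<lambda>k. (cmod (W k))\<^sup>2) summable_on UNIV"
    "V 0 \<noteq> 0" "W 0 \<noteq> 0" "\<And>q. ((\<lambda>k. V k * cnj (W (k + q))) has_sum 0) UNIV"
proof -
  obtain h :: "int \<Rightarrow> real" where odd: "\<And>k. h (- k) = - h k"
    and corr: "\<And>q. ((\<lambda>k. h k * h (k + q)) has_sum (if q = 0 then 1 else 0)) UNIV"
    using square_wave by blast
  have h0: "h 0 = 0" using odd[of 0] by simp
  define V where "V k = (if k = 0 then 1 else \<i> * complex_of_real (h k))" for k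
  define W where "W k = (if k = 0 then 1 else - \<i> * complex_of_real (h k))" for k
  have "((\<lambda>k. (if k = 0 then 1 else 0) + h k * h k) has_sum 1 + 1) UNIV"
    using corr[of 0] by (intro has_sum_add has_sum_delta) simp
  then have "(\<lambda>k. (if k = 0 then 1 else 0) + h k * h k) summable_on UNIV" by (auto simp: summable_on_def)
  moreover have "(cmod (V k))\<^sup>2 = (if k = 0 then 1 else 0) + h k * h k"
    "(cmod (W k))\<^sup>2 = (if k = 0 then 1 else 0) + h k * h k" for k
    by (auto simp: V_def W_def h0 norm_mult power2_eq_square)
  ultimately have "(\<lambda>k. (cmod (V k))\<^sup>2) summable_on UNIV" "(\<lambda>k. (cmod (W k))\<^sup>2) summable_on UNIV" by simp_all
  moreover have "((\<lambda>k. V k * cnj (W (k + q))) has_sum 0) UNIV" for q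
  proof -
    have "((\<lambda>k. complex_of_real (h k * h (k + q))) has_sum complex_of_real (if q = 0 then 1 else 0)) UNIV"
      by (rule has_sum_of_real[OF corr])
    then have "((\<lambda>k. - complex_of_real (h k * h (k + q))) has_sum - complex_of_real (if q = 0 then 1 else 0)) UNIV"
      by (rule has_sum_uminusI)
    then have "((\<lambda>k. (if k = 0 then (if q = 0 then 1 else 0) + \<i> * complex_of_real (h q) else 0)
        + (if k = - q then \<i> * complex_of_real (h (- q)) else 0) + - complex_of_real (h k * h (k + q)))
      has_sum ((if q = 0 then 1 else 0) + \<i> * complex_of_real (h q)) + \<i> * complex_of_real (h (- q))
        + - complex_of_real (if q = 0 then 1 else 0)) UNIV"
      by (intro has_sum_add has_sum_delta)
    moreover have "V k * cnj (W (k + q)) = (if k = 0 then (if q = 0 then 1 else 0) + \<i> * complex_of_real (h q) else 0)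
        + (if k = - q then \<i> * complex_of_real (h (- q)) else 0) + - complex_of_real (h k * h (k + q))" for k
    proof -
      have "k + q = 0 \<longleftrightarrow> k = - q" by linarith
      moreover have "\<i> * x * (\<i> * y) = - (x * y)" for x y :: complex
      proof -
        have "\<i> * x * (\<i> * y) = (\<i> * \<i>) * (x * y)" by (simp only: ac_simps)
        then show ?thesis by simp
      qed
      ultimately show ?thesis by (auto simp: V_def W_def h0)
    qed
    moreover have "((if q = 0 then 1 else 0) + \<i> * complex_of_real (h q)) + \<i> * complex_of_real (h (- q))
        + - complex_of_real (if q = 0 then 1 else 0) = 0" by (simp add: odd)
    \<comment> \<open>The cross terms cancel because \<open>h\<close> is odd, and the product of the point masses cancels the correlation of \<open>h\<close>.\<close>
    ultimately show ?thesis by (simp only:)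
  qed
  ultimately show ?thesis using that[of V W] by (simp add: V_def W_def)
qed


text \<open>Orthogonality of \<open>v\<close> to all iterated translates of \<open>w\<close>, forwards and backwards. Two conditions
  over natural exponents replace one over integers, which would need the inverse of \<open>\<tau>\<close>.\<close>

definition uncorrelated :: "('i \<Rightarrow> 'i) \<Rightarrow> 'i set \<Rightarrow> ('i \<Rightarrow> complex) \<Rightarrow> ('i \<Rightarrow> complex) \<Rightarrow> bool" where
  "uncorrelated \<tau> Z v w \<longleftrightarrow> (\<forall>z. z \<notin> Z \<longrightarrow> v z = 0 \<and> w z = 0) \<and>
     (\<lambda>z. (cmod (v z))\<^sup>2) summable_on UNIV \<and> (\<lambda>z. (cmod (w z))\<^sup>2) summable_on UNIV \<and>
     (\<exists>z. v z \<noteq> 0) \<and> (\<exists>z. w z \<noteq> 0) \<and>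
     (\<forall>q. (\<Sum>\<^sub>\<infinity>z\<in>Z. v z * cnj (w ((\<tau> ^^ q) z))) = 0) \<and>
     (\<forall>q. (\<Sum>\<^sub>\<infinity>z\<in>Z. v ((\<tau> ^^ q) z) * cnj (w z)) = 0)"

lemma funpow_bij_betw:
  "bij_betw \<tau> Z Z \<Longrightarrow> bij_betw (\<tau> ^^ n) Z Z"
  by (induction n) (auto intro: bij_betw_trans bij_betw_id)

lemma summable_on_finite_support:
  fixes f :: "'i \<Rightarrow> complex"
  assumes "finite F" "\<And>z. z \<notin> F \<Longrightarrow> f z = 0"
  shows "(\<lambda>z. (cmod (f z))\<^sup>2) summable_on UNIV"
  by (rule finite_nonzero_values_imp_summable_on, rule finite_subset[OF _ assms(1)]) (use assms(2) in auto)

lemma uncorrelated_on_finite_orbit: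
  fixes \<tau> :: "'i \<Rightarrow> 'i"
  assumes bij: "bij_betw \<tau> Z Z" and ab: "a \<in> Z" "(\<tau> ^^ q\<^sub>0) a = b" "a \<noteq> b" and r: "r > 0" "(\<tau> ^^ r) a = a"
  shows "\<exists>v w. uncorrelated \<tau> Z v w"
proof -
  define X where "X = (\<lambda>k. (\<tau> ^^ k) a) ` {..<r}"
  have X: "(\<tau> ^^ k) a \<in> X" for k
    using funpow_mod_eq[OF r(2), of k] r(1) unfolding X_def by (metis imageI lessThan_iff mod_less_divisor)
  have finO: "finite X" by (simp add: X_def)
  have OZ: "X \<subseteq> Z"
    using bij_betwE[OF funpow_bij_betw[OF bij]] ab(1) by (auto simp: X_def)
  have img: "(\<tau> ^^ q) ` X \<subseteq> X" for q
  proof safe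
    fix z assume "z \<in> X"
    then obtain k where "z = (\<tau> ^^ k) a" by (auto simp: X_def)
    then have "(\<tau> ^^ q) z = (\<tau> ^^ (q + k)) a" by (simp add: funpow_add)
    then show "(\<tau> ^^ q) z \<in> X" using X by simp
  qed
  have injO: "inj_on (\<tau> ^^ q) X" for q
    using funpow_bij_betw[OF bij, of q] OZ by (meson bij_betw_imp_inj_on inj_on_subset)
  have bijO: "bij_betw (\<tau> ^^ q) X X" for q
    using endo_inj_surj[OF finO img injO] injO by (simp add: bij_betw_def)
  have aO: "a \<in> X" and bO: "b \<in> X" using X[of 0] X[of q\<^sub>0] ab by simp_all
  define v w :: "'i \<Rightarrow> complex" where "v z = (if z \<in> X then 1 else 0)"
    and "w z = (if z = a then 1 else 0) - (if z = b then 1 else 0)" for z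
  have sum0: "(\<Sum>z\<in>X. cnj (w z)) = 0"
    using finO aO bO by (simp add: w_def sum_subtractf if_distrib[of cnj] cong: if_cong)
  have inf: "infsum f Z = sum f X" if "\<And>z. z \<in> Z - X \<Longrightarrow> f z = 0" for f :: "'i \<Rightarrow> complex"
  proof -
    have "infsum f Z = infsum f X" by (rule infsum_cong_neutral) (use that OZ in auto)
    then show ?thesis using finO by simp
  qed
  have 1: "(\<Sum>\<^sub>\<infinity>z\<in>Z. v z * cnj (w ((\<tau> ^^ q) z))) = 0" for q
  proof -
    have "(\<Sum>\<^sub>\<infinity>z\<in>Z. v z * cnj (w ((\<tau> ^^ q) z))) = (\<Sum>z\<in>X. v z * cnj (w ((\<tau> ^^ q) z)))"
      by (rule inf) (simp add: v_def)
    also have "\<dots> = (\<Sum>z\<in>X. cnj (w ((\<tau> ^^ q) z)))" by (simp add: v_def)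
    also have "\<dots> = (\<Sum>z\<in>X. cnj (w z))" by (rule sum.reindex_bij_betw[OF bijO])
    finally show ?thesis using sum0 by simp
  qed
  have 2: "(\<Sum>\<^sub>\<infinity>z\<in>Z. v ((\<tau> ^^ q) z) * cnj (w z)) = 0" for q
  proof -
    have "(\<Sum>\<^sub>\<infinity>z\<in>Z. v ((\<tau> ^^ q) z) * cnj (w z)) = (\<Sum>z\<in>X. v ((\<tau> ^^ q) z) * cnj (w z))"
      by (rule inf) (use aO bO in \<open>auto simp: w_def\<close>)
    also have "\<dots> = (\<Sum>z\<in>X. cnj (w z))"
      using img[of q] by (intro sum.cong) (auto simp: v_def)
    finally show ?thesis using sum0 by simp
  qed
  have "uncorrelated \<tau> Z v w" unfolding uncorrelated_def
  proof (intro conjI allI impI 1 2)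
    show "v z = 0" "w z = 0" if "z \<notin> Z" for z using that OZ aO bO by (auto simp: v_def w_def)
    show "(\<lambda>z. (cmod (v z))\<^sup>2) summable_on UNIV"
      by (rule summable_on_finite_support[OF finO]) (simp add: v_def)
    show "(\<lambda>z. (cmod (w z))\<^sup>2) summable_on UNIV"
      by (rule summable_on_finite_support[OF finO]) (use aO bO in \<open>auto simp: w_def\<close>)
    have "v a \<noteq> 0" "w a \<noteq> 0" using aO ab by (auto simp: v_def w_def)
    then show "\<exists>z. v z \<noteq> 0" "\<exists>z. w z \<noteq> 0" by blast+
  qed
  then show ?thesis by blast
qed

lemma uncorrelated_on_infinite_orbit:
  fixes \<tau> :: "'i \<Rightarrow> 'i"
  assumes bij: "bij_betw \<tau> Z Z" and a: "a \<in> Z" and free: "\<And>r. r > 0 \<Longrightarrow> (\<tau> ^^ r) a \<noteq> a"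
  shows "\<exists>v w. uncorrelated \<tau> Z v w"
proof -
  obtain V W :: "int \<Rightarrow> complex" where VW: "(\<lambda>k. (cmod (V k))\<^sup>2) summable_on UNIV" "(\<lambda>k. (cmod (W k))\<^sup>2) summable_on UNIV"
    "V 0 \<noteq> 0" "W 0 \<noteq> 0" "\<And>q. ((\<lambda>k. V k * cnj (W (k + q))) has_sum 0) UNIV"
    using uncorrelated_int_sequences by blast
  define \<sigma> where "\<sigma> = inv_into Z \<tau>"
  have \<sigma>: "\<sigma> z \<in> Z" "\<tau> (\<sigma> z) = z" if "z \<in> Z" for z
    using bij that by (auto simp: \<sigma>_def bij_betw_def inv_into_into f_inv_into_f)
  have \<tau>Z: "(\<tau> ^^ n) z \<in> Z" if "z \<in> Z" for z n using bij_betwE[OF funpow_bij_betw[OF bij]] that by blast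
  have \<sigma>Z: "(\<sigma> ^^ n) z \<in> Z" if "z \<in> Z" for z n by (induction n) (use that \<sigma> in auto)
  define g where "g k = (if k \<ge> 0 then (\<tau> ^^ nat k) a else (\<sigma> ^^ nat (- k)) a)" for k :: int
  have gZ: "g k \<in> Z" for k using \<tau>Z \<sigma>Z a by (simp add: g_def)
  have g_Suc: "\<tau> (g k) = g (k + 1)" for k
  proof (cases "k \<ge> 0")
    case True
    then have "nat (k + 1) = Suc (nat k)" by simp
    then show ?thesis using True by (simp add: g_def)
  next
    case False
    then have "nat (- k) = Suc (nat (- (k + 1)))" by simp
    then have "\<tau> (g k) = (\<sigma> ^^ nat (- (k + 1))) a" using False \<sigma> \<sigma>Z[OF a] by (simp add: g_def)
    also have "\<dots> = g (k + 1)" using False by (cases "k = - 1") (auto simp: g_def)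
    finally show ?thesis .
  qed
  have g_add: "(\<tau> ^^ n) (g k) = g (k + int n)" for n k
    by (induction n) (simp_all add: g_Suc add.assoc add.commute[of 1])
  have g_ne: "g k \<noteq> g l" if "k < l" for k l
  proof
    assume "g k = g l"
    define m where "m = nat (- k)"
    have nn: "k + int m \<ge> 0" "l + int m \<ge> 0" using that by (simp_all add: m_def)
    have "g (k + int m) = g (l + int m)" unfolding g_add[symmetric] \<open>g k = g l\<close> ..
    then have "(\<tau> ^^ nat (l + int m)) a = (\<tau> ^^ nat (k + int m)) a"
      using nn by (simp add: g_def)
    moreover have "nat (l + int m) = nat (k + int m) + nat (l - k)" using that nn by simp
    ultimately have "(\<tau> ^^ nat (k + int m)) ((\<tau> ^^ nat (l - k)) a) = (\<tau> ^^ nat (k + int m)) a"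
      by (simp only: funpow_add comp_apply)
    then have "(\<tau> ^^ nat (l - k)) a = a"
      using inj_onD[OF bij_betw_imp_inj_on[OF funpow_bij_betw[OF bij]]] \<tau>Z a by blast
    then show False using free[of "nat (l - k)"] that by simp
  qed
  have inj: "inj g" using g_ne by (intro injI) (metis linorder_neqE_linordered_idom)
  define v w where "v z = (if z \<in> range g then V (inv g z) else 0)"
    and "w z = (if z \<in> range g then W (inv g z) else 0)" for z
  have vg: "v (g k) = V k" and wg: "w (g k) = W k" for k using inj by (simp_all add: v_def w_def)
  have summ: "(\<lambda>z. (cmod (f z))\<^sup>2) summable_on UNIV"
    if "(\<lambda>k. (cmod (f (g k)))\<^sup>2) summable_on UNIV" "\<And>z. z \<notin> range g \<Longrightarrow> f z = 0" for f :: "'i \<Rightarrow> complex"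
  proof -
    have "(\<lambda>z. (cmod (f z))\<^sup>2) summable_on range g"
      using that(1) inj by (subst summable_on_reindex) (auto simp: o_def)
    then show ?thesis using that(2) by (subst summable_on_cong_neutral[where T = "range g"]) auto
  qed
  have inf: "infsum f Z = 0" if "((\<lambda>k. f (g k)) has_sum 0) UNIV" "\<And>z. z \<notin> range g \<Longrightarrow> f z = 0" for f :: "'i \<Rightarrow> complex"
  proof -
    have "infsum f Z = infsum f (range g)" by (rule infsum_cong_neutral) (use that(2) gZ in auto)
    also have "\<dots> = infsum (\<lambda>k. f (g k)) UNIV" using inj by (subst infsum_reindex) (auto simp: o_def)
    finally show ?thesis using infsumI[OF that(1)] by simp
  qed
  have 1: "(\<Sum>\<^sub>\<infinity>z\<in>Z. v z * cnj (w ((\<tau> ^^ q) z))) = 0" for q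
    by (rule inf) (simp_all add: g_add vg wg VW(5), simp add: v_def)
  have 2: "(\<Sum>\<^sub>\<infinity>z\<in>Z. v ((\<tau> ^^ q) z) * cnj (w z)) = 0" for q
  proof (rule inf)
    have "((\<lambda>k. V (k + int q) * cnj (W (k + int q + - int q))) has_sum 0) UNIV"
      using VW(5)[of "- int q"] bij_int_add[of "int q"]
        has_sum_reindex_bij_betw[of "\<lambda>j. j + int q" UNIV UNIV "\<lambda>k. V k * cnj (W (k + - int q))" 0] by simp
    then show "((\<lambda>k. v ((\<tau> ^^ q) (g k)) * cnj (w (g k))) has_sum 0) UNIV" by (simp add: g_add vg wg)
  qed (simp add: w_def)
  have "uncorrelated \<tau> Z v w" unfolding uncorrelated_def
  proof (intro conjI allI impI 1 2)
    show "v z = 0" "w z = 0" if "z \<notin> Z" for z using that gZ by (auto simp: v_def w_def)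
    show "(\<lambda>z. (cmod (v z))\<^sup>2) summable_on UNIV" by (rule summ) (simp_all add: vg VW, simp add: v_def)
    show "(\<lambda>z. (cmod (w z))\<^sup>2) summable_on UNIV" by (rule summ) (simp_all add: wg VW, simp add: w_def)
    have "v (g 0) \<noteq> 0" "w (g 0) \<noteq> 0" using VW by (simp_all add: vg wg)
    then show "\<exists>z. v z \<noteq> 0" "\<exists>z. w z \<noteq> 0" by blast+
  qed
  then show ?thesis by blast
qed

text \<open>The pairs are point masses if there are two orbits, a constant and a difference of point masses
  on a single finite orbit, and the sequences related to the square wave on an infinite orbit.\<close>

lemma uncorrelated_pair:
  fixes \<tau> :: "'i \<Rightarrow> 'i"
  assumes bij: "bij_betw \<tau> Z Z" and ab: "a \<in> Z" "b \<in> Z" "a \<noteq> b"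
  shows "\<exists>v w. uncorrelated \<tau> Z v w"
proof (cases "\<exists>q. (\<tau> ^^ q) a = b \<or> (\<tau> ^^ q) b = a")
  case True
  then obtain c d q where c: "c \<in> Z" "(\<tau> ^^ q) c = d" "c \<noteq> d" using ab by metis
  show ?thesis
  proof (cases "\<exists>r>0. (\<tau> ^^ r) c = c")
    case True
    then obtain r where r: "r > 0" "(\<tau> ^^ r) c = c" by blast
    show ?thesis by (rule uncorrelated_on_finite_orbit[OF bij c r])
  next
    case False
    then have free: "(\<tau> ^^ r) c \<noteq> c" if "r > 0" for r using that by blast
    show ?thesis by (rule uncorrelated_on_infinite_orbit[OF bij c(1) free])
  qed
next
  case False
  define v w :: "'i \<Rightarrow> complex" where "v z = (if z = a then 1 else 0)" and "w z = (if z = b then 1 else 0)" for z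
  have "uncorrelated \<tau> Z v w" unfolding uncorrelated_def
  proof (intro conjI allI impI)
    show "(\<lambda>z. (cmod (v z))\<^sup>2) summable_on UNIV" "(\<lambda>z. (cmod (w z))\<^sup>2) summable_on UNIV"
      by (rule summable_on_finite_support[of "{a, b}"]; simp add: v_def w_def)+
    show "(\<Sum>\<^sub>\<infinity>z\<in>Z. v z * cnj (w ((\<tau> ^^ q) z))) = 0" "(\<Sum>\<^sub>\<infinity>z\<in>Z. v ((\<tau> ^^ q) z) * cnj (w z)) = 0" for q
      using False by (auto intro!: infsum_0 simp: v_def w_def)
  qed (use ab in \<open>auto simp: v_def w_def\<close>)
  then show ?thesis by blast
qed

section \<open>Irreducibility forces distinct itineraries\<close>

context branching_rep
begin

text \<open>The vectors \<open>u\<close> such that \<open>s\<^sub>I\<^sup>* u\<close> is orthogonal to \<open>s\<^sub>J\<^sup>* y\<close> for all words \<open>I\<close> and \<open>J\<close> form a closed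
  invariant subspace: a generator applied to \<open>u\<close> either cancels against the first letter of \<open>I\<close> or,
  for empty \<open>I\<close>, is moved over to \<open>J\<close>. This subspace contains \<open>x\<close> but not \<open>y\<close>.\<close>

lemma not_irreducible_if_uncorrelated:
  assumes x: "x \<in> K" "x \<noteq> 0" and y: "y \<in> K" "y \<noteq> 0"
    and unc: "\<And>I J. \<forall>i\<in>set I. i \<ge> 1 \<Longrightarrow> \<forall>i\<in>set J. i \<ge> 1 \<Longrightarrow>
      cinner (\<rho> (star (s_word s I)) x) (\<rho> (star (s_word s J)) y) = 0"
  shows "\<not> irreducible_rep K \<rho>"
proof
  assume irr: "irreducible_rep K \<rho>"
  define M where "M = {u \<in> K. \<forall>I J. (\<forall>i\<in>set I. i \<ge> 1) \<longrightarrow> (\<forall>i\<in>set J. i \<ge> 1) \<longrightarrow>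
      cinner (\<rho> (star (s_word s I)) u) (\<rho> (star (s_word s J)) y) = 0}"
  have "subrepresentation K \<rho> M"
  proof (rule subrepresentationI)
    define T where "T = {\<rho> (s_word s I) (\<rho> (star (s_word s J)) y) | I J. (\<forall>i\<in>set I. i \<ge> 1) \<and> (\<forall>i\<in>set J. i \<ge> 1)}"
    have adj: "cinner (\<rho> (star (s_word s I)) u) (\<rho> (star (s_word s J)) y) = cinner u (\<rho> (s_word s I) (\<rho> (star (s_word s J)) y))"
      if "u \<in> K" for u I J using that y by (simp add: adjoint star_star)
    have "M = K \<inter> {u. \<forall>w\<in>T. cinner u w = 0}"
      unfolding M_def T_def by (auto simp: adj) blast
    then show "closed_csubspace M"
      by (simp only: closed_csubspace_Int[OF closed_csubspace_K closed_csubspace_annihilator])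
    show "M \<subseteq> K" by (auto simp: M_def)
    show "\<rho> 1 v \<in> M" if "v \<in> M" for v using that \<open>M \<subseteq> K\<close> by (auto simp: rep_one)
  next
    fix i u assume i: "i \<ge> (1::nat)" and u: "u \<in> M"
    have uK: "u \<in> K" and ort: "\<And>I J. \<forall>i\<in>set I. i \<ge> 1 \<Longrightarrow> \<forall>i\<in>set J. i \<ge> 1 \<Longrightarrow>
        cinner (\<rho> (star (s_word s I)) u) (\<rho> (star (s_word s J)) y) = 0"
      using u by (auto simp: M_def)
    have "cinner (\<rho> (star (s_word s I)) (\<rho> (s i) u)) (\<rho> (star (s_word s J)) y) = 0"
      if I: "\<forall>i\<in>set I. i \<ge> 1" and J: "\<forall>i\<in>set J. i \<ge> 1" for I J
    proof (cases I)
      case Nil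
      have "cinner (\<rho> (s i) u) (\<rho> (star (s_word s J)) y) = cinner u (\<rho> (star (s_word s (J @ [i]))) y)"
        using uK y by (simp add: adjoint s_word_snoc star_mult rep_mult)
      also have "\<dots> = 0" using ort[of "[]" "J @ [i]"] J i uK by (simp add: rep_one del: One_nat_def)
      finally show ?thesis using Nil uK by (simp add: rep_one)
    next
      case (Cons j I')
      have "\<rho> (star (s_word s I)) (\<rho> (s i) u) = \<rho> (star (s_word s I')) (\<rho> (star (s j) * s i) u)"
        using uK by (simp add: Cons star_mult rep_mult)
      also have "\<dots> = (if j = i then \<rho> (star (s_word s I')) u else 0)"
        using I i uK by (simp add: Cons star_gen_mult_gen rep_one rep_zero del: One_nat_def)
      finally show ?thesis using ort[of I' J] I J by (auto simp: Cons)
    qed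
    then show "\<rho> (s i) u \<in> M" using uK by (auto simp: M_def)
    have "cinner (\<rho> (star (s_word s I)) (\<rho> (star (s i)) u)) (\<rho> (star (s_word s J)) y) = 0"
      if I: "\<forall>i\<in>set I. i \<ge> 1" and J: "\<forall>i\<in>set J. i \<ge> 1" for I J
      using ort[of "i # I" J] I J i uK by (simp add: star_mult rep_mult del: One_nat_def)
    then show "\<rho> (star (s i)) u \<in> M" using uK by (auto simp: M_def)
  qed
  moreover have "x \<in> M" using x(1) unc by (auto simp: M_def)
  ultimately have "M = K" using irr x(2) unfolding irreducible_rep_def by blast
  then have "y \<in> M" using y(1) by simp
  then have "\<forall>I J. (\<forall>i\<in>set I. i \<ge> 1) \<longrightarrow> (\<forall>i\<in>set J. i \<ge> 1) \<longrightarrow>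
      cinner (\<rho> (star (s_word s I)) y) (\<rho> (star (s_word s J)) y) = 0" by (simp add: M_def)
  from this[rule_format, of "[]" "[]"] have "cinner y y = 0" using y(1) by (simp add: rep_one)
  then show False using y(2) by (simp add: cinner_self)
qed

lemma sh_funpow_inject:
  assumes "a \<in> A" "b \<in> A" "itin n a = itin n b" "(sh ^^ n) a = (sh ^^ n) b"
  shows "a = b"
proof -
  have "a = foldr br (itin n a) ((sh ^^ n) a)" by (rule foldr_br_itin[OF assms(1), symmetric])
  also have "\<dots> = foldr br (itin n b) ((sh ^^ n) b)" unfolding assms(3,4) ..
  also have "\<dots> = b" by (rule foldr_br_itin[OF assms(2)])
  finally show ?thesis .
qed

definition code :: "'i \<Rightarrow> nat \<Rightarrow> nat" where
  "code a n = lab ((sh ^^ n) a)"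

lemma itin_code: "itin n a = map (code a) [0..<n]"
  by (simp add: itin_def code_def)

lemma code_foldr_br:
  assumes "\<forall>i\<in>set w. i \<ge> 1" "a \<in> A"
  shows "code (foldr br w a) n = (if n < length w then w ! n else code a (n - length w))"
proof (cases "n < length w")
  case True
  then show ?thesis using arg_cong[OF itin_foldr_br[OF assms], of "\<lambda>l. l ! n"] by (simp add: itin_code)
next
  case False
  then have "(sh ^^ n) (foldr br w a) = (sh ^^ (n - length w)) ((sh ^^ length w) (foldr br w a))"
    by (simp add: funpow_add[symmetric] flip: comp_apply[of "sh ^^ _" "sh ^^ _"])
  then show ?thesis using False sh_foldr_br[OF assms] by (simp add: code_def)
qed

text \<open>Suppose two basis elements have the same itinerary. Passing to images under \<open>sh\<close>, the itinerary
  \<open>J\<close> may be taken purely periodic with least period \<open>p\<close>, where \<open>p = 0\<close> stands for an itinerary that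
  is not eventually periodic. Then \<open>sh ^^ p\<close> permutes the set \<open>Z\<close> of the elements with itinerary \<open>J\<close>,
  and for vectors supported on \<open>Z\<close> the inner products in the preceding criterion reduce to
  correlations under the powers of this permutation: if two words both lead from \<open>a\<close> into \<open>Z\<close>, their
  lengths are congruent modulo \<open>p\<close>.\<close>

theorem irreducible_imp_separated:
  assumes irr: "irreducible_rep K \<rho>" and a: "a \<in> A" and b: "b \<in> A" and same: "code a = code b"
  shows "a = b"
proof (rule ccontr)
  assume "a \<noteq> b"
  define \<sigma> where "\<sigma> f = (\<lambda>n. f (Suc n))" for f :: "nat \<Rightarrow> nat"
  have \<sigma>: "(\<sigma> ^^ m) f = (\<lambda>n. f (n + m))" for m f
    by (induction m arbitrary: f) (auto simp: \<sigma>_def fun_eq_iff)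
  have code_sh: "code ((sh ^^ m) z) = (\<sigma> ^^ m) (code z)" for m z
    by (auto simp: \<sigma> code_def fun_eq_iff funpow_add)
  obtain k p where p: "(\<sigma> ^^ p) ((\<sigma> ^^ k) (code a)) = (\<sigma> ^^ k) (code a)"
    and mod: "\<And>m n. (\<sigma> ^^ m) ((\<sigma> ^^ k) (code a)) = (\<sigma> ^^ n) ((\<sigma> ^^ k) (code a)) \<Longrightarrow> m mod p = n mod p"
    using exists_periodic_point[of \<sigma> "code a"] by metis
  define J where "J = (\<sigma> ^^ k) (code a)"
  define Z where "Z = {z \<in> A. code z = J}"
  have ZA: "Z \<subseteq> A" by (auto simp: Z_def)
  have J_ge: "J n \<ge> 1" for n using lab_ge_1[OF sh_funpow_in[OF a]] by (simp add: J_def \<sigma> code_def)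
  have inj: "z = z'" if "z \<in> Z" "z' \<in> Z" "(sh ^^ n) z = (sh ^^ n) z'" for z z' n
    using that by (intro sh_funpow_inject[of z z' n]) (auto simp: Z_def itin_code)
  have ab: "(sh ^^ k) a \<in> Z" "(sh ^^ k) b \<in> Z"
    using a b same by (auto simp: Z_def code_sh J_def sh_funpow_in)
  have ne: "(sh ^^ k) a \<noteq> (sh ^^ k) b"
    using sh_funpow_inject[OF a b, of k] same \<open>a \<noteq> b\<close> by (auto simp: itin_code)
  have bij: "bij_betw (sh ^^ p) Z Z"
  proof (rule bij_betw_imageI)
    show "inj_on (sh ^^ p) Z" using inj by (auto intro: inj_onI)
    show "(sh ^^ p) ` Z = Z"
    proof
      show "(sh ^^ p) ` Z \<subseteq> Z" using p by (auto simp: Z_def code_sh sh_funpow_in J_def)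
      show "Z \<subseteq> (sh ^^ p) ` Z"
      proof
        fix z assume z: "z \<in> Z"
        define w where "w = map J [0..<p]"
        have w: "\<forall>i\<in>set w. i \<ge> 1" using J_ge by (auto simp: w_def)
        have zA: "z \<in> A" using z ZA by blast
        have "code (foldr br w z) n = J n" for n
        proof (cases "n < p")
          case False
          have "code (foldr br w z) n = J (n - p)" using code_foldr_br[OF w zA] False z by (simp add: w_def Z_def)
          also have "\<dots> = (\<sigma> ^^ p) J (n - p)" using p by (simp add: J_def)
          finally show ?thesis using False by (simp add: \<sigma>)
        qed (use code_foldr_br[OF w zA] in \<open>simp add: w_def\<close>)
        then have "foldr br w z \<in> Z" using foldr_br_in[OF w zA] by (auto simp: Z_def)
        moreover have "(sh ^^ p) (foldr br w z) = z" using sh_foldr_br[OF w zA] by (simp add: w_def)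
        ultimately show "z \<in> (sh ^^ p) ` Z" by (metis imageI)
      qed
    qed
  qed
  obtain v w :: "'i \<Rightarrow> complex" where vZ: "\<And>z. z \<notin> Z \<Longrightarrow> v z = 0" and wZ: "\<And>z. z \<notin> Z \<Longrightarrow> w z = 0"
    and vw: "(\<lambda>z. (cmod (v z))\<^sup>2) summable_on UNIV" "(\<lambda>z. (cmod (w z))\<^sup>2) summable_on UNIV"
      "\<exists>z. v z \<noteq> 0" "\<exists>z. w z \<noteq> 0"
    and corr1: "\<And>q. (\<Sum>\<^sub>\<infinity>z\<in>Z. v z * cnj (w (((sh ^^ p) ^^ q) z))) = 0"
    and corr2: "\<And>q. (\<Sum>\<^sub>\<infinity>z\<in>Z. v (((sh ^^ p) ^^ q) z) * cnj (w z)) = 0"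
    using uncorrelated_pair[OF bij ab ne] unfolding uncorrelated_def by auto
  have vec: "\<exists>x\<in>K. x \<noteq> 0 \<and> (\<forall>c\<in>A. cinner x (e c) = f c)"
    if f: "\<And>z. z \<notin> Z \<Longrightarrow> f z = 0" "(\<lambda>z. (cmod (f z))\<^sup>2) summable_on UNIV" "\<exists>z. f z \<noteq> 0" for f
  proof -
    have cf: "ell2_coeff (Abs_ell2 f) = f" by (rule ell2_coeff_Abs[OF f(2)])
    then have "Abs_ell2 f \<in> l2 A" using f(1) ZA by (auto simp: l2_def)
    then obtain x where x: "x \<in> K" "coords A e x = Abs_ell2 f"
      unfolding coords_image[OF on basis, symmetric] by auto
    have "cinner x (e c) = f c" if "c \<in> A" for c
      using arg_cong[OF x(2), of "\<lambda>g. ell2_coeff g c"] that by (simp add: coeff_coords[OF on basis] cf)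
    moreover from this have "x \<noteq> 0" using f(1,3) ZA by (metis cinner_zero_left subsetD)
    ultimately show ?thesis using x(1) by blast
  qed
  obtain x where x: "x \<in> K" "x \<noteq> 0" "\<And>c. c \<in> A \<Longrightarrow> cinner x (e c) = v c" using vec[OF vZ vw(1,3)] by blast
  obtain y where y: "y \<in> K" "y \<noteq> 0" "\<And>c. c \<in> A \<Longrightarrow> cinner y (e c) = w c" using vec[OF wZ vw(2,4)] by blast
  have "cinner (\<rho> (star (s_word s I)) x) (\<rho> (star (s_word s I')) y) = 0"
    if I: "\<forall>i\<in>set I. i \<ge> 1" and I': "\<forall>i\<in>set I'. i \<ge> 1" for I I'
  proof -
    let ?t = "\<lambda>c. v (foldr br I c) * cnj (w (foldr br I' c))"
    have "cinner (\<rho> (star (s_word s I)) x) (\<rho> (star (s_word s I')) y)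
        = cinner (coords A e (\<rho> (star (s_word s I)) x)) (coords A e (\<rho> (star (s_word s I')) y))"
      using x(1) by (simp add: cinner_coords[OF on basis])
    also have "\<dots> = infsum ?t A"
      unfolding cinner_ell2_def
      by (rule infsum_cong_neutral)
        (use I I' x y in \<open>auto simp: coeff_coords[OF on basis] coeff_star_word foldr_br_in simp del: One_nat_def\<close>)
    also have "\<dots> = 0"
    \<comment> \<open>Only those \<open>c\<close> contribute that both words lead into \<open>Z\<close>. If there is one, they are exactly the
      elements with the same itinerary as this one.\<close>
    proof (cases "\<exists>c\<in>A. foldr br I c \<in> Z \<and> foldr br I' c \<in> Z")
      case False
      then show ?thesis using vZ wZ by (intro infsum_0) (metis complex_cnj_zero mult_eq_0_iff)
    next
      case True
      then obtain c where c: "c \<in> A" "foldr br I c \<in> Z" "foldr br I' c \<in> Z" by blast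
      have code_base: "code d = (\<sigma> ^^ length L) J"
        if "\<forall>i\<in>set L. i \<ge> 1" "d \<in> A" "foldr br L d \<in> Z" for L d
      proof -
        have "code d = code ((sh ^^ length L) (foldr br L d))" by (simp only: sh_foldr_br[OF that(1,2)])
        also have "\<dots> = (\<sigma> ^^ length L) (code (foldr br L d))" by (rule code_sh)
        finally show ?thesis using that(3) by (simp add: Z_def)
      qed
      note code_c = code_base[OF I c(1,2)] code_base[OF I' c(1,3)]
      define B where "B = {d \<in> A. code d = code c}"
      have into: "d \<in> B \<longleftrightarrow> d \<in> A \<and> foldr br L d \<in> Z"
        if L: "\<forall>i\<in>set L. i \<ge> 1" "foldr br L c \<in> Z" for L d
      proof
        assume d: "d \<in> B"
        then have "code (foldr br L d) = code (foldr br L c)"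
          using code_foldr_br[OF L(1)] c(1) by (auto simp: B_def fun_eq_iff)
        then show "d \<in> A \<and> foldr br L d \<in> Z" using d L foldr_br_in[OF L(1)] by (auto simp: B_def Z_def)
      next
        assume d: "d \<in> A \<and> foldr br L d \<in> Z"
        have "code d = (\<sigma> ^^ length L) J" "code c = (\<sigma> ^^ length L) J"
          using d code_base[OF L(1)] c(1) L(2) by blast+
        then show "d \<in> B" using d by (simp add: B_def)
      qed
      have bijB: "bij_betw (foldr br L) B Z" if L: "\<forall>i\<in>set L. i \<ge> 1" "foldr br L c \<in> Z" for L
      proof (rule bij_betw_byWitness[of _ "sh ^^ length L"])
        show "\<forall>d\<in>B. (sh ^^ length L) (foldr br L d) = d" using sh_foldr_br[OF L(1)] by (auto simp: B_def)
        have itL: "itin (length L) z = L" if "z \<in> Z" for z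
        proof -
          have "itin (length L) z = itin (length L) (foldr br L c)" using that L(2) by (simp add: itin_code Z_def)
          then show ?thesis using itin_foldr_br[OF L(1) c(1)] by simp
        qed
        show rev: "\<forall>z\<in>Z. foldr br L ((sh ^^ length L) z) = z" using itL foldr_br_itin ZA by (metis subsetD)
        show "foldr br L ` B \<subseteq> Z" using into[OF L] by blast
        show "(sh ^^ length L) ` Z \<subseteq> B"
        proof safe
          fix z assume z: "z \<in> Z"
          then have "(sh ^^ length L) z \<in> A" using ZA sh_funpow_in by blast
          then show "(sh ^^ length L) z \<in> B" using into[OF L, of "(sh ^^ length L) z"] rev z by simp
        qed
      qed
      have "infsum ?t A = infsum ?t B"
      proof (rule infsum_cong_neutral)
        fix d assume "d \<in> A - B"
        then have "foldr br I d \<notin> Z" using into[OF I c(2)] by blast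
        then show "?t d = 0" using vZ by simp
      qed (auto simp: B_def)
      also have "\<dots> = 0"
      proof -
        have shift: "foldr br L' d = ((sh ^^ p) ^^ q) (foldr br L d)"
          if L: "\<forall>i\<in>set L. i \<ge> 1" "foldr br L c \<in> Z" and L': "\<forall>i\<in>set L'. i \<ge> 1" "foldr br L' c \<in> Z"
            and len: "length L = length L' + p * q" and d: "d \<in> B" for L L' q d
        proof (rule inj[of _ _ "length L'"])
          have dA: "d \<in> A" and dZ: "foldr br L d \<in> Z" using d into[OF L] by blast+
          show "foldr br L' d \<in> Z" using d into[OF L'] by blast
          show "((sh ^^ p) ^^ q) (foldr br L d) \<in> Z" using bij_betwE[OF funpow_bij_betw[OF bij]] dZ by blast
          have "(sh ^^ length L') (((sh ^^ p) ^^ q) (foldr br L d)) = (sh ^^ length L) (foldr br L d)"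
            unfolding len funpow_mult funpow_add by simp
          then show "(sh ^^ length L') (foldr br L' d) = (sh ^^ length L') (((sh ^^ p) ^^ q) (foldr br L d))"
            using sh_foldr_br[OF L(1) dA] sh_foldr_br[OF L'(1) dA] by simp
        qed
        have "length I mod p = length I' mod p"
          using code_c mod unfolding J_def by metis
        then consider q where "length I = length I' + p * q" | q where "length I' = length I + p * q"
          by (metis linorder_linear mod_eq_nat1E)
        then show ?thesis
        proof cases
          case 1
          have "infsum ?t B = (\<Sum>\<^sub>\<infinity>d\<in>B. v (foldr br I d) * cnj (w (((sh ^^ p) ^^ q) (foldr br I d))))"
            by (intro infsum_cong) (simp add: shift[OF I c(2) I' c(3) 1])
          also have "\<dots> = (\<Sum>\<^sub>\<infinity>z\<in>Z. v z * cnj (w (((sh ^^ p) ^^ q) z)))"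
            by (rule infsum_reindex_bij_betw[OF bijB[OF I c(2)]])
          finally show ?thesis using corr1 by simp
        next
          case 2
          have "infsum ?t B = (\<Sum>\<^sub>\<infinity>d\<in>B. v (((sh ^^ p) ^^ q) (foldr br I' d)) * cnj (w (foldr br I' d)))"
            by (intro infsum_cong) (simp add: shift[OF I' c(3) I c(2) 2])
          also have "\<dots> = (\<Sum>\<^sub>\<infinity>z\<in>Z. v (((sh ^^ p) ^^ q) z) * cnj (w z))"
            by (rule infsum_reindex_bij_betw[OF bijB[OF I' c(3)]])
          finally show ?thesis using corr2 by simp
        qed
      qed
      finally show ?thesis .
    qed
    finally show ?thesis .
  qed
  then show False using not_irreducible_if_uncorrelated[OF x(1,2) y(1,2)] irr by blast
qed

end

text \<open>The coordinate map intertwines the generators and their adjoints, because the coordinates of the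
  image of a vector under these depend only on the common dynamics of the two bases.\<close>

lemma unitarily_equivalent_l2:
  assumes "branching_rep s K \<rho> A e br lab sh" and "branching_rep s (l2 A) \<pi> A ket br lab sh"
  shows "unitarily_equivalent K \<rho> (l2 A) \<pi>"
proof -
  interpret R: branching_rep s K \<rho> A e br lab sh by fact
  interpret S: branching_rep s "l2 A" \<pi> A ket br lab sh by fact
  let ?u = "coords A e"
  have img: "?u ` K = l2 A" by (rule coords_image[OF R.on R.basis])
  have uK: "?u v \<in> l2 A" if "v \<in> K" for v using img that by blast
  have coeff: "cinner (?u v) (ket c) = cinner v (e c)" if "c \<in> A" for v c
    using that by (simp add: coeff_coords[OF R.on R.basis])
  have intertwineI: "\<forall>v\<in>K. ?u (\<rho> x v) = \<pi> x (?u v)"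
    if "\<And>v c. v \<in> K \<Longrightarrow> c \<in> A \<Longrightarrow> cinner (\<rho> x v) (e c) = cinner (\<pi> x (?u v)) (ket c)" for x
    using that uK by (auto intro!: basis_eqI[OF S.on S.basis] simp: coeff simp del: cinner_ket_right)
  have tw: "\<forall>v\<in>K. ?u (\<rho> x v) = \<pi> x (?u v)" for x
  proof (induction x rule: R.generator_induct)
    case closed
    have "{x. \<forall>v\<in>K. ?u (\<rho> x v) = \<pi> x (?u v)} = (\<Inter>v\<in>K. {x. ?u (\<rho> x v) = \<pi> x (?u v)})" by auto
    moreover have "closed {x. ?u (\<rho> x v) = \<pi> x (?u v)}" if "v \<in> K" for v
      using that uK by (intro closed_Collect_eq S.continuous_on_rep
          continuous_on_compose2[OF linear_continuous_on[OF bounded_linear_coords[OF R.on R.basis]] R.continuous_on_rep, of _ UNIV]) auto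
    ultimately show ?case by auto
  next
    case (gen i)
    show ?case by (rule intertwineI) (simp add: gen R.coeff_gen S.coeff_gen R.sh_in uK coeff R.lab_ge_1 del: One_nat_def cinner_ket_right)
  next
    case (star_gen i)
    show ?case by (rule intertwineI) (simp add: star_gen R.coeff_star_gen S.coeff_star_gen R.br_in uK coeff del: One_nat_def cinner_ket_right)
  qed (auto simp: R.rep_one S.rep_one uK R.rep_add S.rep_add coords_add[OF R.on R.basis]
      R.rep_scaleC S.rep_scaleC coords_scaleC[OF R.on R.basis] R.rep_mult S.rep_mult)
  have "?u (\<rho> x (inv_into K ?u w)) = \<pi> x w" if "w \<in> l2 A" for x w
    using tw[of x] that img by (metis f_inv_into_f inv_into_into)
  then show ?thesis unfolding unitarily_equivalent_def
    using img cinner_coords[OF R.on R.basis]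
    by (intro exI[of _ ?u]) (auto simp: coords_add[OF R.on R.basis] coords_scaleC[OF R.on R.basis])
qed

section \<open>The representation on continued fractions\<close>

text \<open>The ranges of the generators span a dense subspace, and this has two consequences. The vectors
  \<open>w - \<rho> 1 w\<close> are orthogonal to all ranges, so the unit acts as the identity. An element of \<open>E\<close> outside
  all the sets \<open>\<rho> (s i) ` E\<close> would be orthogonal to all ranges as well, so these sets exhaust \<open>E\<close>.\<close>

lemma permutative_branching_rep:
  fixes s :: "nat \<Rightarrow> 'o::cstar_algebra_1" and K :: "'h::chilbert_space set"
  assumes cuntz: "cuntz_algebra_infinity s" and perm: "permutative_rep s K \<rho>" and nontriv: "K \<noteq> {0}"
  obtains E :: "'h set" and lab sh where "branching_rep s K \<rho> E (\<lambda>x. x) (\<lambda>i. \<rho> (s i)) lab sh" "E \<noteq> {}"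
proof -
  obtain E where rep: "star_rep K \<rho>" and E: "orthonormal_basis K E" and inv: "\<And>i x. i \<ge> 1 \<Longrightarrow> x \<in> E \<Longrightarrow> \<rho> (s i) x \<in> E"
    and sum: "orthogonal_direct_sum K {1..} (\<lambda>i. \<rho> (s i) ` K)"
    using perm unfolding permutative_rep_def by blast
  interpret cuntz_rep s K \<rho> using cuntz rep by unfold_locales
  have on: "orthonormal_family E (\<lambda>x. x)" and basis: "closure (cspan ((\<lambda>x. x) ` E)) = K"
    using E by (auto simp: orthonormal_basis_def)
  have EK: "E \<subseteq> K" using basis_in[OF on basis] by blast
  have orth: "cinner x y = (if x = y then 1 else 0)" if "x \<in> E" "y \<in> E" for x y
    using on that by (auto simp: orthonormal_family_def)
  have "cinner (\<rho> (s i) v) (w - \<rho> 1 w) = 0" if "v \<in> K" "w \<in> K" for i v w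
  proof -
    have "cinner (\<rho> (s i) v) (\<rho> 1 w) = cinner (\<rho> 1 (\<rho> (s i) v)) w"
      using adjoint[of "\<rho> (s i) v" w 1] that by simp
    also have "\<rho> 1 (\<rho> (s i) v) = \<rho> (s i) v" using rep_mult[of v 1 "s i"] that by simp
    finally show ?thesis by (simp add: cinner_diff_right)
  qed
  then have "closure (cspan (\<Union>i\<in>{1..}. \<rho> (s i) ` K)) \<subseteq> {v. \<forall>u\<in>(\<lambda>w. w - \<rho> 1 w) ` K. cinner v u = 0}"
    by (intro closure_cspan_minimal closed_csubspace_annihilator) auto
  then have K_ort: "cinner v (w - \<rho> 1 w) = 0" if "v \<in> K" "w \<in> K" for v w
    using sum that unfolding orthogonal_direct_sum_def by blast
  have one: "\<rho> 1 w = w" if "w \<in> K" for w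
    using K_ort[of "w - \<rho> 1 w" w] that by (simp add: cinner_self diff_in_K)
  have iso: "cinner (\<rho> (s i) x) (\<rho> (s j) y) = (if i = j then cinner x y else 0)"
    if "i \<ge> 1" "j \<ge> 1" "x \<in> K" "y \<in> K" for i j x y
  proof -
    have "\<rho> 0 y = 0" using rep_add[of y 0 0] that by simp
    then show ?thesis using that by (simp add: adjoint rep_mult[symmetric] star_gen_mult_gen one del: One_nat_def)
  qed
  have "\<exists>i f. i \<ge> 1 \<and> f \<in> E \<and> x = \<rho> (s i) f" if x: "x \<in> E" for x
  proof (rule ccontr)
    assume no: "\<nexists>i f. i \<ge> 1 \<and> f \<in> E \<and> x = \<rho> (s i) f"
    have "cinner (\<rho> (s i) v) x = 0" if i: "i \<ge> 1" and v: "v \<in> K" for i v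
    proof -
      have "K \<subseteq> {v. \<forall>u\<in>{\<rho> (star (s i)) x}. cinner v u = 0}"
        unfolding basis[symmetric]
      proof (intro closure_cspan_minimal closed_csubspace_annihilator subsetI CollectI ballI)
        fix f u assume f: "f \<in> (\<lambda>x. x) ` E" and u: "u \<in> {\<rho> (star (s i)) x}"
        have "f \<in> K" "x \<in> K" using f x EK by auto
        then have "cinner f u = cinner (\<rho> (s i) f) x" using u by (simp add: adjoint)
        also have "\<dots> = 0" using orth[of "\<rho> (s i) f" x] inv[OF i] f x no i by auto
        finally show "cinner f u = 0" .
      qed
      moreover have "x \<in> K" using x EK by blast
      ultimately show ?thesis using v by (auto simp: adjoint)
    qed
    then have "closure (cspan (\<Union>i\<in>{1..}. \<rho> (s i) ` K)) \<subseteq> {v. \<forall>u\<in>{x}. cinner v u = 0}"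
      by (intro closure_cspan_minimal closed_csubspace_annihilator) auto
    then have "cinner x x = 0" using sum x EK unfolding orthogonal_direct_sum_def by blast
    then show False using orth[OF x x] by simp
  qed
  then obtain lab sh where ls: "\<And>x. x \<in> E \<Longrightarrow> lab x \<ge> 1 \<and> sh x \<in> E \<and> x = \<rho> (s (lab x)) (sh x)" by metis
  have unique: "i = j \<and> f = g" if "i \<ge> 1" "j \<ge> 1" "f \<in> E" "g \<in> E" "\<rho> (s i) f = \<rho> (s j) g" for i j f g
  proof -
    have "cinner (\<rho> (s i) f) (\<rho> (s j) g) = 1"
      using that orth[OF inv[of i f] inv[of i f]] by simp
    moreover have "f \<in> K" "g \<in> K" using that EK by blast+
    ultimately show ?thesis using iso[of i j f g] that orth[of f g] by (auto split: if_splits)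
  qed
  have "branching_rep s K \<rho> E (\<lambda>x. x) (\<lambda>i. \<rho> (s i)) lab sh"
  proof
    fix i x assume i: "i \<ge> (1::nat)" and x: "x \<in> E"
    have "lab (\<rho> (s i) x) \<ge> 1 \<and> sh (\<rho> (s i) x) \<in> E \<and> \<rho> (s i) x = \<rho> (s (lab (\<rho> (s i) x))) (sh (\<rho> (s i) x))"
      using ls inv[OF i x] by blast
    then show "lab (\<rho> (s i) x) = i" "sh (\<rho> (s i) x) = x" using unique i x by metis+
  qed (use on basis ls inv in auto)
  moreover have "E \<noteq> {}" using basis nontriv by (auto simp: complex_vector.span_empty)
  ultimately show ?thesis using that by blast
qed

context
  fixes s :: "nat \<Rightarrow> 'o::cstar_algebra_1" and \<pi> :: "'o \<Rightarrow> real ell2 \<Rightarrow> real ell2"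
  assumes cuntz: "cuntz_algebra_infinity s" and rep: "star_rep (l2 Omega) \<pi>"
    and act: "\<And>i x. i \<ge> 1 \<Longrightarrow> x \<in> Omega \<Longrightarrow> \<pi> (s i) (ket x) = ket (1 / (x + real i))"
begin

lemma gauss_branching_rep:
  "separated_branching_rep s (l2 Omega) \<pi> Omega ket (\<lambda>i x. 1 / (x + real i)) cf_digit gauss_map"
proof
  show "orthonormal_family Omega ket" by (auto simp: orthonormal_family_def cinner_ket_ket simp del: cinner_ket_right)
  show "a = b" if "a \<in> Omega" "b \<in> Omega" "\<And>n. cf_digit ((gauss_map ^^ n) a) = cf_digit ((gauss_map ^^ n) b)" for a b
    using that by (intro CFE_inject) (auto simp: CFE_eq)
qed (auto simp: cuntz rep act l2_eq_closure[symmetric] cf_digit_ge_1 gauss_map_in_Omega gauss_map_inverse branch_in_Omega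
    cf_digit_branch gauss_map_branch simp del: One_nat_def)

interpretation separated_branching_rep s "l2 Omega" \<pi> Omega ket "\<lambda>i x. 1 / (x + real i)" cf_digit gauss_map
  by (rule gauss_branching_rep)

lemma orbit_eq_modular_class: "x \<in> Omega \<Longrightarrow> orbit x = modular_class x"
  unfolding orbit_def modular_class_def
  by (auto simp: modular_equiv_iff_tail) metis+

lemma H_class_subrepresentation:
  "x \<in> Omega \<Longrightarrow> subrepresentation (l2 Omega) \<pi> (H_class (modular_class x))"
  and H_class_irreducible: "x \<in> Omega \<Longrightarrow> irreducible_rep (H_class (modular_class x)) \<pi>"
  using orbit_subspace_irreducible[of x] by (simp_all add: orbit_eq_modular_class H_class_def)

lemma modular_class_eq_iff:
  "x \<in> Omega \<Longrightarrow> y \<in> Omega \<Longrightarrow> modular_class x = modular_class y \<longleftrightarrow> x \<sim>\<^sub>m y"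
  unfolding modular_class_def using modular_equiv_refl modular_equiv_sym modular_equiv_trans by blast

lemma ket_in_H_class: "y \<in> modular_class x \<Longrightarrow> ket y \<in> H_class (modular_class x)"
  unfolding H_class_def by (rule subsetD[OF subset_closure_cspan imageI])

lemma H_class_eq_iff:
  assumes "x \<in> Omega" "y \<in> Omega"
  shows "H_class (modular_class x) = H_class (modular_class y) \<longleftrightarrow> x \<sim>\<^sub>m y"
proof
  assume eq: "H_class (modular_class x) = H_class (modular_class y)"
  have "ket x \<in> l2 (modular_class y)"
    using ket_in_H_class[of x x] assms modular_equiv_refl eq
    by (simp add: H_class_def l2_eq_closure modular_class_def)
  then have "x \<in> modular_class y" by (auto simp: l2_def ket.rep_eq)
  then show "x \<sim>\<^sub>m y" by (simp add: modular_class_def)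
next
  assume "x \<sim>\<^sub>m y"
  then have "modular_class x = modular_class y" using modular_class_eq_iff[OF assms] by blast
  then show "H_class (modular_class x) = H_class (modular_class y)" by (rule arg_cong)
qed

theorem irreducible_decomposition:
  "orthogonal_direct_sum (l2 Omega) modular_classes H_class"
  unfolding orthogonal_direct_sum_def
proof (intro conjI ballI impI)
  show "closed_csubspace (H_class C)" for C by (simp add: H_class_def closed_csubspace_closure_cspan)
  fix C D v w assume CD: "C \<in> modular_classes" "D \<in> modular_classes" "C \<noteq> D" and vw: "v \<in> H_class C" "w \<in> H_class D"
  have "C \<inter> D = {}"
  proof (rule ccontr)
    assume "C \<inter> D \<noteq> {}"
    then obtain z where z: "z \<in> C" "z \<in> D" by blast
    obtain x y where xy: "x \<in> Omega" "C = modular_class x" "y \<in> Omega" "D = modular_class y"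
      using CD by (auto simp: modular_classes_def)
    then have "z \<sim>\<^sub>m x" "z \<sim>\<^sub>m y" using z by (simp_all add: modular_class_def)
    then have "x \<sim>\<^sub>m y" using modular_equiv_sym modular_equiv_trans by blast
    then show False using CD(3) xy modular_class_eq_iff by blast
  qed
  moreover have "ell2_coeff v a = 0" if "a \<notin> C" for a using vw that by (simp add: H_class_def l2_eq_closure[symmetric] l2_def)
  moreover have "ell2_coeff w a = 0" if "a \<notin> D" for a using vw that by (simp add: H_class_def l2_eq_closure[symmetric] l2_def)
  ultimately show "cinner v w = 0" unfolding cinner_ell2_def by (intro infsum_0) (metis IntI complex_cnj_zero empty_iff mult_eq_0_iff)
next
  show "closure (cspan (\<Union>C\<in>modular_classes. H_class C)) = l2 Omega"
  proof
    show "closure (cspan (\<Union>C\<in>modular_classes. H_class C)) \<subseteq> l2 Omega"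
      using H_class_subrepresentation
      by (intro closure_cspan_minimal closed_csubspace_l2) (auto simp: modular_classes_def subrepresentation_def)
    have "ket ` Omega \<subseteq> (\<Union>C\<in>modular_classes. H_class C)"
    proof safe
      fix x assume x: "x \<in> Omega"
      then have "ket x \<in> H_class (modular_class x)"
        by (intro ket_in_H_class) (simp add: modular_class_def modular_equiv_refl)
      then show "ket x \<in> (\<Union>C\<in>modular_classes. H_class C)" using x by (auto simp: modular_classes_def)
    qed
    then show "l2 Omega \<subseteq> closure (cspan (\<Union>C\<in>modular_classes. H_class C))"
      unfolding l2_eq_closure by (intro closure_mono complex_vector.span_mono)
  qed
qed

lemma unitarily_equivalent_refl:
  fixes K :: "'h::chilbert_space set"
  shows "unitarily_equivalent K \<rho> K \<rho>"
  unfolding unitarily_equivalent_def by (intro exI[of _ "\<lambda>v. v"]) (auto simp: inv_into_f_eq)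

theorem equivalence_of_components:
  assumes "x \<in> Omega" "y \<in> Omega"
  shows "unitarily_equivalent (H_class (modular_class x)) \<pi> (H_class (modular_class y)) \<pi> \<longleftrightarrow> x \<sim>\<^sub>m y"
  using unitarily_equivalent_imp_eq[OF H_class_subrepresentation[OF assms(1)] H_class_subrepresentation[OF assms(2)]]
    H_class_eq_iff[OF assms] unitarily_equivalent_refl by metis

theorem multiplicity_free_l2_Omega: "multiplicity_free (l2 Omega) \<pi>"
  unfolding multiplicity_free_def using unitarily_equivalent_imp_eq by blast

lemma H_class_cyclic:
  assumes "x \<in> Omega" "y \<in> modular_class x"
  shows "cyclic_vector (H_class (modular_class x)) \<pi> (ket y)"
proof -
  interpret M: cuntz_rep s "H_class (modular_class x)" \<pi>
    using H_class_subrepresentation[OF assms(1)] by (rule subrepresentation_cuntz_rep)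
  show ?thesis
    using assms(2) rep_one e_nonzero by (intro M.cyclic_if_irreducible H_class_irreducible assms ket_in_H_class)
      (auto simp: modular_class_def)
qed

lemma H_class_star_rep: "x \<in> Omega \<Longrightarrow> star_rep (H_class (modular_class x)) \<pi>"
  using subrepresentation_cuntz_rep[OF H_class_subrepresentation] by (simp add: cuntz_rep_def)

text \<open>The vector \<open>ket x\<close> is cyclic, and \<open>s\<^sub>J\<^sup>*\<close> for the first \<open>n\<close> digits \<open>J\<close> of \<open>x\<close> moves it to the \<open>n\<close>-th
  point of the Gauss orbit of \<open>x\<close>. These points are distinct, as a repetition would make \<open>x\<close>
  quadratic.\<close>

theorem nonquadratic_P_infinite:
  assumes x: "x \<in> Omega" and nq: "x \<notin> quadratic_irrationals"
  shows "P_infinite s (CFE x) (H_class (modular_class x)) \<pi>"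
  unfolding P_infinite_def
proof (intro conjI allI exI[of _ "ket x"])
  show "CFE x l \<ge> 1" for l by (rule CFE_ge_1[OF x])
  show "star_rep (H_class (modular_class x)) \<pi>" by (rule H_class_star_rep[OF x])
  show "cyclic_vector (H_class (modular_class x)) \<pi> (ket x)"
    using x by (intro H_class_cyclic) (simp_all add: modular_class_def modular_equiv_refl)
  have itin: "map (CFE x) [0..<n] = itin n x" for n using x by (simp add: itin_def CFE_eq)
  have "\<pi> (star (s_word s (map (CFE x) [0..<n]))) (ket x) = ket ((gauss_map ^^ n) x)" for n
    unfolding itin using star_word_basis[OF itin_ge_1[OF x] x, of n] by simp
  moreover have "(gauss_map ^^ m) x = (gauss_map ^^ n) x \<longleftrightarrow> m = n" for m n
    using eventually_periodic_imp_quadratic[OF x] nq by (metis linorder_neqE_nat)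
  ultimately show "orthonormal_family {1..} (\<lambda>n. \<pi> (star (s_word s (map (CFE x) [0..<n]))) (ket x))"
    by (simp add: orthonormal_family_def cinner_ket_ket del: cinner_ket_right)
qed simp

text \<open>The cyclic vector is \<open>ket y\<close> for the tail \<open>y\<close> of \<open>x\<close> that starts with the repeating block.\<close>

theorem quadratic_P_finite:
  assumes x: "x \<in> quadratic_irrationals" and n: "repeating_block (CFE x) n"
  shows "P_finite s n (H_class (modular_class x)) \<pi>"
proof -
  have xO: "x \<in> Omega" using x by (simp add: quadratic_irrationals_def)
  obtain m where m: "eventually_repeats (CFE x) m n" using n by (auto simp: repeating_block_def)
  obtain k y where y: "y = (gauss_map ^^ k) x" "y \<in> Omega" and ge: "\<forall>i\<in>set n. i \<ge> 1"
    and fixed: "foldr (\<lambda>i x. 1 / (x + real i)) n y = y"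
    and drop: "\<And>l. l \<le> length n \<Longrightarrow> foldr (\<lambda>i x. 1 / (x + real i)) (drop l n) y = (gauss_map ^^ l) y"
    and inj: "inj_on (\<lambda>l. (gauss_map ^^ l) y) {..<length n}"
    by (rule repeating_block_point[OF xO m]) (rule that)
  have yx: "y \<in> modular_class x"
    using modular_equiv_funpow[OF xO, of k] y by (simp add: modular_class_def modular_equiv_sym)
  show ?thesis unfolding P_finite_def
  proof (intro conjI exI[of _ "ket y"])
    show "n \<noteq> []" using m by (simp add: eventually_repeats_def)
    show "\<forall>j\<in>set n. 1 \<le> j" by (rule ge)
    show "star_rep (H_class (modular_class x)) \<pi>" by (rule H_class_star_rep[OF xO])
    show "cyclic_vector (H_class (modular_class x)) \<pi> (ket y)" by (rule H_class_cyclic[OF xO yx])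
    show "\<pi> (s_word s n) (ket y) = ket y" using word_basis[OF ge y(2)] fixed by simp
    have "\<pi> (s_word s (drop l n)) (ket y) = ket ((gauss_map ^^ l) y)" if "l < length n" for l
      using word_basis[OF _ y(2), of "drop l n"] ge drop[of l] that by (auto dest: in_set_dropD)
    then show "orthonormal_family {..<length n} (\<lambda>l. \<pi> (s_word s (drop l n)) (ket y))"
      using inj by (auto simp: orthonormal_family_def cinner_ket_ket inj_on_def simp del: cinner_ket_right)
  qed simp
qed

text \<open>Every sequence of positive integers is a continued fraction expansion, so sending a basis
  vector to the number whose digits form its itinerary defines a map \<open>X\<close> into \<open>Omega\<close> that turns the
  generators into the branches. Irreducibility makes \<open>X\<close> injective and the basis a single orbit,
  which \<open>X\<close> maps onto a modular class. Indexing the basis by this class gives the equivalence.\<close>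

theorem irreducible_permutative:
  fixes K :: "'h::chilbert_space set"
  assumes perm: "permutative_rep s K \<rho>" and irr: "irreducible_rep K \<rho>"
  shows "\<exists>x\<in>Omega. unitarily_equivalent K \<rho> (H_class (modular_class x)) \<pi>"
proof -
  have "K \<noteq> {0}" using irr by (simp add: irreducible_rep_def)
  then obtain E :: "'h set" and lab sh where B: "branching_rep s K \<rho> E (\<lambda>x. x) (\<lambda>i. \<rho> (s i)) lab sh" and "E \<noteq> {}"
    using permutative_branching_rep[OF cuntz perm] by blast
  interpret R: branching_rep s K \<rho> E "\<lambda>x. x" "\<lambda>i. \<rho> (s i)" lab sh by fact
  have "\<exists>x\<in>Omega. CFE x = R.code v" if "v \<in> E" for v
    using that by (intro CFE_surj) (auto simp: R.code_def R.lab_ge_1 R.sh_funpow_in simp del: One_nat_def)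
  then obtain X where X: "\<And>v. v \<in> E \<Longrightarrow> X v \<in> Omega" "\<And>v. v \<in> E \<Longrightarrow> CFE (X v) = R.code v" by metis
  have inj: "inj_on X E"
    using R.irreducible_imp_separated[OF irr] X(2) by (metis inj_onI)
  have X_sh: "X (sh v) = gauss_map (X v)" if "v \<in> E" for v
    using X[OF that] X[OF R.sh_in[OF that]] CFE_funpow[OF X(1)[OF that], of 1]
    by (intro CFE_inject) (auto simp: gauss_map_in_Omega R.code_def funpow_swap1)
  have X_lab: "cf_digit (X v) = lab v" if "v \<in> E" for v
    using CFE_eq[OF X(1)[OF that], of 0] X(2)[OF that] by (simp add: R.code_def)
  have X_br: "X (\<rho> (s i) v) = 1 / (X v + real i)" if "i \<ge> 1" "v \<in> E" for i v
    using gauss_map_inverse[OF X(1)[OF R.br_in[OF that]]] X_sh[OF R.br_in[OF that]] X_lab[OF R.br_in[OF that]]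
      R.sh_br[OF that] R.lab_br[OF that] by simp
  have X_sh_pow: "X ((sh ^^ n) v) = (gauss_map ^^ n) (X v)" if "v \<in> E" for n v
    using that by (induction n) (auto simp: X_sh R.sh_funpow_in)
  have X_word: "X (foldr (\<lambda>i. \<rho> (s i)) w v) = foldr (\<lambda>i x. 1 / (x + real i)) w (X v)"
    if "\<forall>i\<in>set w. i \<ge> 1" "v \<in> E" for w v
    using that by (induction w) (auto simp: X_br R.foldr_br_in)
  obtain v\<^sub>0 where v0: "v\<^sub>0 \<in> E" using \<open>E \<noteq> {}\<close> by blast
  define x where "x = X v\<^sub>0"
  have x: "x \<in> Omega" using X v0 by (simp add: x_def)
  have img: "X ` E = modular_class x"
  proof (intro subset_antisym subsetI)
    fix y assume "y \<in> X ` E"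
    then obtain v where v: "v \<in> E" "y = X v" by blast
    have "v \<in> R.orbit v\<^sub>0" using R.irreducible_imp_orbit[OF irr v0] v(1) by simp
    then obtain m n where mn: "(sh ^^ m) v\<^sub>0 = (sh ^^ n) v"
      unfolding R.orbit_def by blast
    have "(gauss_map ^^ m) x = (gauss_map ^^ n) y"
      unfolding x_def v(2) X_sh_pow[OF v0, symmetric] X_sh_pow[OF v(1), symmetric] mn ..
    then have "y \<sim>\<^sub>m x" using modular_equiv_iff_tail[of y x] x X v by metis
    then show "y \<in> modular_class x" using X v by (simp add: modular_class_def)
  next
    fix y assume "y \<in> modular_class x"
    then have y: "y \<in> Omega" "y \<sim>\<^sub>m x" by (auto simp: modular_class_def)
    then obtain m n where mn: "(gauss_map ^^ m) y = (gauss_map ^^ n) x"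
      using modular_equiv_iff_tail x by blast
    define v where "v = foldr (\<lambda>i. \<rho> (s i)) (itin m y) ((sh ^^ n) v\<^sub>0)"
    have "v \<in> E" unfolding v_def by (intro R.foldr_br_in R.sh_funpow_in v0 itin_ge_1 y)
    have "X v = foldr (\<lambda>i x. 1 / (x + real i)) (itin m y) ((gauss_map ^^ m) y)"
      unfolding v_def mn x_def by (simp only: X_word[OF itin_ge_1[OF y(1)] R.sh_funpow_in[OF v0]] X_sh_pow[OF v0])
    also have "\<dots> = y" by (rule foldr_br_itin[OF y(1)])
    finally show "y \<in> X ` E" using \<open>v \<in> E\<close> by blast
  qed
  define C where "C = modular_class x"
  define g where "g = inv_into E X"
  have g: "g c \<in> E" "X (g c) = c" if "c \<in> C" for c
    using that img by (auto simp: g_def C_def inv_into_into f_inv_into_f)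
  have gX: "g (X v) = v" if "v \<in> E" for v using inj that by (simp add: g_def)
  have CO: "C \<subseteq> Omega" by (auto simp: C_def modular_class_def)
  have C_br: "1 / (c + real i) \<in> C" if "c \<in> C" "i \<ge> 1" for c i
    using br_orbit[of i c x] that orbit_eq_modular_class[OF x] by (simp add: C_def)
  have C_sh: "gauss_map c \<in> C" if "c \<in> C" for c
    using sh_orbit[of c x] that orbit_eq_modular_class[OF x] by (simp add: C_def)
  have H: "H_class (modular_class x) = l2 C" by (simp add: H_class_def l2_eq_closure C_def)
  have gE: "g ` C = E" using img gX g by (force simp: C_def)
  have "branching_rep s K \<rho> C g (\<lambda>i x. 1 / (x + real i)) cf_digit gauss_map"
  proof
    show "orthonormal_family C g" using R.cinner_e g by (auto simp: orthonormal_family_def) metis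
    show "closure (cspan (g ` C)) = K" unfolding gE using R.basis by simp
    show "\<rho> (s i) (g c) = g (1 / (c + real i))" if "i \<ge> 1" "c \<in> C" for i c
      using X_br[OF that(1) g(1)[OF that(2)]] g(2)[OF that(2)] gX[OF R.br_in[OF that(1) g(1)[OF that(2)]]] by simp
  qed (use CO in \<open>auto simp: C_br C_sh cf_digit_ge_1 gauss_map_inverse cf_digit_branch gauss_map_branch subset_iff
        simp del: One_nat_def\<close>)
  moreover have "branching_rep s (l2 C) \<pi> C ket (\<lambda>i x. 1 / (x + real i)) cf_digit gauss_map"
  proof
    show "cuntz_algebra_infinity s" by (rule cuntz)
    show "star_rep (l2 C) \<pi>" using H_class_star_rep[OF x] unfolding H .
    show "orthonormal_family C ket"
      by (simp add: orthonormal_family_def cinner_ket_ket del: cinner_ket_right)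
    show "closure (cspan (ket ` C)) = l2 C" by (simp add: l2_eq_closure)
  qed (use CO in \<open>auto simp: act C_br C_sh cf_digit_ge_1 gauss_map_inverse cf_digit_branch gauss_map_branch subset_iff
        simp del: One_nat_def\<close>)
  ultimately have "unitarily_equivalent K \<rho> (l2 C) \<pi>" by (rule unitarily_equivalent_l2)
  then show ?thesis unfolding H[symmetric] using x by blast
qed

end

theorem theorem1p6:
  fixes s :: "nat \<Rightarrow> 'o::cstar_algebra_1"
    and \<pi> :: "'o \<Rightarrow> real ell2 \<Rightarrow> real ell2"
  assumes "cuntz_algebra_infinity s"
    and "star_rep (l2 Omega) \<pi>"
    and "\<And>i x. i \<ge> 1 \<Longrightarrow> x \<in> Omega \<Longrightarrow> \<pi> (s i) (ket x) = ket (1 / (x + real i))"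
  shows
    "(orthogonal_direct_sum (l2 Omega) modular_classes H_class \<and>
      (\<forall>C\<in>modular_classes.
         subrepresentation (l2 Omega) \<pi> (H_class C) \<and> irreducible_rep (H_class C) \<pi>))
     \<and>
     ((\<forall>x\<in>Omega. \<forall>y\<in>Omega.
         unitarily_equivalent (H_class (modular_class x)) \<pi> (H_class (modular_class y)) \<pi>
           \<longleftrightarrow> x \<sim>\<^sub>m y) \<and>
      multiplicity_free (l2 Omega) \<pi>)
     \<and>
     (\<forall>x\<in>Omega - quadratic_irrationals.
         P_infinite s (CFE x) (H_class (modular_class x)) \<pi>)
     \<and>
     (\<forall>x\<in>quadratic_irrationals.
         (\<exists>n. repeating_block (CFE x) n) \<and>
         (\<forall>n. repeating_block (CFE x) n \<longrightarrow>
            P_finite s n (H_class (modular_class x)) \<pi>))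
     \<and>
     (\<forall>(K :: 'h::chilbert_space set) \<rho>.
         permutative_rep s K \<rho> \<and> irreducible_rep K \<rho> \<longrightarrow>
           (\<exists>x\<in>Omega. unitarily_equivalent K \<rho> (H_class (modular_class x)) \<pi>))"
proof (intro conjI ballI allI impI)
  fix C assume "C \<in> modular_classes"
  then obtain x where x: "x \<in> Omega" "C = modular_class x" by (auto simp: modular_classes_def)
  show "subrepresentation (l2 Omega) \<pi> (H_class C)" "irreducible_rep (H_class C) \<pi>"
    unfolding x(2) using H_class_subrepresentation[OF assms x(1)] H_class_irreducible[OF assms x(1)] by auto
next
  fix x y assume "x \<in> Omega" "y \<in> Omega"
  then show "unitarily_equivalent (H_class (modular_class x)) \<pi> (H_class (modular_class y)) \<pi> \<longleftrightarrow> x \<sim>\<^sub>m y"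
    by (simp only: equivalence_of_components[OF assms])
next
  fix x assume "x \<in> Omega - quadratic_irrationals"
  then show "P_infinite s (CFE x) (H_class (modular_class x)) \<pi>"
    using nonquadratic_P_infinite[OF assms] by blast
next
  fix x assume x: "x \<in> quadratic_irrationals"
  show "\<exists>n. repeating_block (CFE x) n" by (rule exists_repeating_block[OF x])
  fix n assume "repeating_block (CFE x) n"
  then show "P_finite s n (H_class (modular_class x)) \<pi>" using quadratic_P_finite[OF assms x] by blast
next
  fix K :: "'h set" and \<rho> assume "permutative_rep s K \<rho> \<and> irreducible_rep K \<rho>"
  then show "\<exists>x\<in>Omega. unitarily_equivalent K \<rho> (H_class (modular_class x)) \<pi>"
    using irreducible_permutative[OF assms] by blast
qed (use irreducible_decomposition[OF assms] multiplicity_free_l2_Omega[OF assms] in blast)+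

end
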